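(* Every finitely generated $\mathbb{Z}^r$-graded $B$-saturated $S$-module $M$ has a virtual resolution of length at most $|\mathbf{n}| := n_1+n_2+\dotsb+n_r = \dim \mathbb{P}^{\mathbf{n}}$.
   Context: Let $\Bbbk$ be a field, $\mathbf{n}=(n_1,\dotsc,n_r)\in\mathbb{N}^r$, and $\mathbb{P}^{\mathbf{n}}=\mathbb{P}^{n_1}\times\dotsb\times\mathbb{P}^{n_r}$ over $\Bbbk$. Its Cox ring is $S=\Bbbk[x_{i,j}: 1\le i\le r,\ 0\le j\le n_i]$, graded by $\operatorname{Pic}(\mathbb{P}^{\mathbf{n}})=\mathbb{Z}^r$ via $\deg(x_{i,j})=\mathbf{e}_i$ (the $i$-th standard basis vector), and its irrelevant ideal is $B=\bigcap_{i=1}^r\langle x_{i,0},x_{i,1},\dotsc,x_{i,n_i}\rangle$. A graded $S$-module $M$ determines a quasi-coherent sheaf $\widetilde{M}$ on $\mathbb{P}^{\mathbf{n}}$ (on the open set where a product $x_{1,j_1}\dotsb x_{r,j_r}$ is nonzero, its sections are the degree-$\mathbf{0}$ part of the localization of $M$ at that product). $M$ is $B$-saturated if $H^0_B(M)=0$. A complex $F=[F_0\leftarrow F_1\leftarrow F_2\leftarrow\dotsb]$ of finitely generated $\mathbb{Z}^r$-graded free $S$-modules is a virtual resolution of $M$ if the complex of vector bundles $\widetilde{F}$ is a locally free resolution of $\widetilde{M}$. Its length is the largest $p$ with $F_p\neq0$. *)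

theory Defs
  imports
    "HOL-Algebra.Ideal_Product"
    "HOL-Algebra.Module"
    "HOL-Library.Poly_Mapping"
    "HOL-Library.Extended_Nat"
begin

text \<open>
  A tuple of dimensions is a list \<open>n\<close>, so \<open>r = length n\<close> and the factors are numbered
  \<open>0, \<dots>, r - 1\<close>.  The variable \<open>x_{i,j}\<close> is the pair \<open>(i, j)\<close>.
\<close>

type_synonym exponent = "nat \<times> nat \<Rightarrow>\<^sub>0 nat"
type_synonym multidegree = "nat \<Rightarrow>\<^sub>0 int"
type_synonym 'k cox_poly = "exponent \<Rightarrow>\<^sub>0 'k"

definition variables :: "nat list \<Rightarrow> (nat \<times> nat) set" where
  "variables n = {(i, j). i < length n \<and> j \<le> n ! i}"

text \<open>The group \<open>\<int>\<^sup>r\<close>, as the subgroup of multidegrees supported on \<open>{..<r}\<close>.\<close>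

definition multidegrees :: "nat list \<Rightarrow> multidegree set" where
  "multidegrees n = {d. Poly_Mapping.keys d \<subseteq> {..<length n}}"

definition exponent_degree :: "exponent \<Rightarrow> multidegree" where
  "exponent_degree \<mu> =
     (\<Sum>v \<in> Poly_Mapping.keys \<mu>. Poly_Mapping.single (fst v) (int (Poly_Mapping.lookup \<mu> v)))"

definition var :: "nat \<Rightarrow> nat \<Rightarrow> 'k::field cox_poly" where
  "var i j = Poly_Mapping.single (Poly_Mapping.single (i, j) 1) 1"


section \<open>The Cox ring and graded modules over it\<close>

text \<open>
  Only the values of \<^term>\<open>component\<close> at multidegrees in \<open>\<int>\<^sup>r\<close> are meaningful.  As usual for
  the record type of modules, the fields \<^term>\<open>mult\<close> and \<^term>\<open>one\<close> of a module carry no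
  information, except for the Cox ring, which is at the same time the base ring and a graded
  module over itself.
\<close>

record ('a, 'b) graded_module = "('a, 'b) module" +
  component :: "multidegree \<Rightarrow> 'b set"

definition cox :: "nat list \<Rightarrow> ('k::field cox_poly, 'k cox_poly) graded_module" where
  "cox n =
     (let S = {f. \<forall>\<mu> \<in> Poly_Mapping.keys f. Poly_Mapping.keys \<mu> \<subseteq> variables n} in
      \<lparr>carrier = S, mult = (*), one = 1, zero = 0, add = (+), smult = (*),
       component = (\<lambda>d. {f \<in> S. \<forall>\<mu> \<in> Poly_Mapping.keys f. exponent_degree \<mu> = d})\<rparr>)"

text \<open>
  The last condition says that \<open>M\<close> is the direct sum of its components: \<open>c\<close> is the family of
  homogeneous components of \<open>m\<close>.
\<close>

definition graded_module ::
  "nat list \<Rightarrow> ('k::field cox_poly, 'm) graded_module \<Rightarrow> bool" where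
  "graded_module n M \<longleftrightarrow>
     Module.module (cox n) M \<and>
     (\<forall>d \<in> multidegrees n. additive_subgroup (component M d) M) \<and>
     (\<forall>d \<in> multidegrees n. \<forall>e \<in> multidegrees n.
        \<forall>f \<in> component (cox n) d. \<forall>m \<in> component M e. f \<odot>\<^bsub>M\<^esub> m \<in> component M (d + e)) \<and>
     (\<forall>m \<in> carrier M. \<exists>!c.
        (\<forall>d \<in> multidegrees n. c d \<in> component M d) \<and>
        (\<forall>d. d \<notin> multidegrees n \<longrightarrow> c d = \<zero>\<^bsub>M\<^esub>) \<and>
        finite {d. c d \<noteq> \<zero>\<^bsub>M\<^esub>} \<and>
        m = (\<Oplus>\<^bsub>M\<^esub> d \<in> {d. c d \<noteq> \<zero>\<^bsub>M\<^esub>}. c d))"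

definition homogeneous_elements ::
  "nat list \<Rightarrow> ('k::field cox_poly, 'm) graded_module \<Rightarrow> 'm set" where
  "homogeneous_elements n M = (\<Union>d \<in> multidegrees n. component M d)"

definition finitely_generated ::
  "('a, 'c) ring_scheme \<Rightarrow> ('a, 'm, 'd) module_scheme \<Rightarrow> bool" where
  "finitely_generated R M \<longleftrightarrow>
     (\<exists>A. finite A \<and> A \<subseteq> carrier M \<and>
        (\<forall>m \<in> carrier M. \<exists>c \<in> A \<rightarrow> carrier R. m = (\<Oplus>\<^bsub>M\<^esub> a \<in> A. c a \<odot>\<^bsub>M\<^esub> a)))"

text \<open>Finitely generated graded free: there is a finite basis of homogeneous elements.\<close>

definition fg_graded_free ::
  "nat list \<Rightarrow> ('k::field cox_poly, 'm) graded_module \<Rightarrow> bool" where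
  "fg_graded_free n M \<longleftrightarrow>
     graded_module n M \<and>
     (\<exists>A. finite A \<and> A \<subseteq> homogeneous_elements n M \<and>
        (\<forall>m \<in> carrier M. \<exists>!c. c \<in> A \<rightarrow>\<^sub>E carrier (cox n) \<and> m = (\<Oplus>\<^bsub>M\<^esub> a \<in> A. c a \<odot>\<^bsub>M\<^esub> a)))"

definition module_hom ::
  "('a, 'c) ring_scheme \<Rightarrow> ('a, 'm, 'd) module_scheme \<Rightarrow> ('a, 'n, 'e) module_scheme
     \<Rightarrow> ('m \<Rightarrow> 'n) set" where
  "module_hom R M N =
     {h \<in> carrier M \<rightarrow> carrier N.
        (\<forall>x \<in> carrier M. \<forall>y \<in> carrier M. h (x \<oplus>\<^bsub>M\<^esub> y) = h x \<oplus>\<^bsub>N\<^esub> h y) \<and>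
        (\<forall>a \<in> carrier R. \<forall>x \<in> carrier M. h (a \<odot>\<^bsub>M\<^esub> x) = a \<odot>\<^bsub>N\<^esub> h x)}"

definition graded_hom ::
  "nat list \<Rightarrow> ('k::field cox_poly, 'm) graded_module \<Rightarrow> ('k cox_poly, 'n) graded_module
     \<Rightarrow> ('m \<Rightarrow> 'n) set" where
  "graded_hom n M N =
     {h \<in> module_hom (cox n) M N. \<forall>d \<in> multidegrees n. h ` component M d \<subseteq> component N d}"

definition irrelevant_ideal :: "nat list \<Rightarrow> 'k::field cox_poly set" where
  "irrelevant_ideal n =
     carrier (cox n) \<inter> (\<Inter>i < length n. genideal (cox n) {var i j | j. j \<le> n ! i})"

text \<open>\<open>H\<^sup>0\<^sub>B(M)\<close>: the elements annihilated by some power of \<open>B\<close>.\<close>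

definition B_torsion ::
  "nat list \<Rightarrow> ('k::field cox_poly, 'm) graded_module \<Rightarrow> 'm set" where
  "B_torsion n M =
     {m \<in> carrier M. \<exists>k::nat.
        \<forall>b \<in> irrelevant_ideal n [^]\<^bsub>ideals_set (cox n)\<^esub> k. b \<odot>\<^bsub>M\<^esub> m = \<zero>\<^bsub>M\<^esub>}"

definition B_saturated ::
  "nat list \<Rightarrow> ('k::field cox_poly, 'm) graded_module \<Rightarrow> bool" where
  "B_saturated n M \<longleftrightarrow> B_torsion n M = {\<zero>\<^bsub>M\<^esub>}"


section \<open>The product of projective spaces and the sheaf of a graded module\<close>

text \<open>
  The product of projective spaces is the space of homogeneous primes of the Cox ring not
  containing the irrelevant ideal, with the Zariski topology.  The sheaf of \<open>M\<close> is built as for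
  Proj: the stalk at \<open>P\<close> is the degree zero part of the localization of \<open>M\<close> at the homogeneous
  elements outside \<open>P\<close>, and the sections over an open set are the functions into the stalks
  that are locally given by a single fraction.  Over the open set where
  \<open>g = x_{1,j_1} \<cdots> x_{r,j_r}\<close> does not vanish this gives the degree zero part of
  the localization of \<open>M\<close> at \<open>g\<close>.
\<close>

type_synonym 'k point = "'k cox_poly set"

definition homogeneous_ideal :: "nat list \<Rightarrow> 'k::field cox_poly set \<Rightarrow> bool" where
  "homogeneous_ideal n I \<longleftrightarrow>
     ideal I (cox n) \<and> I = genideal (cox n) (I \<inter> homogeneous_elements n (cox n))"

definition proj_points :: "nat list \<Rightarrow> 'k::field point set" where
  "proj_points n =
     {P. primeideal P (cox n) \<and> homogeneous_ideal n P \<and> \<not> irrelevant_ideal n \<subseteq> P}"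

definition zariski_open :: "nat list \<Rightarrow> 'k::field point set \<Rightarrow> bool" where
  "zariski_open n U \<longleftrightarrow>
     (\<exists>A \<subseteq> carrier (cox n). U = {P \<in> proj_points n. \<not> A \<subseteq> P})"

text \<open>
  The germ \<open>m / f\<close> at \<open>P\<close>, for \<open>m\<close> and \<open>f\<close> homogeneous of the same degree with \<open>f \<notin> P\<close>, as
  the equivalence class of all pairs representing it.
\<close>

definition germ ::
  "nat list \<Rightarrow> ('k::field cox_poly, 'm) graded_module \<Rightarrow> 'k point \<Rightarrow> 'm \<Rightarrow> 'k cox_poly
     \<Rightarrow> ('m \<times> 'k cox_poly) set" where
  "germ n M P m f =
     {(m', f'). \<exists>d \<in> multidegrees n. m' \<in> component M d \<and> f' \<in> component (cox n) d \<and> f' \<notin> P \<and>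
        (\<exists>h \<in> homogeneous_elements n (cox n). h \<notin> P \<and>
           h \<odot>\<^bsub>M\<^esub> (f' \<odot>\<^bsub>M\<^esub> m) = h \<odot>\<^bsub>M\<^esub> (f \<odot>\<^bsub>M\<^esub> m'))}"

definition stalk ::
  "nat list \<Rightarrow> ('k::field cox_poly, 'm) graded_module \<Rightarrow> 'k point \<Rightarrow> ('m \<times> 'k cox_poly) set set" where
  "stalk n M P =
     {germ n M P m f | m f d.
        d \<in> multidegrees n \<and> m \<in> component M d \<and> f \<in> component (cox n) d \<and> f \<notin> P}"

text \<open>
  The operations on germs take the union over all representatives; these unions are over equal
  sets, because the germ obtained does not depend on the representatives.
\<close>

definition germ_add ::
  "nat list \<Rightarrow> ('k::field cox_poly, 'm) graded_module \<Rightarrow> 'k point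
     \<Rightarrow> ('m \<times> 'k cox_poly) set \<Rightarrow> ('m \<times> 'k cox_poly) set \<Rightarrow> ('m \<times> 'k cox_poly) set" where
  "germ_add n M P s t =
     (\<Union>(m, f) \<in> s. \<Union>(m', f') \<in> t. germ n M P (f' \<odot>\<^bsub>M\<^esub> m \<oplus>\<^bsub>M\<^esub> f \<odot>\<^bsub>M\<^esub> m') (f * f'))"

definition germ_smult ::
  "nat list \<Rightarrow> ('k::field cox_poly, 'm) graded_module \<Rightarrow> 'k point
     \<Rightarrow> ('k cox_poly \<times> 'k cox_poly) set \<Rightarrow> ('m \<times> 'k cox_poly) set \<Rightarrow> ('m \<times> 'k cox_poly) set" where
  "germ_smult n M P a s = (\<Union>(b, g) \<in> a. \<Union>(m, f) \<in> s. germ n M P (b \<odot>\<^bsub>M\<^esub> m) (g * f))"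

definition sections ::
  "nat list \<Rightarrow> ('k::field cox_poly, 'm) graded_module \<Rightarrow> 'k point set
     \<Rightarrow> ('k point \<Rightarrow> ('m \<times> 'k cox_poly) set) set" where
  "sections n M U =
     {s \<in> (\<Pi>\<^sub>E P \<in> U. stalk n M P).
        \<forall>P \<in> U. \<exists>V. zariski_open n V \<and> P \<in> V \<and> V \<subseteq> U \<and>
          (\<exists>d \<in> multidegrees n. \<exists>m \<in> component M d. \<exists>f \<in> component (cox n) d.
             \<forall>Q \<in> V. f \<notin> Q \<and> s Q = germ n M Q m f)}"

text \<open>
  Sheaves are represented by their modules of sections over the Zariski open sets, the sections
  being functions on points and the restriction maps being restriction of functions.
\<close>

type_synonym 'k regular_function = "'k point \<Rightarrow> ('k cox_poly \<times> 'k cox_poly) set"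
type_synonym ('k, 'c) sheaf = "'k point set \<Rightarrow> ('k regular_function, 'k point \<Rightarrow> 'c) module"

definition sheaf_of ::
  "nat list \<Rightarrow> ('k::field cox_poly, 'm) graded_module \<Rightarrow> ('k, ('m \<times> 'k cox_poly) set) sheaf" where
  "sheaf_of n M U =
     \<lparr>carrier = sections n M U, mult = undefined, one = undefined,
      zero = (\<lambda>P \<in> U. germ n M P \<zero>\<^bsub>M\<^esub> 1),
      add = (\<lambda>s t. \<lambda>P \<in> U. germ_add n M P (s P) (t P)),
      smult = (\<lambda>a s. \<lambda>P \<in> U. germ_smult n M P (a P) (s P))\<rparr>"

definition structure_sheaf ::
  "nat list \<Rightarrow> ('k::field, ('k cox_poly \<times> 'k cox_poly) set) sheaf" where
  "structure_sheaf n U =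
     (sheaf_of n (cox n) U)
       \<lparr>mult := smult (sheaf_of n (cox n) U), one := (\<lambda>P \<in> U. germ n (cox n) P 1 1)\<rparr>"

definition sheaf_morphism ::
  "nat list \<Rightarrow> ('k::field, 'c) sheaf \<Rightarrow> ('k, 'd) sheaf
     \<Rightarrow> ('k point set \<Rightarrow> ('k point \<Rightarrow> 'c) \<Rightarrow> ('k point \<Rightarrow> 'd)) \<Rightarrow> bool" where
  "sheaf_morphism n \<F> \<G> \<phi> \<longleftrightarrow>
     (\<forall>U. zariski_open n U \<longrightarrow> \<phi> U \<in> module_hom (structure_sheaf n U) (\<F> U) (\<G> U)) \<and>
     (\<forall>U V. zariski_open n U \<and> zariski_open n V \<and> V \<subseteq> U \<longrightarrow>
        (\<forall>s \<in> carrier (\<F> U). \<phi> V (restrict s V) = restrict (\<phi> U s) V))"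

text \<open>The section \<open>s\<close> over \<open>U\<close> lies in the image sheaf of \<open>\<phi>\<close>, i.e. locally has preimages.\<close>

definition in_image_sheaf ::
  "nat list \<Rightarrow> ('k::field, 'c) sheaf
     \<Rightarrow> ('k point set \<Rightarrow> ('k point \<Rightarrow> 'c) \<Rightarrow> ('k point \<Rightarrow> 'd))
     \<Rightarrow> 'k point set \<Rightarrow> ('k point \<Rightarrow> 'd) \<Rightarrow> bool" where
  "in_image_sheaf n \<F> \<phi> U s \<longleftrightarrow>
     (\<forall>P \<in> U. \<exists>V. zariski_open n V \<and> P \<in> V \<and> V \<subseteq> U \<and>
        (\<exists>t \<in> carrier (\<F> V). \<phi> V t = restrict s V))"

definition sheaf_surjective ::
  "nat list \<Rightarrow> ('k::field, 'c) sheaf \<Rightarrow> ('k, 'd) sheaf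
     \<Rightarrow> ('k point set \<Rightarrow> ('k point \<Rightarrow> 'c) \<Rightarrow> ('k point \<Rightarrow> 'd)) \<Rightarrow> bool" where
  "sheaf_surjective n \<F> \<G> \<phi> \<longleftrightarrow>
     (\<forall>U. zariski_open n U \<longrightarrow> (\<forall>s \<in> carrier (\<G> U). in_image_sheaf n \<F> \<phi> U s))"

text \<open>Exactness of \<open>\<F> \<rightarrow> \<G> \<rightarrow> \<H>\<close> at \<open>\<G>\<close>: the image sheaf is the kernel sheaf.\<close>

definition sheaf_exact ::
  "nat list \<Rightarrow> ('k::field, 'c) sheaf \<Rightarrow> ('k, 'd) sheaf \<Rightarrow> ('k, 'e) sheaf
     \<Rightarrow> ('k point set \<Rightarrow> ('k point \<Rightarrow> 'c) \<Rightarrow> ('k point \<Rightarrow> 'd))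
     \<Rightarrow> ('k point set \<Rightarrow> ('k point \<Rightarrow> 'd) \<Rightarrow> ('k point \<Rightarrow> 'e)) \<Rightarrow> bool" where
  "sheaf_exact n \<F> \<G> \<H> \<phi> \<psi> \<longleftrightarrow>
     (\<forall>U. zariski_open n U \<longrightarrow>
        (\<forall>s \<in> carrier (\<G> U). in_image_sheaf n \<F> \<phi> U s \<longleftrightarrow> \<psi> U s = \<zero>\<^bsub>\<H> U\<^esub>))"

text \<open>The morphism of sheaves induced by a graded homomorphism \<open>h\<close> into \<open>N\<close>.\<close>

definition sheaf_map ::
  "nat list \<Rightarrow> ('k::field cox_poly, 'n) graded_module \<Rightarrow> ('m \<Rightarrow> 'n)
     \<Rightarrow> 'k point set \<Rightarrow> ('k point \<Rightarrow> ('m \<times> 'k cox_poly) set)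
     \<Rightarrow> ('k point \<Rightarrow> ('n \<times> 'k cox_poly) set)" where
  "sheaf_map n N h U s = (\<lambda>P \<in> U. \<Union>(m, f) \<in> s P. germ n N P (h m) f)"


section \<open>Virtual resolutions\<close>

definition fg_free_complex ::
  "nat list \<Rightarrow> (nat \<Rightarrow> ('k::field cox_poly, 'f) graded_module) \<Rightarrow> (nat \<Rightarrow> 'f \<Rightarrow> 'f) \<Rightarrow> bool" where
  "fg_free_complex n F \<delta> \<longleftrightarrow>
     (\<forall>p. fg_graded_free n (F p)) \<and>
     (\<forall>p. \<delta> p \<in> graded_hom n (F (Suc p)) (F p)) \<and>
     (\<forall>p. \<forall>x \<in> carrier (F (Suc (Suc p))). \<delta> p (\<delta> (Suc p) x) = \<zero>\<^bsub>F p\<^esub>)"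

text \<open>
  The augmentation \<open>\<epsilon>\<close> is an arbitrary morphism of sheaves; it need not be induced by a
  homomorphism of modules from \<open>F\<^sub>0\<close> to \<open>M\<close>.  That the terms of the complex of sheaves are locally
  free follows from the freeness of the modules \<open>F\<^sub>p\<close>.
\<close>

definition virtual_resolution ::
  "nat list \<Rightarrow> ('k::field cox_poly, 'm) graded_module
     \<Rightarrow> (nat \<Rightarrow> ('k cox_poly, 'f) graded_module) \<Rightarrow> (nat \<Rightarrow> 'f \<Rightarrow> 'f) \<Rightarrow> bool" where
  "virtual_resolution n M F \<delta> \<longleftrightarrow>
     fg_free_complex n F \<delta> \<and>
     (\<exists>\<epsilon>. sheaf_morphism n (sheaf_of n (F 0)) (sheaf_of n M) \<epsilon> \<and>
        sheaf_surjective n (sheaf_of n (F 0)) (sheaf_of n M) \<epsilon> \<and>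
        sheaf_exact n (sheaf_of n (F 1)) (sheaf_of n (F 0)) (sheaf_of n M)
          (sheaf_map n (F 0) (\<delta> 0)) \<epsilon>) \<and>
     (\<forall>p. sheaf_exact n (sheaf_of n (F (Suc (Suc p)))) (sheaf_of n (F (Suc p))) (sheaf_of n (F p))
        (sheaf_map n (F (Suc p)) (\<delta> (Suc p))) (sheaf_map n (F p) (\<delta> p)))"

text \<open>
  The supremum in \<^typ>\<open>enat\<close> is the largest \<open>p\<close> with \<open>F\<^sub>p \<noteq> 0\<close> if there is one, \<open>0\<close> for the
  zero complex and \<open>\<infinity>\<close> for an unbounded complex.
\<close>

definition complex_length :: "(nat \<Rightarrow> ('a, 'f) graded_module) \<Rightarrow> enat" where
  "complex_length F = Sup (enat ` {p. carrier (F p) \<noteq> {\<zero>\<^bsub>F p\<^esub>}})"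

end

theory Submission
  imports Defs "HOL-Library.Function_Algebras"
begin

text \<open>
  The sheaf of \<open>M\<close> does not change if \<open>M\<close> is replaced by a truncation, the submodule of the
  elements whose degree is at least \<open>d\<^sub>i\<close> in every factor \<open>i\<close>: at a point of the product of projective
  spaces some variable of each factor does not vanish, and a monomial in these variables moves any
  homogeneous element into the truncation.  The theorem follows because, for suitable \<open>d\<close>, the
  truncation has an honest free resolution \<open>F\<^sub>0 \<leftarrow> \<dots> \<leftarrow> F\<^bsub>|n|\<^esub>\<close>.

  Hilbert's syzygy theorem allows one step for each of the \<open>n\<^sub>i + 1\<close> variables of factor \<open>i\<close>; the point
  is that a truncation saves one step in every factor.  Let \<open>x\<close> be a variable of the first factor
  and \<open>N\<close> a finitely generated graded module.
  \<^item> If \<open>x\<close> kills \<open>N\<close>, then \<open>N\<close> is a module over the other variables, and a resolution over them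
    becomes one over all variables at the price of one step (\<open>has_res_add_variable\<close>).
  \<^item> If \<open>x\<close> is a nonzerodivisor on \<open>N\<close>, let \<open>T\<close> be the part of \<open>N\<close> of degree at least \<open>\<delta>\<close> in the first
    factor, truncated in the other factors as well.  A resolution of \<open>T/xT\<close> over the variables
    other than \<open>x\<close> lifts to one of \<open>T\<close> without any loss (\<open>has_res_lift\<close>).  Now \<open>T/xT\<close> is an extension
    of the strand of \<open>T\<close> of degree exactly \<open>\<delta>\<close> by a truncation of \<open>N/xN\<close>.  The strand is a module over
    the variables of the later factors, and the variables of the first factor other than \<open>x\<close>
    kill it modulo higher degrees, so they cost \<open>n\<^sub>1\<close> steps; the truncation of \<open>N/xN\<close> is
    handled by induction on the number of variables (\<open>has_res_truncation_torsion_free\<close>).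
  \<^item> In general the elements killed by a power of \<open>x\<close> form a submodule that is killed by a single
    power, by the Hilbert basis theorem (\<open>noetherian\<close>), and extensions are dealt with by the
    horseshoe lemma (\<open>has_res_horseshoe\<close>).

  When no variable of the first factor is left, high truncations vanish.  The bounds \<open>d\<close> depend
  on each other: a strand is chosen first, and how far the later factors must be truncated depends
  on it.  The theorem \<open>truncation\<close> therefore holds for all large \<open>d\<^sub>1\<close>, then all large \<open>d\<^sub>2\<close> depending on \<open>d\<^sub>1\<close>, and
  so on; this notion of largeness is closed under intersections, which the use of extensions requires.

  All modules are subquotients of free modules of vectors of polynomials.  A pair of submodules \<open>Z\<close>, \<open>K\<close>
  stands for the module \<open>(Z + K)/K\<close>, so that quotients are never formed.
  Passing to sheaves only uses that a form that does not vanish at a point can be inverted there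
  (\<open>sheaf_map_surjective\<close> and \<open>sheaf_map_exact\<close>).
\<close>

section \<open>Polynomials and their exponents\<close>

abbreviation "lookup \<equiv> Poly_Mapping.lookup"
abbreviation "keys \<equiv> Poly_Mapping.keys"
abbreviation "single \<equiv> Poly_Mapping.single"

lemma poly_eq_sum_monomials: "f = (\<Sum>\<mu>\<in>keys f. single \<mu> (lookup f \<mu>))"
  by (rule poly_mapping_eqI)
     (auto simp: lookup_sum lookup_single when_def in_keys_iff sum.delta')

lemma poly_induct [consumes 1, case_names zero add monomial]:
  fixes f :: "'a \<Rightarrow>\<^sub>0 'b::comm_monoid_add"
  assumes "f \<in> {f. \<forall>\<mu>\<in>keys f. Q \<mu>}"
    and "P 0" and "\<And>f g. P f \<Longrightarrow> P g \<Longrightarrow> P (f + g)" and "\<And>\<mu> a. Q \<mu> \<Longrightarrow> a \<noteq> 0 \<Longrightarrow> P (single \<mu> a)"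
  shows "P f"
proof -
  have "P (\<Sum>\<mu>\<in>A. single \<mu> (lookup f \<mu>))" if "finite A" "A \<subseteq> keys f" for A
    using that
  proof (induction A rule: finite_induct)
    case (insert x A)
    then show ?case using assms by (auto simp: in_keys_iff)
  qed (use assms in auto)
  then show ?thesis using poly_eq_sum_monomials[of f] by (metis finite_keys order_refl)
qed

text \<open>
  Keeping only some monomials is the common form of taking homogeneous parts, of truncating
  and of setting a variable to zero.
\<close>

definition filter_terms :: "('a \<Rightarrow> bool) \<Rightarrow> ('a \<Rightarrow>\<^sub>0 'b::zero) \<Rightarrow> ('a \<Rightarrow>\<^sub>0 'b)" where
  "filter_terms Q f = Abs_poly_mapping (\<lambda>\<mu>. lookup f \<mu> when Q \<mu>)"

lemma lookup_filter_terms: "lookup (filter_terms Q f) \<mu> = (lookup f \<mu> when Q \<mu>)"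
proof -
  have "finite {\<mu>. (lookup f \<mu> when Q \<mu>) \<noteq> 0}"
    by (rule finite_subset[OF _ finite_lookup[of f]]) auto
  then show ?thesis by (simp add: filter_terms_def)
qed

lemma keys_filter_terms: "keys (filter_terms Q f) = {\<mu> \<in> keys f. Q \<mu>}"
  by (auto simp: in_keys_iff lookup_filter_terms)

lemma filter_terms_zero [simp]: "filter_terms Q 0 = 0"
  by (rule poly_mapping_eqI) (simp add: lookup_filter_terms)

lemma filter_terms_add: "filter_terms Q (f + g) = filter_terms Q f + filter_terms Q (g :: 'a \<Rightarrow>\<^sub>0 'b::monoid_add)"
  by (rule poly_mapping_eqI) (simp add: lookup_filter_terms lookup_add when_def)

lemma filter_terms_diff: "filter_terms Q (f - g) = filter_terms Q f - filter_terms Q (g :: 'a \<Rightarrow>\<^sub>0 'b::ab_group_add)"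
  by (rule poly_mapping_eqI) (simp add: lookup_filter_terms lookup_minus when_def)

lemma filter_terms_filter_terms: "filter_terms Q (filter_terms R f) = filter_terms (\<lambda>\<mu>. Q \<mu> \<and> R \<mu>) f"
  by (rule poly_mapping_eqI) (simp add: lookup_filter_terms when_def)

lemma filter_terms_eq_iff: "filter_terms Q f = f \<longleftrightarrow> (\<forall>\<mu>\<in>keys f. Q \<mu>)"
proof
  assume "filter_terms Q f = f" then show "\<forall>\<mu>\<in>keys f. Q \<mu>" using keys_filter_terms[of Q f] by auto
next
  assume "\<forall>\<mu>\<in>keys f. Q \<mu>" then show "filter_terms Q f = f"
    by (intro poly_mapping_eqI) (auto simp: lookup_filter_terms when_def in_keys_iff)
qed

lemma filter_terms_eq_0_iff: "filter_terms Q f = 0 \<longleftrightarrow> (\<forall>\<mu>\<in>keys f. \<not> Q \<mu>)"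
proof
  assume "filter_terms Q f = 0" then show "\<forall>\<mu>\<in>keys f. \<not> Q \<mu>" using keys_filter_terms[of Q f] by auto
next
  assume "\<forall>\<mu>\<in>keys f. \<not> Q \<mu>" then show "filter_terms Q f = 0"
    by (intro poly_mapping_eqI) (auto simp: lookup_filter_terms when_def in_keys_iff)
qed

text \<open>
  The function \<open>w\<close> is an additive weight of exponents: the degree, or the exponent of one
  variable.  A factor that is homogeneous for \<open>w\<close> only shifts weights, so selecting terms by their
  weight commutes with multiplication by it.
\<close>

lemma filter_terms_mult:
  fixes f g :: "'k::field cox_poly" and w :: "exponent \<Rightarrow> 'd::comm_monoid_add"
  assumes w: "\<And>\<mu> \<nu>. w (\<mu> + \<nu>) = w \<mu> + w \<nu>" and f: "\<forall>\<mu>\<in>keys f. w \<mu> = e"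
  shows "filter_terms (\<lambda>\<mu>. P (w \<mu>)) (f * g) = f * filter_terms (\<lambda>\<mu>. P (e + w \<mu>)) g"
proof -
  have "g \<in> {g. \<forall>\<mu>\<in>keys g. True}" by simp
  then show ?thesis
  proof (induction g rule: poly_induct)
    case (monomial \<mu> a)
    have k: "w \<nu> = e + w \<mu>" if "\<nu> \<in> keys (f * single \<mu> a)" for \<nu>
      using subsetD[OF keys_mult that] f w by (auto split: if_splits)
    show ?case
    proof (cases "P (e + w \<mu>)")
      case True
      then have "filter_terms (\<lambda>\<mu>. P (w \<mu>)) (f * single \<mu> a) = f * single \<mu> a"
        using k by (simp add: filter_terms_eq_iff)
      moreover have "filter_terms (\<lambda>\<mu>. P (e + w \<mu>)) (single \<mu> a) = single \<mu> a"
        using True by (simp add: filter_terms_eq_iff)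
      ultimately show ?thesis by simp
    next
      case False
      then have "filter_terms (\<lambda>\<mu>. P (w \<mu>)) (f * single \<mu> a) = 0"
        using k by (simp add: filter_terms_eq_0_iff)
      moreover have "filter_terms (\<lambda>\<mu>. P (e + w \<mu>)) (single \<mu> a) = 0"
        using False by (simp add: filter_terms_eq_0_iff)
      ultimately show ?thesis by simp
    qed
  qed (simp_all add: distrib_left filter_terms_add)
qed

definition polys :: "(nat \<times> nat) set \<Rightarrow> 'k::field cox_poly set" where
  "polys W = {f. \<forall>\<mu> \<in> keys f. keys \<mu> \<subseteq> W}"

lemma keys_exponent_add: "keys (\<mu> + \<nu>) = keys \<mu> \<union> keys (\<nu> :: exponent)"
  by (auto simp: in_keys_iff lookup_add)

lemma polys_0 [simp]: "0 \<in> polys W" and polys_1 [simp]: "1 \<in> polys W"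
  by (auto simp: polys_def)

lemma polys_add: "f \<in> polys W \<Longrightarrow> g \<in> polys W \<Longrightarrow> f + g \<in> polys W"
  using keys_add[of f g] by (auto simp: polys_def)

lemma polys_uminus: "f \<in> polys W \<Longrightarrow> - f \<in> polys W"
  by (auto simp: polys_def in_keys_iff)

lemma polys_diff: "f \<in> polys W \<Longrightarrow> g \<in> polys W \<Longrightarrow> f - g \<in> polys W"
  using polys_add[of f W "- g"] polys_uminus by auto

lemma polys_mult: "f \<in> polys W \<Longrightarrow> g \<in> polys W \<Longrightarrow> f * g \<in> polys W"
  using keys_mult[of f g] unfolding polys_def keys_exponent_add
  by (fastforce simp: keys_exponent_add)

lemma polys_mono: "V \<subseteq> W \<Longrightarrow> polys V \<subseteq> polys W"
  by (auto simp: polys_def)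

lemma polys_monomial: "keys \<mu> \<subseteq> W \<Longrightarrow> single \<mu> a \<in> polys W"
  by (auto simp: polys_def)

lemma polys_filter_terms: "f \<in> polys W \<Longrightarrow> filter_terms Q f \<in> polys W"
  by (auto simp: polys_def keys_filter_terms)

lemma polys_power: "f \<in> polys W \<Longrightarrow> f ^ k \<in> polys W"
  by (induction k) (auto intro: polys_mult)

lemma exponent_degree_superset:
  "finite A \<Longrightarrow> keys \<mu> \<subseteq> A \<Longrightarrow> exponent_degree \<mu> = (\<Sum>v\<in>A. single (fst v) (int (lookup \<mu> v)))"
  unfolding exponent_degree_def by (rule sum.mono_neutral_left) (auto simp: in_keys_iff)

lemma exponent_degree_add: "exponent_degree (\<mu> + \<nu>) = exponent_degree \<mu> + exponent_degree \<nu>"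
proof -
  let ?A = "keys \<mu> \<union> keys \<nu>"
  have "exponent_degree (\<mu> + \<nu>) = (\<Sum>v\<in>?A. single (fst v) (int (lookup (\<mu> + \<nu>) v)))"
    by (rule exponent_degree_superset) (auto simp: keys_exponent_add)
  also have "\<dots> = exponent_degree \<mu> + exponent_degree \<nu>"
    by (simp add: exponent_degree_superset[of ?A \<mu>] exponent_degree_superset[of ?A \<nu>]
        lookup_add single_add sum.distrib)
  finally show ?thesis .
qed

lemma exponent_degree_0 [simp]: "exponent_degree 0 = 0"
  by (simp add: exponent_degree_def)

lemma exponent_degree_single [simp]: "exponent_degree (single v k) = single (fst v) (int k)"
  by (auto simp: exponent_degree_def)

lemma keys_exponent_degree: "keys (exponent_degree \<mu>) \<subseteq> fst ` keys \<mu>"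
proof
  fix g assume "g \<in> keys (exponent_degree \<mu>)"
  then have "(\<Sum>v\<in>keys \<mu>. lookup (single (fst v) (int (lookup \<mu> v))) g) \<noteq> 0"
    by (simp add: in_keys_iff exponent_degree_def lookup_sum)
  then obtain v where "v \<in> keys \<mu>" "lookup (single (fst v) (int (lookup \<mu> v))) g \<noteq> 0"
    by (meson sum.neutral)
  then show "g \<in> fst ` keys \<mu>" by (auto simp: lookup_single when_def split: if_splits)
qed

lemma lookup_exponent_degree_nonneg: "0 \<le> lookup (exponent_degree \<mu>) g"
  by (auto simp: exponent_degree_def lookup_sum lookup_single when_def intro: sum_nonneg)

lemma lookup_le_exponent_degree: "int (lookup \<mu> v) \<le> lookup (exponent_degree \<mu>) (fst v)"
proof (cases "v \<in> keys \<mu>")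
  case True
  have "int (lookup \<mu> v) = lookup (single (fst v) (int (lookup \<mu> v))) (fst v)" by simp
  also have "\<dots> \<le> (\<Sum>u\<in>keys \<mu>. lookup (single (fst u) (int (lookup \<mu> u))) (fst v))"
    by (rule member_le_sum) (auto simp: True lookup_single when_def)
  finally show ?thesis by (simp add: exponent_degree_def lookup_sum)
qed (simp add: in_keys_iff lookup_exponent_degree_nonneg)

definition X :: "nat \<times> nat \<Rightarrow> 'k::field cox_poly" where
  "X v = single (single v 1) 1"

lemma var_eq_X: "var i j = X (i, j)" by (simp add: var_def X_def)

lemma polys_X: "v \<in> W \<Longrightarrow> X v \<in> polys W"
  unfolding X_def by (rule polys_monomial) auto

lemma lookup_X_mult: "lookup (X v * f) (single v 1 + \<mu>) = lookup f \<mu>"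
proof -
  have "f \<in> {f. \<forall>\<mu>\<in>keys f. True}" by simp
  then show ?thesis
    by (induction f rule: poly_induct)
      (simp_all add: distrib_left lookup_add X_def mult_single lookup_single when_def)
qed

lemma X_mult_eq_0_iff: "X v * f = 0 \<longleftrightarrow> f = 0"
proof
  assume "X v * f = 0" then show "f = 0"
    using lookup_X_mult[of v f] by (intro poly_mapping_eqI) (metis lookup_zero)
qed simp

lemma X_dvd:
  assumes "f \<in> polys W" and "\<forall>\<mu>\<in>keys f. lookup \<mu> v \<noteq> 0"
  obtains g where "g \<in> polys W" "f = X v * g"
proof -
  have "f \<in> {f. \<forall>\<mu>\<in>keys f. keys \<mu> \<subseteq> W \<and> lookup \<mu> v \<noteq> 0}" using assms by (auto simp: polys_def)
  then have "\<exists>g\<in>polys W. f = X v * g"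
  proof (induction f rule: poly_induct)
    case zero show ?case by (rule bexI[of _ 0]) auto
  next
    case (add f g)
    then obtain f' g' where "f' \<in> polys W" "g' \<in> polys W" "f = X v * f'" "g = X v * g'" by auto
    then show ?case by (intro bexI[of _ "f' + g'"]) (auto simp: distrib_left polys_add)
  next
    case (monomial \<mu> a)
    let ?\<nu> = "\<mu> - single v 1"
    have "single v 1 + ?\<nu> = \<mu>"
      by (rule poly_mapping_eqI) (use monomial in \<open>auto simp: lookup_add lookup_minus lookup_single when_def\<close>)
    moreover have "keys ?\<nu> \<subseteq> W"
      using monomial by (auto simp: in_keys_iff lookup_minus subset_eq)
    ultimately show ?case
      by (intro bexI[of _ "single ?\<nu> a"]) (auto simp: X_def mult_single polys_monomial)
  qed
  then show ?thesis using that by auto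
qed

text \<open>
  The substitution \<open>v = 0\<close>.
\<close>

definition drop_var :: "nat \<times> nat \<Rightarrow> 'k::field cox_poly \<Rightarrow> 'k cox_poly" where
  "drop_var v f = filter_terms (\<lambda>\<mu>. lookup \<mu> v = 0) f"

lemma drop_var_add: "drop_var v (f + g) = drop_var v f + drop_var v g"
  and drop_var_0 [simp]: "drop_var v 0 = 0"
  by (simp_all add: drop_var_def filter_terms_add)

lemma drop_var_polys: "f \<in> polys (insert v W) \<Longrightarrow> drop_var v f \<in> polys W"
  by (auto simp: drop_var_def polys_def keys_filter_terms dest: lookup_eq_zero_in_keys_contradict)

lemma drop_var_eq: "f \<in> polys W \<Longrightarrow> v \<notin> W \<Longrightarrow> drop_var v f = f"
  unfolding drop_var_def filter_terms_eq_iff polys_def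
  by (auto simp: not_in_keys_iff_lookup_eq_zero[symmetric])

text \<open>
  The substitution is a ring homomorphism that fixes the polynomials without \<open>v\<close>.
\<close>

lemma drop_var_mult:
  assumes "f \<in> polys W" "v \<notin> W"
  shows "drop_var v (f * g) = f * drop_var v g"
proof -
  have "\<forall>\<mu>\<in>keys f. lookup \<mu> v = 0"
    using assms by (auto simp: polys_def not_in_keys_iff_lookup_eq_zero[symmetric])
  from filter_terms_mult[of "\<lambda>\<mu>. lookup \<mu> v", OF _ this, of "\<lambda>d. d = 0"] show ?thesis
    by (simp add: drop_var_def lookup_add)
qed

lemma drop_var_X_mult: "drop_var v (X v * f) = 0"
proof -
  have "\<forall>\<mu>\<in>keys (X v * f). lookup \<mu> v \<noteq> 0"
  proof
    fix \<mu> assume "\<mu> \<in> keys (X v * f)"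
    from subsetD[OF keys_mult this] show "lookup \<mu> v \<noteq> 0"
      by (auto simp: X_def lookup_add)
  qed
  then show ?thesis by (simp add: drop_var_def filter_terms_eq_0_iff)
qed

lemma drop_var_decomp:
  assumes "f \<in> polys (insert v W)"
  obtains g where "g \<in> polys (insert v W)" "f = drop_var v f + X v * g"
proof -
  let ?h = "f - drop_var v f"
  have "?h \<in> polys (insert v W)"
    using assms drop_var_polys[OF assms] polys_mono[of W "insert v W"] by (auto intro: polys_diff)
  moreover have "\<forall>\<mu>\<in>keys ?h. lookup \<mu> v \<noteq> 0"
    by (auto simp: drop_var_def in_keys_iff lookup_minus lookup_filter_terms when_def split: if_splits)
  ultimately obtain g where "g \<in> polys (insert v W)" "?h = X v * g" by (rule X_dvd)
  then show ?thesis by (intro that[of g]) (auto simp: algebra_simps)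
qed


section \<open>Vectors of polynomials, submodules and degrees\<close>

type_synonym 'k vec = "nat \<Rightarrow> 'k cox_poly"

definition smul :: "'k::field cox_poly \<Rightarrow> 'k vec \<Rightarrow> 'k vec" (infixr "\<bullet>" 75) where
  "f \<bullet> c = (\<lambda>i. f * c i)"

lemma smul_apply: "(f \<bullet> c) i = f * c i"
  by (simp add: smul_def)

lemmas vec_apply = smul_apply plus_fun_apply zero_fun_apply minus_apply uminus_apply
declare plus_fun_apply [simp del] zero_fun_apply [simp del] minus_apply [simp del] uminus_apply [simp del]

lemma smul_simps [simp]: "f \<bullet> 0 = 0" "0 \<bullet> c = 0" "1 \<bullet> c = c" "(- 1) \<bullet> c = - c"
  by (simp_all add: fun_eq_iff vec_apply)

lemma smul_distribs: "f \<bullet> (c + d) = f \<bullet> c + f \<bullet> d" "(f + g) \<bullet> c = f \<bullet> c + g \<bullet> c"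
  "f \<bullet> (c - d) = f \<bullet> c - f \<bullet> d" "(f - g) \<bullet> c = f \<bullet> c - g \<bullet> c"
  by (simp_all add: fun_eq_iff vec_apply algebra_simps)

lemma smul_smul: "f \<bullet> g \<bullet> c = (f * g) \<bullet> c"
  by (simp add: fun_eq_iff vec_apply algebra_simps)

lemma smul_commute: "f \<bullet> g \<bullet> c = g \<bullet> f \<bullet> c"
  by (simp add: fun_eq_iff vec_apply algebra_simps)

lemma sum_fun_apply: "(\<Sum>a\<in>A. f a) x = (\<Sum>a\<in>A. f a x)"
  by (induction A rule: infinite_finite_induct) (auto simp: vec_apply)

lemma smul_sum: "f \<bullet> (\<Sum>a\<in>A. g a) = (\<Sum>a\<in>A. f \<bullet> g a)"
  by (simp add: fun_eq_iff sum_fun_apply vec_apply sum_distrib_left)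

definition vecs :: "'k::field vec set" where
  "vecs = {c. finite {i. c i \<noteq> 0}}"

definition submod :: "(nat \<times> nat) set \<Rightarrow> 'k::field vec set \<Rightarrow> bool" where
  "submod W Z \<longleftrightarrow> Z \<subseteq> vecs \<and> 0 \<in> Z \<and> (\<forall>c\<in>Z. \<forall>d\<in>Z. c + d \<in> Z) \<and>
     (\<forall>f\<in>polys W. \<forall>c\<in>Z. f \<bullet> c \<in> Z)"

lemma submod_vecs: "submod W Z \<Longrightarrow> Z \<subseteq> vecs"
  and submod_0: "submod W Z \<Longrightarrow> 0 \<in> Z"
  and submod_add: "submod W Z \<Longrightarrow> c \<in> Z \<Longrightarrow> d \<in> Z \<Longrightarrow> c + d \<in> Z"
  and submod_smul: "submod W Z \<Longrightarrow> f \<in> polys W \<Longrightarrow> c \<in> Z \<Longrightarrow> f \<bullet> c \<in> Z"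
  by (auto simp: submod_def)

lemma submod_uminus: "submod W Z \<Longrightarrow> c \<in> Z \<Longrightarrow> - c \<in> Z"
  using submod_smul[of W Z "- 1" c] by (simp add: polys_uminus)

lemma submod_diff: "submod W Z \<Longrightarrow> c \<in> Z \<Longrightarrow> d \<in> Z \<Longrightarrow> c - d \<in> Z"
  using submod_add[of W Z c "- d"] submod_uminus[of W Z d] by simp

lemma submod_sum: "submod W Z \<Longrightarrow> (\<And>i. i \<in> A \<Longrightarrow> f i \<in> Z) \<Longrightarrow> sum f A \<in> Z"
  by (induction A rule: infinite_finite_induct) (auto intro: submod_add submod_0)

lemma submod_diff_swap: "submod W Z \<Longrightarrow> c - d \<in> Z \<Longrightarrow> d - c \<in> Z"
  using submod_uminus[of W Z "c - d"] by simp

lemma submod_mono: "V \<subseteq> W \<Longrightarrow> submod W Z \<Longrightarrow> submod V Z"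
  using polys_mono[of V W] by (fastforce simp: submod_def)

lemma submod_singleton_0: "submod W {0}"
  by (auto simp: submod_def vecs_def vec_apply)

lemma submod_vecs_UNIV: "submod W vecs"
proof -
  have "finite {i. c i + d i \<noteq> 0}" if "finite {i. c i \<noteq> 0}" "finite {i. d i \<noteq> 0}" for c d :: "'k::field vec"
    by (rule finite_subset[of _ "{i. c i \<noteq> 0} \<union> {i. d i \<noteq> 0}"]) (use that in auto)
  moreover have "finite {i. f * c i \<noteq> 0}" if "finite {i. c i \<noteq> 0}" for f and c :: "'k::field vec"
    by (rule finite_subset[OF _ that]) auto
  ultimately show ?thesis by (auto simp: submod_def vecs_def vec_apply)
qed

lemma submod_Int: "submod W Y \<Longrightarrow> submod W Z \<Longrightarrow> submod W (Y \<inter> Z)"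
  by (auto simp: submod_def)

definition set_sum :: "'a::plus set \<Rightarrow> 'a set \<Rightarrow> 'a set" where
  "set_sum K Y = {k + y | k y. k \<in> K \<and> y \<in> Y}"

lemma submod_set_sum:
  assumes "submod W K" "submod W Y" shows "submod W (set_sum K Y)"
proof -
  have "c + d \<in> set_sum K Y" if cd: "c \<in> set_sum K Y" "d \<in> set_sum K Y" for c d
  proof -
    obtain k y k' y' where "k \<in> K" "y \<in> Y" "c = k + y" "k' \<in> K" "y' \<in> Y" "d = k' + y'"
      using cd unfolding set_sum_def by blast
    then have "c + d = (k + k') + (y + y')" "k + k' \<in> K" "y + y' \<in> Y"
      using submod_add[OF assms(1)] submod_add[OF assms(2)] by (auto simp: algebra_simps)
    then show ?thesis unfolding set_sum_def by blast
  qed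
  moreover have "f \<bullet> c \<in> set_sum K Y" if "c \<in> set_sum K Y" "f \<in> polys W" for f c
    using that submod_smul[OF assms(1)] submod_smul[OF assms(2)]
    unfolding set_sum_def by (auto simp: smul_distribs) blast
  moreover have "0 \<in> set_sum K Y" unfolding set_sum_def
    using assms[THEN submod_0] by (auto intro!: exI[of _ 0])
  moreover have "set_sum K Y \<subseteq> vecs"
    using submod_add[OF submod_vecs_UNIV[of W]] submod_vecs[OF assms(1)] submod_vecs[OF assms(2)]
    unfolding set_sum_def by blast
  ultimately show ?thesis by (auto simp: submod_def)
qed

lemma set_sum_left: "submod W Y \<Longrightarrow> K \<subseteq> set_sum K Y"
  and set_sum_right: "submod W K \<Longrightarrow> Y \<subseteq> set_sum K Y"
  unfolding set_sum_def using submod_0[of W] by (force intro: add.right_neutral[symmetric] add.left_neutral[symmetric])+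

lemma set_sum_least: "submod W Z \<Longrightarrow> K \<subseteq> Z \<Longrightarrow> Y \<subseteq> Z \<Longrightarrow> set_sum K Y \<subseteq> Z"
  by (auto simp: set_sum_def intro: submod_add)

lemma submod_image_smul: "submod W Z \<Longrightarrow> submod W ((\<bullet>) f ` Z)"
  unfolding submod_def
proof (intro conjI ballI, goal_cases)
  case 1 then show ?case using submod_smul[OF submod_vecs_UNIV[of UNIV], of f] by (auto simp: polys_def)
next
  case 2 then show ?case by (auto intro!: image_eqI[of _ _ 0])
next
  case (3 c d) then show ?case by (auto simp: smul_distribs[symmetric])
next
  case (4 g c) then show ?case by (auto simp: smul_commute[of g f])
qed


text \<open>
  The part of a vector whose degrees lie in \<open>D\<close>, where the \<open>i\<close>-th basis vector has degree \<open>s i\<close>.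
  Arbitrary sets \<open>D\<close> cover homogeneous components as well as truncations.
\<close>

definition part :: "(nat \<Rightarrow> multidegree) \<Rightarrow> multidegree set \<Rightarrow> 'k::field vec \<Rightarrow> 'k vec" where
  "part s D c = (\<lambda>i. filter_terms (\<lambda>\<mu>. exponent_degree \<mu> + s i \<in> D) (c i))"

definition graded :: "(nat \<Rightarrow> multidegree) \<Rightarrow> 'k::field vec set \<Rightarrow> bool" where
  "graded s Z \<longleftrightarrow> (\<forall>c\<in>Z. \<forall>D. part s D c \<in> Z)"

lemma gradedD: "graded s Z \<Longrightarrow> c \<in> Z \<Longrightarrow> part s D c \<in> Z"
  by (auto simp: graded_def)

lemma part_0 [simp]: "part s D 0 = 0"
  and part_add: "part s D (c + d) = part s D c + part s D d"
  and part_diff: "part s D (c - d) = part s D c - part s D d"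
  and part_part: "part s D (part s E c) = part s (D \<inter> E) c"
  by (simp_all add: part_def fun_eq_iff vec_apply filter_terms_add filter_terms_diff filter_terms_filter_terms)

lemma part_sum: "part s D (\<Sum>a\<in>A. f a) = (\<Sum>a\<in>A. part s D (f a))"
  by (induction A rule: infinite_finite_induct) (simp_all add: part_add)

lemma part_eq_iff: "part s D c = c \<longleftrightarrow> (\<forall>i. \<forall>\<mu>\<in>keys (c i). exponent_degree \<mu> + s i \<in> D)"
  by (simp add: part_def fun_eq_iff filter_terms_eq_iff)

lemma part_eq_0_iff: "part s D c = 0 \<longleftrightarrow> (\<forall>i. \<forall>\<mu>\<in>keys (c i). exponent_degree \<mu> + s i \<notin> D)"
  by (simp add: part_def fun_eq_iff vec_apply filter_terms_eq_0_iff)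

lemma part_smul_poly:
  assumes "\<forall>\<mu>\<in>keys f. exponent_degree \<mu> = e"
  shows "part s D (f \<bullet> c) = f \<bullet> part s {d. e + d \<in> D} c"
  using filter_terms_mult[of exponent_degree, OF exponent_degree_add assms, of "\<lambda>d. d + s _ \<in> D"]
  by (simp add: part_def fun_eq_iff vec_apply add.assoc)

lemma part_X_smul: "part s D (X v \<bullet> c) = X v \<bullet> part s {d. single (fst v) 1 + d \<in> D} c"
  by (rule part_smul_poly) (simp add: X_def)

lemma part_smul_vec:
  assumes "part s {e} c = c"
  shows "part s D (f \<bullet> c) = filter_terms (\<lambda>\<mu>. exponent_degree \<mu> + e \<in> D) f \<bullet> c"
proof (rule ext)
  fix i
  have "\<forall>\<mu>\<in>keys (c i). exponent_degree \<mu> = e - s i"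
    using assms by (auto simp: part_eq_iff algebra_simps eq_diff_eq)
  from filter_terms_mult[of exponent_degree, OF exponent_degree_add this, of "\<lambda>d. d + s i \<in> D" f]
  show "part s D (f \<bullet> c) i = (filter_terms (\<lambda>\<mu>. exponent_degree \<mu> + e \<in> D) f \<bullet> c) i"
    by (simp add: part_def vec_apply algebra_simps)
qed

lemma part_finite: "finite D \<Longrightarrow> part s D c = (\<Sum>d\<in>D. part s {d} c)"
proof (induction D rule: finite_induct)
  case empty
  then show ?case by (simp add: part_eq_0_iff)
next
  case (insert d D)
  have "part s (insert d D) c = part s {d} c + part s D c"
    using insert(2)
    by (auto simp: part_def fun_eq_iff vec_apply lookup_filter_terms lookup_add when_def intro!: poly_mapping_eqI)
  then show ?case using insert by simp
qed

definition degs :: "(nat \<Rightarrow> multidegree) \<Rightarrow> 'k::field vec \<Rightarrow> multidegree set" where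
  "degs s c = (\<Union>i\<in>{i. c i \<noteq> 0}. (\<lambda>\<mu>. exponent_degree \<mu> + s i) ` keys (c i))"

lemma finite_degs: "c \<in> vecs \<Longrightarrow> finite (degs s c)"
  by (auto simp: degs_def vecs_def)

lemma part_degs: "part s (degs s c) c = c"
  unfolding part_eq_iff degs_def by (force simp: in_keys_iff)

lemma vec_eq_sum_parts: "c \<in> vecs \<Longrightarrow> c = (\<Sum>d\<in>degs s c. part s {d} c)"
  using part_finite[OF finite_degs] part_degs by metis

lemma graded_set_sum: "graded s Y \<Longrightarrow> graded s Z \<Longrightarrow> graded s (set_sum Y Z)"
  by (fastforce simp: graded_def set_sum_def part_add)

lemma graded_0: "graded s {0}"
  by (auto simp: graded_def)

lemma graded_X_image: "graded s Z \<Longrightarrow> graded s ((\<bullet>) (X v) ` Z)"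
  by (auto simp: graded_def part_X_smul)

text \<open>
  Two elements of the union of an increasing chain already lie in a common member.
\<close>

lemma submod_Union_chain:
  assumes L: "\<And>k. submod W (L k)" and chain: "\<And>i j. i \<le> j \<Longrightarrow> L i \<subseteq> L (j :: nat)"
  shows "submod W (\<Union>k. L k)"
  unfolding submod_def
proof (intro conjI ballI)
  show "(\<Union>k. L k) \<subseteq> vecs" using submod_vecs[OF L] by (rule UN_least)
  show "0 \<in> (\<Union>k. L k)" using submod_0[OF L] by (rule UN_I[OF UNIV_I])
  show "f \<bullet> c \<in> (\<Union>k. L k)" if "f \<in> polys W" "c \<in> (\<Union>k. L k)" for f c
    using that submod_smul[OF L] by auto
next
  fix c d assume "c \<in> (\<Union>k. L k)" "d \<in> (\<Union>k. L k)"
  then obtain k l where "c \<in> L k" "d \<in> L l" by auto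
  then have "c + d \<in> L (max k l)"
    using chain[of k "max k l"] chain[of l "max k l"] by (auto intro: submod_add[OF L])
  then show "c + d \<in> (\<Union>k. L k)" by auto
qed

lemma finite_subset_chain:
  assumes "finite B" "B \<subseteq> (\<Union>k. L k)" and chain: "\<And>i j. i \<le> j \<Longrightarrow> L i \<subseteq> L (j :: nat)"
  shows "\<exists>m. B \<subseteq> L m"
  using assms(1,2)
proof (induction B rule: finite_induct)
  case (insert b B)
  then obtain k l where "b \<in> L k" "B \<subseteq> L l" by auto
  then have "insert b B \<subseteq> L (max k l)"
    using chain[of k "max k l"] chain[of l "max k l"] by auto
  then show ?case ..
qed auto

definition colon :: "'k::field vec set \<Rightarrow> 'k vec set \<Rightarrow> 'k cox_poly \<Rightarrow> 'k vec set" where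
  "colon Z K f = {m \<in> Z. f \<bullet> m \<in> K}"

lemma submod_colon:
  assumes Z: "submod W Z" and K: "submod W K"
  shows "submod W (colon Z K f)"
  unfolding submod_def
proof (intro conjI ballI)
  show "colon Z K f \<subseteq> vecs" using submod_vecs[OF Z] by (auto simp: colon_def)
  show "0 \<in> colon Z K f" using submod_0[OF Z] submod_0[OF K] by (simp add: colon_def)
  show "x + y \<in> colon Z K f" if "x \<in> colon Z K f" "y \<in> colon Z K f" for x y
    using that submod_add[OF Z] submod_add[OF K] by (simp add: colon_def smul_distribs)
  show "g \<bullet> x \<in> colon Z K f" if "g \<in> polys W" "x \<in> colon Z K f" for g x
    using that submod_smul[OF Z] submod_smul[OF K] by (simp add: colon_def smul_commute[of f])
qed

lemma graded_colon:
  assumes Z: "graded s Z" and K: "graded s K" and f: "\<forall>\<mu>\<in>keys f. exponent_degree \<mu> = e"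
  shows "graded s (colon Z K f)"
  unfolding graded_def
proof (intro ballI allI)
  fix m D assume m: "m \<in> colon Z K f"
  have "part s ((+) e ` D) (f \<bullet> m) \<in> K" using m gradedD[OF K] by (simp add: colon_def)
  moreover have "{d. e + d \<in> (+) e ` D} = D" by auto
  ultimately have "f \<bullet> part s D m \<in> K" by (simp add: part_smul_poly[OF f])
  then show "part s D m \<in> colon Z K f" using m gradedD[OF Z] by (simp add: colon_def)
qed


inductive_set mspan :: "(nat \<times> nat) set \<Rightarrow> 'k::field vec set \<Rightarrow> 'k vec set"
  for W A where
  mspan_zero: "0 \<in> mspan W A"
| mspan_step: "m \<in> mspan W A \<Longrightarrow> a \<in> A \<Longrightarrow> f \<in> polys W \<Longrightarrow> m + f \<bullet> a \<in> mspan W A"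

lemmas mspan_induct = mspan.induct [consumes 1, case_names zero step]

lemma mspan_least: "submod W Z \<Longrightarrow> A \<subseteq> Z \<Longrightarrow> mspan W A \<subseteq> Z"
proof
  fix x assume Z: "submod W Z" "A \<subseteq> Z" and "x \<in> mspan W A"
  from this(3) show "x \<in> Z"
    by (induction rule: mspan_induct) (use Z in \<open>auto intro: submod_0 submod_add submod_smul\<close>)
qed

lemma mspan_add: "d \<in> mspan W A \<Longrightarrow> c \<in> mspan W A \<Longrightarrow> c + d \<in> mspan W A"
  by (induction rule: mspan_induct) (auto simp: add.assoc[symmetric] intro: mspan_step)

lemma mspan_smul: "c \<in> mspan W A \<Longrightarrow> f \<in> polys W \<Longrightarrow> f \<bullet> c \<in> mspan W A"
  by (induction rule: mspan_induct)
    (auto simp: smul_distribs smul_smul intro: mspan_zero mspan_step polys_mult)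

lemma submod_mspan: "A \<subseteq> vecs \<Longrightarrow> submod W (mspan W A)"
  unfolding submod_def
  using mspan_least[OF submod_vecs_UNIV, of A W] by (auto intro: mspan_zero mspan_add mspan_smul)

lemma mspan_base: "a \<in> A \<Longrightarrow> a \<in> mspan W A"
  using mspan_step[OF mspan_zero, of a A 1 W] by simp

lemma mspan_mono: "A \<subseteq> B \<Longrightarrow> V \<subseteq> W \<Longrightarrow> mspan V A \<subseteq> mspan W B"
proof
  fix x assume *: "A \<subseteq> B" "V \<subseteq> W" and "x \<in> mspan V A"
  from this(3) show "x \<in> mspan W B"
    by (induction rule: mspan_induct) (use * polys_mono[of V W] in \<open>auto intro: mspan_zero mspan_step\<close>)
qed

lemma mspan_Un:
  assumes "c \<in> mspan W (A \<union> K)" "submod W K"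
  obtains a k where "a \<in> mspan W A" "k \<in> K" "c = a + k"
proof -
  have "\<exists>a\<in>mspan W A. \<exists>k\<in>K. c = a + k"
    using assms(1)
  proof (induction rule: mspan_induct)
    case zero
    then show ?case using submod_0[OF assms(2)] by (auto intro!: bexI[of _ 0] mspan_zero)
  next
    case (step m x f)
    then obtain a k where ak: "a \<in> mspan W A" "k \<in> K" "m = a + k" by auto
    show ?case
    proof (cases "x \<in> A")
      case True
      then show ?thesis using ak step
        by (intro bexI[of _ "a + f \<bullet> x"] bexI[of _ k]) (auto intro: mspan_step)
    next
      case False
      then have "f \<bullet> x \<in> K" using step assms by (auto intro: submod_smul)
      then show ?thesis using ak
        by (intro bexI[of _ a] bexI[of _ "k + f \<bullet> x"]) (auto intro: submod_add[OF assms(2)])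
    qed
  qed
  then show ?thesis using that by auto
qed

definition fg :: "(nat \<times> nat) set \<Rightarrow> 'k::field vec set \<Rightarrow> 'k vec set \<Rightarrow> bool" where
  "fg W Z K \<longleftrightarrow> (\<exists>A. finite A \<and> A \<subseteq> Z \<and> Z \<subseteq> mspan W (A \<union> K))"

lemma X_power: "X v ^ j = single (single v j) 1"
  by (induction j) (simp_all add: X_def mult_single single_add[symmetric])

lemma polys_empty: "f \<in> polys {} \<longleftrightarrow> (\<exists>a. f = single 0 a)"
proof
  assume "f \<in> polys {}"
  then have "keys f \<subseteq> {0}" by (auto simp: polys_def)
  then have "f = single 0 (lookup f 0)"
    by (intro poly_mapping_eqI) (auto simp: lookup_single when_def in_keys_iff)
  then show "\<exists>a. f = single 0 a" ..
qed (auto simp: polys_def split: if_splits)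


section \<open>The Hilbert basis theorem\<close>

text \<open>
  Induction on the number of vectors that span.  Modulo the span of the others, \<open>Y\<close> is at most one
  dimensional, so one further generator suffices.
\<close>

lemma noetherian_field:
  assumes "finite A"
  shows "A \<subseteq> vecs \<Longrightarrow> submod {} K \<Longrightarrow> submod {} Y \<Longrightarrow> K \<subseteq> Y \<Longrightarrow> Y \<subseteq> mspan {} (A \<union> K) \<Longrightarrow> fg {} Y K"
  using assms
proof (induction A arbitrary: Y rule: finite_induct)
  case empty
  then show ?case unfolding fg_def by (intro exI[of _ "{}"]) auto
next
  case (insert a A)
  let ?N = "mspan {} (A \<union> K)"
  have N: "submod {} ?N" using insert by (intro submod_mspan) (auto dest: submod_vecs)
  have "fg {} (Y \<inter> ?N) K"
    using insert N by (intro insert.IH) (auto intro: submod_Int mspan_base)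
  then obtain B where B: "finite B" "B \<subseteq> Y \<inter> ?N" "Y \<inter> ?N \<subseteq> mspan {} (B \<union> K)"
    by (auto simp: fg_def)
  show ?case
  proof (cases "Y \<subseteq> ?N")
    case True then show ?thesis using B by (auto simp: fg_def)
  next
    case False
    have split: "\<exists>f. c - single 0 f \<bullet> a \<in> ?N" if "c \<in> Y" for c
    proof -
      have "c \<in> mspan {} (insert a (A \<union> K))" using that insert by auto
      then show ?thesis
      proof (induction rule: mspan_induct)
        case zero show ?case by (rule exI[of _ 0]) (auto intro: mspan_zero)
      next
        case (step m x f)
        then obtain g where g: "m - single 0 g \<bullet> a \<in> ?N" by auto
        show ?case
        proof (cases "x = a")
          case True
          obtain f' where "f = single 0 f'" using step polys_empty by auto
          then show ?thesis using g True
            by (intro exI[of _ "g + f'"]) (simp add: single_add smul_distribs algebra_simps)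
        next
          case False
          then have "f \<bullet> x \<in> ?N" using step by (auto intro: mspan_base mspan_smul)
          from submod_add[OF N g this] show ?thesis by (auto simp: algebra_simps)
        qed
      qed
    qed
    from False obtain y where y: "y \<in> Y" "y \<notin> ?N" by auto
    obtain f where f: "y - single 0 f \<bullet> a \<in> ?N" using split y by auto
    then have "f \<noteq> 0" using y by auto
    have "Y \<subseteq> mspan {} (insert y B \<union> K)"
    proof
      fix c assume c: "c \<in> Y"
      obtain g where g: "c - single 0 g \<bullet> a \<in> ?N" using split c by auto
      \<comment> \<open>the multiple of \<open>y\<close> that cancels the coefficient of \<open>a\<close>\<close>
      let ?r = "single 0 (g / f) :: 'a cox_poly"
      have r: "?r \<in> polys {}" by (auto simp: polys_empty)
      have "?r \<bullet> (y - single 0 f \<bullet> a) \<in> ?N" by (rule submod_smul[OF N r f])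
      from submod_diff[OF N g this] have "c - ?r \<bullet> y \<in> ?N"
        using \<open>f \<noteq> 0\<close> by (simp add: smul_distribs smul_smul mult_single algebra_simps)
      moreover have "c - ?r \<bullet> y \<in> Y"
        using c y r insert by (auto intro!: submod_diff submod_smul)
      ultimately have "c - ?r \<bullet> y \<in> mspan {} (insert y B \<union> K)"
        using B mspan_mono[of "B \<union> K" "insert y B \<union> K" "{}" "{}"] by auto
      from mspan_step[OF this _ r, of y] show "c \<in> mspan {} (insert y B \<union> K)" by simp
    qed
    then show ?thesis using B y unfolding fg_def by (intro exI[of _ "insert y B"]) auto
  qed
qed

text \<open>
  Hilbert's basis theorem for modules, in the form that a submodule \<open>Y\<close> of a module that is finitely
  generated modulo \<open>K\<close> is itself finitely generated modulo \<open>K\<close>.  The proof is the classical one with leading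
  coefficients, but in terms of the module: with \<open>N k\<close> the vectors of degree less than \<open>k\<close> in the new
  variable \<open>v\<close>, the leading coefficients of the elements of \<open>Y\<close> of degree \<open>k\<close> form an increasing chain
  \<open>L k\<close> of submodules over the old variables, which becomes stationary.
\<close>

theorem noetherian:
  assumes "finite W"
  shows "finite A \<Longrightarrow> A \<subseteq> vecs \<Longrightarrow> submod W K \<Longrightarrow> submod W Y \<Longrightarrow> K \<subseteq> Y \<Longrightarrow>
    Y \<subseteq> mspan W (A \<union> K) \<Longrightarrow> fg W Y (K :: 'k::field vec set)"
  using assms
proof (induction W arbitrary: A K Y rule: finite_induct)
  case empty
  then show ?case by (intro noetherian_field)
next
  case (insert v W)
  let ?W = "insert v W"
  note KV = insert.prems(3) and YV = insert.prems(4)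
  have KW: "submod W K" and YW: "submod W Y" using KV YV submod_mono[of W ?W] by auto
  have Xv: "X v ^ j \<in> polys ?W" for j by (auto intro!: polys_power polys_X)
  define N where "N k = mspan W (K \<union> {X v ^ j \<bullet> a | j a. j < k \<and> a \<in> A})" for k :: nat
  have N: "submod W (N k)" for k unfolding N_def
    using insert.prems(2) submod_vecs[OF KW] submod_smul[OF submod_vecs_UNIV[of ?W] Xv]
    by (intro submod_mspan) auto
  have K_N: "K \<subseteq> N k" for k by (auto simp: N_def intro: mspan_base)
  have N_mono: "N i \<subseteq> N j" if "i \<le> j" for i j
    unfolding N_def by (rule mspan_mono) (use that in force)+
  have X_N: "X v \<bullet> c \<in> N (Suc k)" if "c \<in> N k" for c k
    using that unfolding N_def
  proof (induction rule: mspan_induct)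
    case (step m a f)
    have "X v \<bullet> a \<in> N (Suc k)"
    proof (cases "a \<in> K")
      case True
      then show ?thesis using K_N[of "Suc k"] submod_smul[OF KV polys_X[of v]] by auto
    next
      case False
      then obtain j b where "a = X v ^ j \<bullet> b" "j < k" "b \<in> A" using step by auto
      then show ?thesis unfolding N_def
        by (intro mspan_base) (auto simp: smul_smul intro!: exI[of _ "Suc j"] exI[of _ b])
    qed
    then have "f \<bullet> X v \<bullet> a \<in> N (Suc k)" using step N by (auto intro: submod_smul)
    then show ?case using step N[of "Suc k"]
      by (auto simp: smul_distribs smul_commute[of "X v"] N_def[symmetric] intro: submod_add)
  qed (auto intro: mspan_zero)
  have X_N_pow: "X v ^ j \<bullet> c \<in> N (j + k)" if "c \<in> N k" for c j k
    by (induction j) (auto simp: that smul_smul[symmetric] intro: X_N)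
  have N_exhaust: "\<exists>k. c \<in> N k" if "c \<in> mspan ?W (A \<union> K)" for c
    using that
  proof (induction rule: mspan_induct)
    case zero then show ?case using N submod_0 by blast
  next
    case (step m a f)
    have "\<exists>k. f \<bullet> a \<in> N k"
    proof (cases "a \<in> K")
      case True
      then have "f \<bullet> a \<in> K" using step KV by (auto intro: submod_smul)
      then show ?thesis using K_N by blast
    next
      case False
      then have a: "a \<in> A" using step by auto
      have "f \<in> {f. \<forall>\<mu>\<in>keys f. keys \<mu> \<subseteq> ?W}" using step by (auto simp: polys_def)
      then show ?thesis
      proof (induction f rule: poly_induct)
        case zero then show ?case using N submod_0 by auto
      next
        case (add f g)
        then obtain k l where "f \<bullet> a \<in> N k" "g \<bullet> a \<in> N l" by auto
        then have "(f + g) \<bullet> a \<in> N (max k l)"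
          using N_mono[of k "max k l"] N_mono[of l "max k l"]
          by (auto simp: smul_distribs intro: submod_add[OF N])
        then show ?case ..
      next
        case (monomial \<mu> x)
        let ?\<nu> = "filter_terms (\<lambda>u. u \<noteq> v) \<mu>" let ?j = "lookup \<mu> v"
        have "single v ?j + ?\<nu> = \<mu>"
          by (rule poly_mapping_eqI) (auto simp: lookup_add lookup_filter_terms lookup_single when_def)
        then have "single \<mu> x = single ?\<nu> x * X v ^ ?j" by (simp add: X_power mult_single add.commute)
        moreover have "single ?\<nu> x \<in> polys W"
          using monomial by (intro polys_monomial) (auto simp: keys_filter_terms)
        moreover have "X v ^ ?j \<bullet> a \<in> N (Suc ?j)"
          using a by (auto simp: N_def intro!: mspan_base)
        ultimately have "single \<mu> x \<bullet> a \<in> N (Suc ?j)"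
          by (simp add: smul_smul[symmetric]) (blast intro: submod_smul[OF N])
        then show ?case ..
      qed
    qed
    then obtain k l where "m \<in> N k" "f \<bullet> a \<in> N l" using step by auto
    then have "m + f \<bullet> a \<in> N (max k l)"
      using N_mono[of k "max k l"] N_mono[of l "max k l"] by (auto intro: submod_add[OF N])
    then show ?case ..
  qed
  have N_Suc: "\<exists>u\<in>mspan W A. c - X v ^ k \<bullet> u \<in> N k" if "c \<in> N (Suc k)" for c k
    using that unfolding N_def[of "Suc k"]
  proof (induction rule: mspan_induct)
    case zero then show ?case by (auto intro!: bexI[of _ 0] mspan_zero submod_0[OF N])
  next
    case (step m a f)
    then obtain u where u: "u \<in> mspan W A" "m - X v ^ k \<bullet> u \<in> N k" by auto
    show ?case
    proof (cases "\<exists>b\<in>A. a = X v ^ k \<bullet> b")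
      case True
      then obtain b where b: "b \<in> A" "a = X v ^ k \<bullet> b" by auto
      then show ?thesis using u step
        by (intro bexI[of _ "u + f \<bullet> b"])
          (auto simp: smul_distribs smul_commute[of f] intro: mspan_step)
    next
      case False
      then have "a \<in> K \<union> {X v ^ j \<bullet> a |j a. j < k \<and> a \<in> A}" using step less_Suc_eq by auto
      then have "f \<bullet> a \<in> N k" using step unfolding N_def by (intro mspan_smul mspan_base)
      from submod_add[OF N u(2) this] show ?thesis using u
        by (intro bexI[of _ u]) (auto simp: algebra_simps)
    qed
  qed
  \<comment> \<open>the leading coefficients of the elements of \<open>Y\<close> of degree \<open>k\<close> in \<open>v\<close>\<close>
  define L where "L k = {u \<in> mspan W A. \<exists>y\<in>Y. X v ^ k \<bullet> u - y \<in> N k}" for k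
  have A: "submod W (mspan W A)" using insert by (intro submod_mspan)
  have L: "submod W (L k)" for k
    unfolding submod_def
  proof (intro conjI ballI)
    show "L k \<subseteq> vecs" using submod_vecs[OF A] by (auto simp: L_def)
    show "0 \<in> L k" using submod_0[OF A] submod_0[OF YW] submod_0[OF N] by (force simp: L_def)
    fix c assume "c \<in> L k"
    then obtain y where c: "c \<in> mspan W A" "y \<in> Y" "X v ^ k \<bullet> c - y \<in> N k" by (auto simp: L_def)
    show "c + d \<in> L k" if "d \<in> L k" for d
    proof -
      obtain z where d: "d \<in> mspan W A" "z \<in> Y" "X v ^ k \<bullet> d - z \<in> N k"
        using \<open>d \<in> L k\<close> by (auto simp: L_def)
      have "X v ^ k \<bullet> (c + d) - (y + z) \<in> N k"
        using submod_add[OF N c(3) d(3)] by (simp add: smul_distribs algebra_simps)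
      then show ?thesis using c d submod_add[OF A] submod_add[OF YW] by (auto simp: L_def)
    qed
    show "f \<bullet> c \<in> L k" if "f \<in> polys W" for f
    proof -
      have "X v ^ k \<bullet> f \<bullet> c - f \<bullet> y \<in> N k"
        using submod_smul[OF N that c(3)] by (simp add: smul_distribs smul_commute)
      then show ?thesis using c that submod_smul[OF A] submod_smul[OF YW] by (auto simp: L_def)
    qed
  qed
  have "L k \<subseteq> L (Suc k)" for k
  proof
    fix u assume "u \<in> L k"
    then obtain y where u: "u \<in> mspan W A" "y \<in> Y" "X v ^ k \<bullet> u - y \<in> N k" by (auto simp: L_def)
    have "X v ^ Suc k \<bullet> u - X v \<bullet> y \<in> N (Suc k)"
      using X_N[OF u(3)] by (simp add: smul_distribs smul_smul)
    moreover have "X v \<bullet> y \<in> Y" using submod_smul[OF YV polys_X u(2)] by simp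
    ultimately show "u \<in> L (Suc k)" using u by (auto simp: L_def)
  qed
  then have L_mono: "i \<le> j \<Longrightarrow> L i \<subseteq> L j" for i j by (rule lift_Suc_mono_le)
  have U: "submod W (\<Union>k. L k)" by (rule submod_Union_chain[OF L L_mono])
  have fgL: "fg W Z {0}" if "submod W Z" "Z \<subseteq> mspan W A" for Z
    using insert.prems(1,2) that submod_0 mspan_mono[of A "A \<union> {0}" W W]
    by (intro insert.IH) (auto simp: submod_singleton_0)
  have "fg W (\<Union>k. L k) {0}" by (rule fgL[OF U]) (auto simp: L_def)
  then obtain B where B: "finite B" "B \<subseteq> (\<Union>k. L k)" "(\<Union>k. L k) \<subseteq> mspan W (B \<union> {0})"
    by (auto simp: fg_def)
  have "\<exists>m. B \<subseteq> L m" by (rule finite_subset_chain[OF B(1,2) L_mono])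
  then obtain m where "B \<subseteq> L m" by auto
  then have Lm: "L k \<subseteq> L m" for k
    using B(3) mspan_least[OF L, of "B \<union> {0}" m] submod_0[OF L] by blast
  have "\<exists>B. finite B \<and> B \<subseteq> L k \<and> L k \<subseteq> mspan W (B \<union> {0})" for k
    using fgL[OF L, of k] by (auto simp: fg_def L_def)
  then obtain B where B: "\<And>k. finite (B k)" "\<And>k. B k \<subseteq> L k" "\<And>k. L k \<subseteq> mspan W (B k \<union> {0})"
    by metis
  define y where "y k u = (SOME y. y \<in> Y \<and> X v ^ k \<bullet> u - y \<in> N k)" for k u
  have y: "y k u \<in> Y \<and> X v ^ k \<bullet> u - y k u \<in> N k" if "u \<in> L k" for k u
  proof -
    have "\<exists>y. y \<in> Y \<and> X v ^ k \<bullet> u - y \<in> N k" using that by (auto simp: L_def)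
    from someI_ex[OF this] show ?thesis unfolding y_def .
  qed
  define C where "C = (\<Union>k\<le>m. y k ` B k)"
  have "finite C" using B(1) by (simp add: C_def)
  moreover have "C \<subseteq> Y" using y subsetD[OF B(2)] unfolding C_def by blast
  ultimately have C: "finite C" "C \<subseteq> Y" .
  have lead: "\<exists>w\<in>mspan W C. X v ^ k \<bullet> u - w \<in> N k" if "u \<in> L k" "k \<le> m" for u k
  proof -
    have "u \<in> mspan W (B k \<union> {0})" using that(1) B(3)[of k] by auto
    then show ?thesis
    proof (induction rule: mspan_induct)
      case zero then show ?case by (auto intro!: bexI[of _ 0] mspan_zero submod_0[OF N])
    next
      case (step n a f)
      then obtain w where w: "w \<in> mspan W C" "X v ^ k \<bullet> n - w \<in> N k" by auto
      show ?case
      proof (cases "a = 0")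
        case False
        then have a: "a \<in> B k" using step by auto
        have "f \<bullet> (X v ^ k \<bullet> a - y k a) \<in> N k"
          using y[OF subsetD[OF B(2) a]] step by (intro submod_smul[OF N]) auto
        from submod_add[OF N w(2) this]
        have "X v ^ k \<bullet> (n + f \<bullet> a) - (w + f \<bullet> y k a) \<in> N k"
          by (simp add: smul_distribs smul_commute[of f] algebra_simps)
        moreover have "w + f \<bullet> y k a \<in> mspan W C"
          using w a step that by (intro mspan_step) (auto simp: C_def)
        ultimately show ?thesis by blast
      qed (use w in auto)
    qed
  qed
  have "c \<in> mspan ?W (C \<union> K)" if "c \<in> Y" "c \<in> N k" for c k
    using that
  proof (induction k arbitrary: c)
    case 0
    then have "c \<in> mspan W K" by (simp add: N_def)
    then show ?case using mspan_mono[of K "C \<union> K" W ?W] by auto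
  next
    case (Suc k)
    obtain u where u: "u \<in> mspan W A" "c - X v ^ k \<bullet> u \<in> N k" using N_Suc Suc by blast
    then have "X v ^ k \<bullet> u - c \<in> N k" using submod_diff_swap[OF N] by blast
    then have "u \<in> L k" using u Suc by (auto simp: L_def)
    \<comment> \<open>for \<open>k > m\<close> the leading coefficient already occurs in degree \<open>m\<close>, as the chain is stationary from there\<close>
    define k' where "k' = min k m"
    have "u \<in> L k'" using \<open>u \<in> L k\<close> Lm[of k] by (auto simp: k'_def min_def)
    then obtain w where w: "w \<in> mspan W C" "X v ^ k' \<bullet> u - w \<in> N k'"
      using lead[of u k'] by (auto simp: k'_def)
    let ?w = "X v ^ (k - k') \<bullet> w"
    have "w \<in> mspan ?W C" using w mspan_mono[of C C W ?W] by auto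
    then have wC: "?w \<in> mspan ?W C" using Xv by (intro mspan_smul)
    have "X v ^ (k - k') \<bullet> (X v ^ k' \<bullet> u - w) \<in> N (k - k' + k')"
      by (rule X_N_pow[OF w(2)])
    then have "X v ^ k \<bullet> u - ?w \<in> N k"
      by (simp add: k'_def smul_distribs smul_smul power_add[symmetric])
    from submod_add[OF N u(2) this] have "c - ?w \<in> N k" by simp
    moreover have "c - ?w \<in> Y"
      using Suc wC mspan_least[OF YV C(2)] by (auto intro: submod_diff[OF YV])
    ultimately have "c - ?w \<in> mspan ?W (C \<union> K)" by (rule Suc.IH[rotated])
    moreover have "?w \<in> mspan ?W (C \<union> K)" using wC mspan_mono[of C "C \<union> K" ?W ?W] by auto
    ultimately have "(c - ?w) + ?w \<in> mspan ?W (C \<union> K)" by (intro mspan_add)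
    then show ?case by simp
  qed
  then have "Y \<subseteq> mspan ?W (C \<union> K)" using insert.prems(6) N_exhaust by blast
  then show ?case using C by (auto simp: fg_def)
qed


section \<open>Finite free resolutions of graded subquotients\<close>

definition lincomb :: "nat \<Rightarrow> 'k::field vec \<Rightarrow> (nat \<Rightarrow> 'k vec) \<Rightarrow> 'k vec" where
  "lincomb b c a = (\<Sum>i<b. c i \<bullet> a i)"

definition free :: "(nat \<times> nat) set \<Rightarrow> nat \<Rightarrow> 'k::field vec set" where
  "free W b = {c. (\<forall>i. c i \<in> polys W) \<and> (\<forall>i\<ge>b. c i = 0)}"

text \<open>
  The relations modulo \<open>K\<close> between \<open>b\<close> given vectors, with coefficients in the polynomials in \<open>W\<close>.
\<close>

definition syz :: "(nat \<times> nat) set \<Rightarrow> nat \<Rightarrow> (nat \<Rightarrow> 'k vec) \<Rightarrow> 'k::field vec set \<Rightarrow> 'k vec set" where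
  "syz W b a K = {c \<in> free W b. lincomb b c a \<in> K}"

definition unitv :: "nat \<Rightarrow> 'k::field cox_poly \<Rightarrow> 'k vec" where
  "unitv i f = (\<lambda>j. if j = i then f else 0)"

definition homgens ::
  "(nat \<times> nat) set \<Rightarrow> (nat \<Rightarrow> multidegree) \<Rightarrow> 'k::field vec set \<Rightarrow> 'k vec set \<Rightarrow> nat \<Rightarrow>
    (nat \<Rightarrow> 'k vec) \<Rightarrow> (nat \<Rightarrow> multidegree) \<Rightarrow> bool" where
  "homgens W s Z K b a t \<longleftrightarrow>
     (\<forall>i<b. a i \<in> Z \<and> part s {t i} (a i) = a i) \<and> (\<forall>m\<in>Z. \<exists>c\<in>free W b. m - lincomb b c a \<in> K)"

text \<open>
  The module \<open>(Z + K)/K\<close> over the polynomials in \<open>W\<close> has a finite graded free resolution with at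
  most \<open>q\<close> nonzero terms, hence of length at most \<open>q - 1\<close>.  Counting terms instead of the length lets
  the zero module be the case \<open>q = 0\<close>, and makes it the start of every induction below.
\<close>

primrec has_res ::
  "nat \<Rightarrow> (nat \<times> nat) set \<Rightarrow> (nat \<Rightarrow> multidegree) \<Rightarrow> 'k::field vec set \<Rightarrow> 'k vec set \<Rightarrow> bool" where
  "has_res 0 W s Z K \<longleftrightarrow> Z \<subseteq> K"
| "has_res (Suc q) W s Z K \<longleftrightarrow> (\<exists>b a t. homgens W s Z K b a t \<and> has_res q W t (syz W b a K) {0})"

lemma lincomb_0_left [simp]: "lincomb b 0 a = 0" by (simp add: lincomb_def vec_apply)
lemma lincomb_0 [simp]: "lincomb 0 c a = 0" by (simp add: lincomb_def)
lemma lincomb_Suc: "lincomb (Suc b) c a = lincomb b c a + c b \<bullet> a b" by (simp add: lincomb_def)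
lemma lincomb_add: "lincomb b (c + d) a = lincomb b c a + lincomb b d a"
  by (simp add: lincomb_def vec_apply smul_distribs sum.distrib)
lemma lincomb_diff: "lincomb b (c - d) a = lincomb b c a - lincomb b d a"
  by (simp add: lincomb_def vec_apply smul_distribs sum_subtractf)
lemma lincomb_uminus: "lincomb b (- d) a = - lincomb b d a"
  using lincomb_diff[of b 0 d a] by simp
lemma lincomb_smul: "lincomb b (f \<bullet> c) a = f \<bullet> lincomb b c a"
  by (simp add: lincomb_def vec_apply smul_sum smul_smul)
lemma lincomb_cong: "(\<And>i. i < b \<Longrightarrow> c i = d i) \<Longrightarrow> (\<And>i. i < b \<Longrightarrow> a i = e i) \<Longrightarrow> lincomb b c a = lincomb b d e"
  by (simp add: lincomb_def)
lemma lincomb_unitv: "i < b \<Longrightarrow> lincomb b (unitv i f) a = f \<bullet> a i"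
proof -
  assume "i < b"
  have "lincomb b (unitv i f) a = (\<Sum>j<b. if j = i then f \<bullet> a i else 0)"
    unfolding lincomb_def by (rule sum.cong) (auto simp: unitv_def)
  then show ?thesis using \<open>i < b\<close> by simp
qed

lemma lincomb_split: "lincomb (b1 + b2) c a = lincomb b1 c a + lincomb b2 (\<lambda>i. c (i + b1)) (\<lambda>i. a (i + b1))"
  by (induction b2) (simp_all add: lincomb_Suc add.assoc add.commute[of b1])

lemma free_mono: "V \<subseteq> W \<Longrightarrow> b \<le> b' \<Longrightarrow> free V b \<subseteq> free W b'"
  using polys_mono[of V W] by (auto simp: free_def)

lemma submod_free: "submod W (free W b)"
  unfolding submod_def
proof (intro conjI ballI subsetI)
  fix c :: "'k::field vec" assume "c \<in> free W b"
  then have "{i. c i \<noteq> 0} \<subseteq> {..<b}" by (auto simp: free_def) (meson not_le)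
  then show "c \<in> vecs" by (auto simp: vecs_def intro: finite_subset)
qed (auto simp: free_def vec_apply polys_add polys_mult)

lemma graded_free: "graded s (free W b)"
  by (auto simp: graded_def free_def part_def polys_filter_terms)

lemma lincomb_mem:
  assumes "submod W Z" "\<And>i. i < b \<Longrightarrow> a i \<in> Z" "c \<in> free W b"
  shows "lincomb b c a \<in> Z"
  unfolding lincomb_def
  by (rule submod_sum[OF assms(1)]) (use assms in \<open>auto simp: free_def intro!: submod_smul[OF assms(1)]\<close>)

lemma lincomb_part:
  assumes "\<And>i. i < b \<Longrightarrow> part s {t i} (a i) = a i"
  shows "part s D (lincomb b c a) = lincomb b (part t D c) a"
  unfolding lincomb_def part_sum
  by (rule sum.cong) (auto simp: part_smul_vec[OF assms] part_def[of t])

lemma submod_syz: "submod W K \<Longrightarrow> submod W (syz W b a K)"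
  using submod_free[of W b] by (auto simp: submod_def syz_def lincomb_add lincomb_smul)

lemma graded_syz:
  assumes K: "graded s K" and a: "\<And>i. i < b \<Longrightarrow> part s {t i} (a i) = a i"
  shows "graded t (syz W b a K)"
  unfolding graded_def
proof (intro ballI allI)
  fix c D assume "c \<in> syz W b a K"
  then have c: "c \<in> free W b" "lincomb b c a \<in> K" unfolding syz_def by blast+
  have "part s D (lincomb b c a) = lincomb b (part t D c) a" by (rule lincomb_part[OF a])
  then have "lincomb b (part t D c) a \<in> K" using gradedD[OF K c(2), of D] by simp
  then show "part t D c \<in> syz W b a K"
    using gradedD[OF graded_free c(1)] by (simp add: syz_def)
qed

lemma homgensD:
  assumes "homgens W s Z K b a t"
  shows "\<And>i. i < b \<Longrightarrow> a i \<in> Z" "\<And>i. i < b \<Longrightarrow> part s {t i} (a i) = a i"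
    "\<And>m. m \<in> Z \<Longrightarrow> \<exists>c\<in>free W b. m - lincomb b c a \<in> K"
  using assms by (auto simp: homgens_def)

lemma has_res_Suc: "has_res q W s Z K \<Longrightarrow> has_res (Suc q) W s Z K"
proof (induction q arbitrary: s Z K)
  case 0
  have "homgens W s Z K 0 (\<lambda>_. 0) s" using 0 submod_0[OF submod_free[of W 0]]
    by (auto simp: homgens_def)
  moreover have "syz W 0 a K \<subseteq> {0}" for a by (auto simp: syz_def free_def fun_eq_iff vec_apply)
  ultimately show ?case unfolding has_res.simps by blast
next
  case (Suc q) then show ?case by (subst has_res.simps) (metis has_res.simps(2))
qed

lemma has_res_mono: "p \<le> q \<Longrightarrow> has_res p W s Z K \<Longrightarrow> has_res q W s Z K"
  by (induction q rule: dec_induct) (auto intro: has_res_Suc simp del: has_res.simps)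

text \<open>
  Maps of the ambient free modules.  They are required to be linear and homogeneous everywhere and
  not only on the modules to be compared; this holds for all maps that occur and keeps the rules
  simple.
\<close>

definition graded_linear ::
  "(nat \<times> nat) set \<Rightarrow> (nat \<Rightarrow> multidegree) \<Rightarrow> (nat \<Rightarrow> multidegree) \<Rightarrow> ('k::field vec \<Rightarrow> 'k vec) \<Rightarrow> bool" where
  "graded_linear W s s' \<phi> \<longleftrightarrow> (\<forall>c d. \<phi> (c + d) = \<phi> c + \<phi> d) \<and> (\<forall>f\<in>polys W. \<forall>c. \<phi> (f \<bullet> c) = f \<bullet> \<phi> c) \<and>
     (\<forall>D c. \<phi> (part s D c) = part s' D (\<phi> c))"

lemma graded_linear_diff: "graded_linear W s s' \<phi> \<Longrightarrow> \<phi> (c - d) = \<phi> c - \<phi> d"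
proof -
  assume "graded_linear W s s' \<phi>"
  then have "\<phi> (c - d + d) = \<phi> (c - d) + \<phi> d" unfolding graded_linear_def by blast
  then show ?thesis by (simp add: algebra_simps)
qed

lemma graded_linear_0: "graded_linear W s s' \<phi> \<Longrightarrow> \<phi> 0 = 0"
  using graded_linear_diff[of W s s' \<phi> 0 0] by simp

lemma graded_linear_lincomb: "graded_linear W s s' \<phi> \<Longrightarrow> c \<in> free W b \<Longrightarrow> \<phi> (lincomb b c a) = lincomb b c (\<lambda>i. \<phi> (a i))"
proof (induction b arbitrary: c)
  case (Suc b)
  let ?c = "\<lambda>i. if i < b then c i else 0"
  have c: "?c \<in> free W b" "lincomb b c = lincomb b ?c" using Suc(3) by (auto simp: free_def lincomb_def)
  have "c b \<in> polys W" using Suc(3) by (auto simp: free_def)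
  then show ?case using Suc(1)[OF Suc(2) c(1)] Suc(2) c(2)
    by (simp add: lincomb_Suc graded_linear_def)
qed (simp add: graded_linear_0)

lemma graded_linear_id: "graded_linear W s s (\<lambda>c. c)" by (simp add: graded_linear_def)

text \<open>
  Isomorphic modules have the same resolutions.  Only the first step has to be compared: lifts of the
  generators of \<open>Z'\<close> generate \<open>Z\<close>, and they have literally the same syzygies.
\<close>

lemma has_res_iso:
  assumes \<phi>: "graded_linear W s s' \<phi>"
    and Z: "submod W Z" "graded s Z" and K': "submod W K'" "graded s' K'"
    and ker: "\<And>m. m \<in> Z \<Longrightarrow> \<phi> m \<in> K' \<longleftrightarrow> m \<in> K"
    and into: "\<And>m. m \<in> Z \<Longrightarrow> \<exists>m'\<in>Z'. \<phi> m - m' \<in> K'"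
    and onto: "\<And>m'. m' \<in> Z' \<Longrightarrow> \<exists>m\<in>Z. \<phi> m - m' \<in> K'"
    and r: "has_res q W s' Z' K'"
  shows "has_res q W s Z K"
proof (cases q)
  case 0
  then have "Z' \<subseteq> K'" using r by simp
  then have "m \<in> K" if "m \<in> Z" for m
    using into[OF that] ker[OF that] submod_add[OF K'(1)] by (metis diff_add_cancel subsetD)
  then show ?thesis using 0 by auto
next
  case (Suc p)
  then obtain b a' t where g: "homgens W s' Z' K' b a' t" and r': "has_res p W t (syz W b a' K') {0}"
    using r by auto
  note g = homgensD[OF g]
  have "\<exists>m\<in>Z. part s {t i} m = m \<and> \<phi> m - a' i \<in> K'" if i: "i < b" for i
  proof -
    obtain m where m: "m \<in> Z" "\<phi> m - a' i \<in> K'" using onto[OF g(1)[OF i]] by auto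
    have "\<phi> (part s {t i} m) - a' i = part s' {t i} (\<phi> m - a' i)"
      using \<phi> g(2)[OF that] by (simp add: graded_linear_def part_diff)
    then show ?thesis using m Z(2) K'(2)
      by (intro bexI[of _ "part s {t i} m"]) (auto simp: part_part gradedD)
  qed
  then obtain a where a: "\<And>i. i < b \<Longrightarrow> a i \<in> Z" "\<And>i. i < b \<Longrightarrow> part s {t i} (a i) = a i"
    "\<And>i. i < b \<Longrightarrow> \<phi> (a i) - a' i \<in> K'"
    by metis
  have cmp: "\<phi> (lincomb b c a) - lincomb b c a' \<in> K'" if "c \<in> free W b" for c
  proof -
    have "\<phi> (lincomb b c a) - lincomb b c a' = lincomb b c (\<lambda>i. \<phi> (a i) - a' i)"
      unfolding graded_linear_lincomb[OF \<phi> that] by (simp add: lincomb_def smul_distribs sum_subtractf)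
    then show ?thesis using a(3) by (simp add: lincomb_mem[OF K'(1) _ that])
  qed
  have lcZ: "lincomb b c a \<in> Z" if "c \<in> free W b" for c
    using lincomb_mem[OF Z(1) a(1) that] .
  have in_iff: "\<phi> x \<in> K' \<longleftrightarrow> y \<in> K'" if "\<phi> x - y \<in> K'" for x y
    using that submod_add[OF K'(1), of "\<phi> x - y" y] submod_diff[OF K'(1), of "\<phi> x" "\<phi> x - y"] by auto
  have "syz W b a K = syz W b a' K'"
    unfolding syz_def using cmp lcZ ker in_iff by blast
  moreover have "homgens W s Z K b a t"
    unfolding homgens_def
  proof (intro conjI ballI allI impI)
    fix m assume m: "m \<in> Z"
    obtain m' where m': "m' \<in> Z'" "\<phi> m - m' \<in> K'" using into[OF m] by auto
    obtain c where c: "c \<in> free W b" "m' - lincomb b c a' \<in> K'" using g(3)[OF m'(1)] by auto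
    have "\<phi> (m - lincomb b c a) = (\<phi> m - m') + (m' - lincomb b c a') - (\<phi> (lincomb b c a) - lincomb b c a')"
      by (simp add: graded_linear_diff[OF \<phi>])
    then have "\<phi> (m - lincomb b c a) \<in> K'"
      using submod_diff[OF K'(1) submod_add[OF K'(1) m'(2) c(2)] cmp[OF c(1)]] by simp
    then have "m - lincomb b c a \<in> K" using ker submod_diff[OF Z(1) m lcZ[OF c(1)]] by simp
    then show "\<exists>c\<in>free W b. m - lincomb b c a \<in> K" using c(1) by auto
  qed (use a in auto)
  ultimately show ?thesis using r' unfolding Suc has_res.simps
    by (intro exI[of _ b] exI[of _ a] exI[of _ t]) simp
qed

text \<open>
  The horseshoe lemma.  Generators of \<open>Y\<close> modulo \<open>K\<close> and of \<open>Z\<close> modulo \<open>Y\<close> together generate \<open>Z\<close> modulo \<open>K\<close>.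
  Their syzygies contain those of the first family, as the vectors supported on the first \<open>b1\<close>
  coordinates, and the quotient is isomorphic to the syzygies of the second family by forgetting these
  coordinates.
\<close>

lemma has_res_horseshoe:
  assumes "submod W K" "graded s K" "submod W Y" "graded s Y" "submod W Z" "graded s Z" "K \<subseteq> Y" "Y \<subseteq> Z"
    and "has_res q W s Y K" "has_res q W s Z Y"
  shows "has_res q W s Z K"
  using assms
proof (induction q arbitrary: s K Y Z)
  case (Suc q)
  note K = Suc.prems(1,2) and Y = Suc.prems(3,4) and Z = Suc.prems(5,6)
  from Suc.prems(9) obtain b1 a1 t1 where g1: "homgens W s Y K b1 a1 t1"
    and r1: "has_res q W t1 (syz W b1 a1 K) {0}" by auto
  from Suc.prems(10) obtain b2 a2 t2 where g2: "homgens W s Z Y b2 a2 t2"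
    and r2: "has_res q W t2 (syz W b2 a2 Y) {0}" by auto
  note g1 = homgensD[OF g1] and g2 = homgensD[OF g2]
  define a where "a i = (if i < b1 then a1 i else a2 (i - b1))" for i
  define t where "t i = (if i < b1 then t1 i else t2 (i - b1))" for i
  define b where "b = b1 + b2"
  define sh where "sh c = (\<lambda>i. c (i + b1))" for c :: "'a vec"
  define join where "join c d = (\<lambda>i. if i < b1 then c i else d (i - b1))" for c d :: "'a vec"
  have lincomb: "lincomb b c a = lincomb b1 c a1 + lincomb b2 (sh c) a2" for c
    unfolding b_def lincomb_split sh_def by (intro arg_cong2[of _ _ _ _ "(+)"] lincomb_cong) (auto simp: a_def)
  have join: "join c d \<in> free W b" "sh (join c d) = d" "lincomb b1 (join c d) e = lincomb b1 c e"
    if "c \<in> free W b1" "d \<in> free W b2" for c d e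
    using that by (auto simp: free_def join_def sh_def b_def intro!: lincomb_cong)
  have ah: "a i \<in> Z" "part s {t i} (a i) = a i" if "i < b" for i
    using that g1(1,2) g2(1,2) Suc.prems(8) by (auto simp: a_def t_def b_def)
  have gens: "\<exists>c\<in>free W b. m - lincomb b c a \<in> K" if m: "m \<in> Z" for m
  proof -
    obtain d where d: "d \<in> free W b2" "m - lincomb b2 d a2 \<in> Y" using g2(3)[OF m] by auto
    obtain c where c: "c \<in> free W b1" "m - lincomb b2 d a2 - lincomb b1 c a1 \<in> K" using g1(3)[OF d(2)] by auto
    show ?thesis using c d join[OF c(1) d(1)]
      by (intro bexI[of _ "join c d"]) (auto simp: lincomb diff_diff_add add.commute)
  qed
  define Y' where "Y' = syz W b1 a1 K"
  define Z' where "Z' = syz W b a K"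
  have Y': "submod W Y'" "graded t1 Y'" and Z': "submod W Z'" "graded t Z'"
    using submod_syz[OF K(1)] graded_syz[OF K(2)] g1(2) ah(2) by (auto simp: Y'_def Z'_def)
  have sh0: "sh c = 0" if "c \<in> free W b1" for c
    using that by (auto simp: free_def sh_def fun_eq_iff vec_apply)
  have "free W b1 \<subseteq> free W b" by (rule free_mono) (auto simp: b_def)
  then have Y'Z': "Y' \<subseteq> Z'"
    using sh0 by (auto simp: Y'_def Z'_def syz_def lincomb)
  have "graded t Y'"
    unfolding graded_def
  proof (intro ballI allI)
    fix c D assume c: "c \<in> Y'"
    then have "part t D c = part t1 D c"
      by (auto simp: Y'_def syz_def free_def part_def t_def fun_eq_iff)
    then show "part t D c \<in> Y'" using c Y'(2) by (auto simp: graded_def)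
  qed
  note Y' = Y'(1) this
  have "has_res q W t Y' {0}"
  proof (rule has_res_iso[where \<phi> = "\<lambda>c i. if i < b1 then c i else 0"])
    show "has_res q W t1 Y' {0}" using r1 by (simp add: Y'_def)
    have id: "(\<lambda>i. if i < b1 then c i else 0) = c" if "c \<in> Y'" for c
      using that by (auto simp: Y'_def syz_def free_def fun_eq_iff)
    show "graded_linear W t t1 (\<lambda>c i. if i < b1 then c i else 0)"
      by (auto simp: graded_linear_def fun_eq_iff vec_apply part_def t_def)
    show "((\<lambda>i. if i < b1 then m i else 0) \<in> {0}) = (m \<in> {0})" if "m \<in> Y'" for m
      using id[OF that] by simp
    show "\<exists>m'\<in>Y'. (\<lambda>i. if i < b1 then m i else 0) - m' \<in> {0}" if "m \<in> Y'" for m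
      using id[OF that] that by auto
    show "\<exists>m\<in>Y'. (\<lambda>i. if i < b1 then m i else 0) - m' \<in> {0}" if "m' \<in> Y'" for m'
      using id[OF that] that by auto
  qed (use Y' submod_singleton_0 graded_0 in auto)
  moreover have "has_res q W t Z' Y'"
  proof (rule has_res_iso[where \<phi> = sh])
    show "has_res q W t2 (syz W b2 a2 Y) {0}" by (rule r2)
    show "graded_linear W t t2 sh" by (auto simp: graded_linear_def sh_def fun_eq_iff vec_apply part_def t_def)
    show "sh m \<in> {0} \<longleftrightarrow> m \<in> Y'" if "m \<in> Z'" for m
    proof
      assume "sh m \<in> {0}"
      then have sm: "sh m = 0" by simp
      have "m i = 0" if "i \<ge> b1" for i
        using fun_cong[OF sm, of "i - b1"] that by (simp add: sh_def vec_apply)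
      then have "m \<in> free W b1" using \<open>m \<in> Z'\<close> by (auto simp: Z'_def syz_def free_def)
      then show "m \<in> Y'" using \<open>m \<in> Z'\<close> sm by (auto simp: Z'_def Y'_def syz_def lincomb)
    qed (use sh0 in \<open>auto simp: Y'_def syz_def\<close>)
    show "\<exists>m'\<in>syz W b2 a2 Y. sh m - m' \<in> {0}" if "m \<in> Z'" for m
    proof -
      have m: "m \<in> free W b" "lincomb b m a \<in> K" using that by (auto simp: Z'_def syz_def)
      let ?m = "\<lambda>i. if i < b1 then m i else 0"
      have "lincomb b1 ?m a1 = lincomb b1 m a1" by (rule lincomb_cong) auto
      moreover have "?m \<in> free W b1" using m(1) by (auto simp: free_def)
      ultimately have "lincomb b1 m a1 \<in> Y" using lincomb_mem[where c = ?m and b = b1 and a = a1, OF Y(1)] g1(1) by simp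
      then have "lincomb b2 (sh m) a2 \<in> Y"
        using m(2) Suc.prems(7) submod_diff[OF Y(1), of "lincomb b m a" "lincomb b1 m a1"] by (auto simp: lincomb)
      moreover have "sh m \<in> free W b2" using m(1) by (auto simp: free_def sh_def b_def)
      ultimately show ?thesis by (intro bexI[of _ "sh m"]) (auto simp: syz_def)
    qed
    show "\<exists>m\<in>Z'. sh m - m' \<in> {0}" if "m' \<in> syz W b2 a2 Y" for m'
    proof -
      have m': "m' \<in> free W b2" "lincomb b2 m' a2 \<in> Y" using that by (auto simp: syz_def)
      obtain c where c: "c \<in> free W b1" "lincomb b2 m' a2 - lincomb b1 c a1 \<in> K" using g1(3)[OF m'(2)] by auto
      have nc: "- c \<in> free W b1" by (rule submod_uminus[OF submod_free c(1)])
      have "lincomb b1 (- c) a1 + lincomb b2 m' a2 \<in> K" using c(2) by (simp add: lincomb_uminus)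
      then have "join (- c) m' \<in> Z'" using join[OF nc m'(1)] by (auto simp: Z'_def syz_def lincomb)
      then show ?thesis using join(2)[OF nc m'(1)] by (intro bexI[of _ "join (- c) m'"]) auto
    qed
  qed (use Z' submod_singleton_0 graded_0 in auto)
  ultimately have "has_res q W t Z' {0}"
    using Y' Z' Y'Z' submod_0[OF Y'(1)] submod_singleton_0 graded_0
    by (intro Suc.IH[of "{0}" t Y' Z']) auto
  moreover have "homgens W s Z K b a t" using ah gens by (auto simp: homgens_def)
  ultimately show ?case unfolding Z'_def has_res.simps by blast
qed auto


section \<open>Changing the number of variables\<close>

declare has_res.simps [simp del]

lemma mspan_lincomb:
  assumes "A \<subseteq> a ` {..<b}" "submod W K" "m \<in> mspan W (A \<union> K)"
  shows "\<exists>c\<in>free W b. m - lincomb b c a \<in> K"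
  using assms(3)
proof (induction rule: mspan_induct)
  case zero
  then show ?case using submod_0[OF submod_free] submod_0[OF assms(2)] by (intro bexI[of _ 0]) auto
next
  case (step m x f)
  then obtain c where c: "c \<in> free W b" "m - lincomb b c a \<in> K" by auto
  show ?case
  proof (cases "x \<in> K")
    case True
    then have "(m - lincomb b c a) + f \<bullet> x \<in> K"
      using c step submod_add[OF assms(2)] submod_smul[OF assms(2)] by blast
    then show ?thesis using c by (intro bexI[of _ c]) (auto simp: algebra_simps)
  next
    case False
    then obtain i where i: "i < b" "x = a i" using step assms(1) by auto
    have "unitv i f \<in> free W b" using i step by (auto simp: free_def unitv_def)
    then have "c + unitv i f \<in> free W b" by (rule submod_add[OF submod_free c(1)])
    then show ?thesis using c i
      by (intro bexI[of _ "c + unitv i f"]) (auto simp: lincomb_add lincomb_unitv algebra_simps)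
  qed
qed

text \<open>
  The homogeneous parts of generators generate.
\<close>

lemma fg_homogeneous:
  assumes "fg W Z K" "submod W K" "submod W Z" "graded s Z"
  obtains A where "finite A" "A \<subseteq> Z" "Z \<subseteq> mspan W (A \<union> K)" "\<And>x. x \<in> A \<Longrightarrow> \<exists>d. part s {d} x = x"
proof -
  obtain A where A: "finite A" "A \<subseteq> Z" "Z \<subseteq> mspan W (A \<union> K)" using assms(1) by (auto simp: fg_def)
  define A' where "A' = (\<Union>x\<in>A. (\<lambda>d. part s {d} x) ` degs s x)"
  have fin: "finite A'" unfolding A'_def
    using A(1,2) submod_vecs[OF assms(3)] by (auto intro: finite_degs)
  have A'Z: "A' \<subseteq> Z" using A(2) gradedD[OF assms(4)] by (auto simp: A'_def)
  have S: "submod W (mspan W (A' \<union> K))"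
    using A'Z submod_vecs[OF assms(2)] submod_vecs[OF assms(3)] by (intro submod_mspan) auto
  have "x \<in> mspan W (A' \<union> K)" if "x \<in> A" for x
  proof -
    have "(\<Sum>d\<in>degs s x. part s {d} x) \<in> mspan W (A' \<union> K)"
      using that by (intro submod_sum[OF S]) (auto simp: A'_def intro!: mspan_base)
    then show ?thesis using vec_eq_sum_parts[of x s] that A(2) submod_vecs[OF assms(3)] by auto
  qed
  then have "mspan W (A \<union> K) \<subseteq> mspan W (A' \<union> K)"
    by (intro mspan_least[OF S]) (auto intro: mspan_base)
  moreover have "\<exists>d. part s {d} x = x" if "x \<in> A'" for x
  proof -
    obtain y d where "x = part s {d} y" using \<open>x \<in> A'\<close> by (auto simp: A'_def)
    then have "part s {d} x = x" by (simp add: part_part)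
    then show ?thesis ..
  qed
  ultimately show ?thesis using fin A'Z A(3) by (intro that[of A']) auto
qed

lemma homgens_of_set:
  assumes "finite A" "A \<subseteq> Z" "Z \<subseteq> mspan W (A \<union> K)" "\<And>x. x \<in> A \<Longrightarrow> \<exists>d. part s {d} x = x" "submod W K"
  obtains a t where "homgens W s Z K (card A) a t" "inj_on a {..<card A}" "a ` {..<card A} = A"
proof -
  obtain a where a: "bij_betw a {0..<card A} A" using ex_bij_betw_nat_finite[OF assms(1)] by auto
  then have im: "a ` {..<card A} = A" by (simp add: bij_betw_def atLeast0LessThan)
  obtain t where t: "\<And>x. x \<in> A \<Longrightarrow> part s {t x} x = x" using assms(4) by metis
  have "homgens W s Z K (card A) a (\<lambda>i. t (a i))"
    unfolding homgens_def
  proof (intro conjI allI impI ballI)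
    fix i assume "i < card A" then have "a i \<in> A" using im by auto
    then show "a i \<in> Z" "part s {t (a i)} (a i) = a i" using assms(2) t by auto
  next
    fix m assume "m \<in> Z"
    then show "\<exists>c\<in>free W (card A). m - lincomb (card A) c a \<in> K"
      using mspan_lincomb[of A a "card A" W K m] im assms(3,5) by auto
  qed
  then show ?thesis using that a im by (auto simp: bij_betw_def atLeast0LessThan)
qed

text \<open>
  Without variables the coefficients form a field, and a minimal family of generators is a basis:
  a nontrivial relation would express one generator by the others.
\<close>

lemma has_res_field:
  assumes "fg {} Z K" "submod {} K" "submod {} Z" "graded s Z"
  shows "has_res 1 {} s Z K"
proof -
  define good where "good A \<longleftrightarrow> finite A \<and> A \<subseteq> Z \<and> Z \<subseteq> mspan {} (A \<union> K) \<and> (\<forall>x\<in>A. \<exists>d. part s {d} x = x)" for A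
  have "\<exists>A. good A" using fg_homogeneous[OF assms] unfolding good_def by metis
  define A where "A = arg_min card good"
  have A: "good A" and min: "\<And>B. good B \<Longrightarrow> card A \<le> card B"
    unfolding A_def using arg_min_nat_lemma[of good _ card] \<open>\<exists>A. good A\<close> by blast+
  then have "finite A" by (auto simp: good_def)
  obtain a t where at: "homgens {} s Z K (card A) a t" "inj_on a {..<card A}" "a ` {..<card A} = A"
    by (rule homgens_of_set[of A Z "{}" K s]) (use A assms in \<open>auto simp: good_def\<close>)
  have "c = 0" if c: "c \<in> free {} (card A)" "lincomb (card A) c a \<in> K" for c
  proof (rule ccontr)
    assume "c \<noteq> 0"
    then obtain i where ci: "c i \<noteq> 0" by (auto simp: fun_eq_iff vec_apply)
    then have i: "i < card A" using c(1) by (auto simp: free_def) (meson not_le)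
    obtain x where x: "c i = single 0 x" using c(1) by (auto simp: free_def polys_empty)
    then have "x \<noteq> 0" using ci by auto
    let ?B = "A - {a i}"
    have S: "submod {} (mspan {} (?B \<union> K))"
      using A submod_vecs[OF assms(3)] submod_vecs[OF assms(2)]
      by (intro submod_mspan) (auto simp: good_def)
    have eq: "lincomb (card A) c a = c i \<bullet> a i + (\<Sum>j\<in>{..<card A} - {i}. c j \<bullet> a j)"
      unfolding lincomb_def using i by (simp add: sum.remove)
    have rest: "(\<Sum>j\<in>{..<card A} - {i}. c j \<bullet> a j) \<in> mspan {} (?B \<union> K)"
    proof (rule submod_sum[OF S])
      fix j assume j: "j \<in> {..<card A} - {i}"
      then have "a j \<in> ?B" using at i by (auto dest: inj_onD)
      then show "c j \<bullet> a j \<in> mspan {} (?B \<union> K)"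
        using c(1) by (intro mspan_smul mspan_base) (auto simp: free_def)
    qed
    have "lincomb (card A) c a \<in> mspan {} (?B \<union> K)" using c(2) by (intro mspan_base) simp
    from submod_diff[OF S this rest] have ca: "c i \<bullet> a i \<in> mspan {} (?B \<union> K)" by (simp add: eq)
    have "single 0 (1 / x) \<in> polys {}" by (auto simp: polys_empty)
    from submod_smul[OF S this ca]
    have "single 0 (1 / x) \<bullet> c i \<bullet> a i \<in> mspan {} (?B \<union> K)" .
    then have ai: "a i \<in> mspan {} (?B \<union> K)" using x \<open>x \<noteq> 0\<close> by (simp add: smul_smul mult_single)
    have "mspan {} (A \<union> K) \<subseteq> mspan {} (?B \<union> K)"
      by (rule mspan_least[OF S]) (use ai in \<open>auto intro: mspan_base\<close>)
    then have "good ?B" using A by (auto simp: good_def)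
    moreover have "a i \<in> A" using at(3) i by auto
    then have "card ?B < card A" using \<open>finite A\<close> by (intro psubset_card_mono) auto
    ultimately show False using min[of ?B] by simp
  qed
  then have "syz {} (card A) a K \<subseteq> {0}" by (auto simp: syz_def)
  then show ?thesis unfolding One_nat_def has_res.simps using at(1) by blast
qed


definition dropv :: "nat \<times> nat \<Rightarrow> 'k::field vec \<Rightarrow> 'k vec" where
  "dropv v c = (\<lambda>i. drop_var v (c i))"

lemma graded_linear_dropv: "v \<notin> W \<Longrightarrow> graded_linear W s s (dropv v)"
  unfolding graded_linear_def dropv_def fun_eq_iff vec_apply
  by (auto simp: drop_var_add drop_var_mult) (simp add: drop_var_def part_def filter_terms_filter_terms conj_commute)

lemma dropv_free: "c \<in> free (insert v W) b \<Longrightarrow> dropv v c \<in> free W b"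
  by (auto simp: free_def dropv_def drop_var_polys)

lemma dropv_eq: "c \<in> free W b \<Longrightarrow> v \<notin> W \<Longrightarrow> dropv v c = c"
  by (auto simp: free_def dropv_def drop_var_eq[of _ W] fun_eq_iff)

lemma dropv_X: "dropv v (X v \<bullet> c) = 0"
  by (simp add: dropv_def fun_eq_iff vec_apply drop_var_X_mult)

lemma dropv_decomp:
  assumes "c \<in> free (insert v W) b"
  obtains g where "g \<in> free (insert v W) b" "c = dropv v c + X v \<bullet> g"
proof -
  have "\<exists>g. g \<in> polys (insert v W) \<and> c i = drop_var v (c i) + X v * g \<and> (i \<ge> b \<longrightarrow> g = 0)" for i
  proof (cases "i \<ge> b")
    case True then show ?thesis using assms by (intro exI[of _ 0]) (auto simp: free_def)
  next
    case False
    have "c i \<in> polys (insert v W)" using assms by (auto simp: free_def)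
    from drop_var_decomp[OF this] show ?thesis using False by metis
  qed
  then obtain g where "\<And>i. g i \<in> polys (insert v W) \<and> c i = drop_var v (c i) + X v * g i \<and> (i \<ge> b \<longrightarrow> g i = 0)"
    by metis
  then show ?thesis by (intro that[of g]) (auto simp: free_def dropv_def fun_eq_iff vec_apply)
qed

lemma X_smul_eq_0_iff: "X v \<bullet> c = 0 \<longleftrightarrow> c = 0"
  by (auto simp: fun_eq_iff vec_apply X_mult_eq_0_iff)

lemma has_res_X_free: "v \<in> W \<Longrightarrow> has_res 1 W t ((\<bullet>) (X v) ` free W b) {0}"
proof -
  assume v: "v \<in> W"
  let ?a = "\<lambda>i. X v \<bullet> unitv i 1" and ?t = "\<lambda>i. t i + single (fst v) 1"
  have lincomb: "lincomb b c ?a = X v \<bullet> c" if "c \<in> free W b" for c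
  proof
    fix j
    have "lincomb b c ?a j = (\<Sum>i<b. if i = j then X v * c j else 0)"
      unfolding lincomb_def sum_fun_apply by (rule sum.cong) (auto simp: vec_apply unitv_def)
    also have "\<dots> = X v * c j"
      using that by (cases "j < b") (auto simp: free_def)
    finally show "lincomb b c ?a j = (X v \<bullet> c) j" by (simp add: vec_apply)
  qed
  have "homgens W t ((\<bullet>) (X v) ` free W b) {0} b ?a ?t"
    unfolding homgens_def
  proof (intro conjI allI impI ballI)
    fix i assume "i < b"
    then have "unitv i 1 \<in> free W b" by (auto simp: free_def unitv_def)
    then show "?a i \<in> (\<bullet>) (X v) ` free W b" by auto
    show "part t {?t i} (?a i) = ?a i"
      by (auto simp: part_eq_iff vec_apply unitv_def X_def add.commute)
  next
    fix m assume "m \<in> (\<bullet>) (X v) ` free W b"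
    then obtain c where "c \<in> free W b" "m = X v \<bullet> c" by auto
    then show "\<exists>c\<in>free W b. m - lincomb b c ?a \<in> {0}" using lincomb[of c] by (intro bexI[of _ c]) auto
  qed
  moreover have "syz W b ?a {0} \<subseteq> {0}"
  proof
    fix c assume "c \<in> syz W b ?a {0}"
    then have "X v \<bullet> c = 0" using lincomb[of c] by (simp add: syz_def)
    then show "c \<in> {0}" by (simp add: X_smul_eq_0_iff)
  qed
  ultimately show ?thesis unfolding One_nat_def has_res.simps by blast
qed

lemma homgens_mono: "homgens V s Z K b a t \<Longrightarrow> V \<subseteq> W \<Longrightarrow> homgens W s Z K b a t"
  using free_mono[of V W b b] by (fastforce simp: homgens_def)

text \<open>
  By induction on the resolution over \<open>W\<close>.  With \<open>v\<close> as a further variable, the same generators have the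
  syzygies \<open>Y \<oplus> v F\<close>, where \<open>Y\<close> are the syzygies over \<open>W\<close> and \<open>F\<close> is the free module, because \<open>v\<close> times any
  combination of the generators lies in \<open>K\<close>.  Modulo \<open>v F\<close> this is \<open>Y\<close>, which \<open>v\<close> kills, and \<open>v F\<close> is
  free.
\<close>

lemma has_res_add_variable:
  assumes "v \<notin> W" "submod (insert v W) K" "graded s K" "submod (insert v W) Z" "graded s Z"
    and "\<And>m. m \<in> Z \<Longrightarrow> X v \<bullet> m \<in> K" and "has_res q W s Z K"
  shows "has_res (Suc q) (insert v W) s Z K"
  using assms
proof (induction q arbitrary: s Z K)
  case 0
  then show ?case by (intro has_res_Suc) (simp add: has_res.simps)
next
  case (Suc q)
  let ?W = "insert v W"
  note K = Suc.prems(2,3) and Z = Suc.prems(4,5)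
  obtain b a t where g: "homgens W s Z K b a t" and r: "has_res q W t (syz W b a K) {0}"
    using Suc.prems(7) by (auto simp: has_res.simps)
  note gD = homgensD[OF g]
  let ?Y = "syz ?W b a K" and ?F = "(\<bullet>) (X v) ` free ?W b"
  have Y: "submod ?W ?Y" "graded t ?Y" using submod_syz[OF K(1)] graded_syz[OF K(2) gD(2)] by auto
  have F: "submod ?W ?F" "graded t ?F"
    by (auto intro: submod_image_smul submod_free graded_X_image graded_free)
  have XF: "X v \<bullet> c \<in> free ?W b" if "c \<in> free ?W b" for c
    using that by (intro submod_smul[OF submod_free] polys_X) auto
  have XK: "lincomb b (X v \<bullet> c) a \<in> K" if "c \<in> free ?W b" for c
    unfolding lincomb_smul by (rule Suc.prems(6), rule lincomb_mem[OF Z(1) gD(1) that])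
  have FY: "?F \<subseteq> ?Y" using XF XK by (auto simp: syz_def)
  have "has_res q W t ?Y ?F"
  proof (rule has_res_iso[OF graded_linear_dropv[OF Suc.prems(1), of t]])
    show "has_res q W t (syz W b a K) {0}" by (rule r)
    show "submod W ?Y" using submod_mono[OF _ Y(1)] by auto
    show "(dropv v m \<in> {0}) = (m \<in> ?F)" if "m \<in> ?Y" for m
    proof
      have m: "m \<in> free ?W b" using that by (simp add: syz_def)
      assume "dropv v m \<in> {0}"
      then show "m \<in> ?F" using dropv_decomp[OF m] by auto
    qed (auto simp: dropv_X)
    show "\<exists>m'\<in>syz W b a K. dropv v m - m' \<in> {0}" if "m \<in> ?Y" for m
    proof -
      have m: "m \<in> free ?W b" "lincomb b m a \<in> K" using that by (auto simp: syz_def)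
      obtain g where g: "g \<in> free ?W b" "m = dropv v m + X v \<bullet> g" by (rule dropv_decomp[OF m(1)])
      then have "lincomb b (dropv v m) a = lincomb b m a - lincomb b (X v \<bullet> g) a"
        by (metis add_diff_cancel_right' lincomb_diff)
      then have "lincomb b (dropv v m) a \<in> K" using submod_diff[OF K(1) m(2) XK[OF g(1)]] by simp
      then show ?thesis using dropv_free[OF m(1)] by (auto simp: syz_def)
    qed
    show "\<exists>m\<in>?Y. dropv v m - m' \<in> {0}" if "m' \<in> syz W b a K" for m'
      using that dropv_eq[of m' W b v] free_mono[of W ?W b b] Suc.prems(1)
      by (intro bexI[of _ m']) (auto simp: syz_def)
  qed (use Y submod_singleton_0 graded_0 in auto)
  then have "has_res (Suc q) ?W t ?Y ?F"
    using Y F Suc.prems(1) by - (rule Suc.IH, auto simp: syz_def)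
  moreover have "has_res (Suc q) ?W t ?F {0}"
    using has_res_mono[of 1 "Suc q" ?W t ?F "{0}"] has_res_X_free[of v ?W t b] by simp
  ultimately have "has_res (Suc q) ?W t ?Y {0}"
    using Y F FY submod_0[OF F(1)]
    by - (rule has_res_horseshoe[of ?W "{0}" t ?F], auto simp: submod_singleton_0 graded_0)
  moreover have "homgens ?W s Z K b a t" using homgens_mono[OF g] by auto
  ultimately show ?case unfolding has_res.simps(2)[of "Suc q"] by blast
qed


definition degs_ge :: "nat \<Rightarrow> int \<Rightarrow> multidegree set" where
  "degs_ge g \<delta> = {e. \<delta> \<le> lookup e g}"

text \<open>
  Comparing parts of degree less than \<open>\<delta> + N\<close> in the equation \<open>Z = Q + v Z\<close> shows, by induction on \<open>N\<close>,
  that the elements of \<open>Z\<close> of such degrees lie in \<open>Q\<close>: multiplication by \<open>v\<close> raises this degree.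
\<close>

lemma graded_nakayama:
  assumes Q: "submod V Q" "graded s Q" "\<And>c. c \<in> Q \<Longrightarrow> X v \<bullet> c \<in> Q"
    and Z: "submod V Z" "graded s Z" "\<And>m. m \<in> Z \<Longrightarrow> part s (degs_ge (fst v) \<delta>) m = m"
    and gen: "Z \<subseteq> set_sum Q ((\<bullet>) (X v) ` Z)"
  shows "Z \<subseteq> Q"
proof -
  \<comment> \<open>degrees less than \<open>\<delta> + N\<close>; by the bound \<open>\<delta>\<close>, only zero has such degrees if \<open>N = 0\<close>\<close>
  define below where "below N = {e :: multidegree. lookup e (fst v) < \<delta> + int N}" for N
  have *: "m \<in> Q" if "m \<in> Z" "part s (below N) m = m" for m N
    using that
  proof (induction N arbitrary: m)
    case 0
    have "part s (below 0 \<inter> degs_ge (fst v) \<delta>) m = m"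
      using 0 Z(3)[of m] by (metis part_part)
    moreover have "below 0 \<inter> degs_ge (fst v) \<delta> = {}" by (auto simp: below_def degs_ge_def)
    ultimately have "m = 0" by (metis empty_iff part_eq_0_iff)
    then show ?case using submod_0[OF Q(1)] by simp
  next
    case (Suc N)
    obtain x y where xy: "x \<in> Q" "y \<in> Z" "m = x + X v \<bullet> y"
      using gen Suc.prems(1) by (fastforce simp: set_sum_def)
    have "{d. single (fst v) 1 + d \<in> below (Suc N)} = below N"
      by (auto simp: below_def lookup_add)
    then have "m = part s (below (Suc N)) x + X v \<bullet> part s (below N) y"
      using Suc.prems(2) xy(3) by (metis part_X_smul part_add)
    moreover have "part s (below N) y \<in> Q"
      by (rule Suc.IH) (auto simp: part_part gradedD[OF Z(2) xy(2)])
    ultimately show ?case using Q(3) submod_add[OF Q(1)] gradedD[OF Q(2) xy(1)] by metis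
  qed
  show ?thesis
  proof
    fix m assume m: "m \<in> Z"
    have fin: "finite (degs s m)" using m submod_vecs[OF Z(1)] by (intro finite_degs) auto
    define N where "N = nat (Max (insert 0 ((\<lambda>e. lookup e (fst v) - \<delta> + 1) ` degs s m)))"
    have "lookup e (fst v) < \<delta> + int N" if "e \<in> degs s m" for e
    proof -
      have "lookup e (fst v) - \<delta> + 1 \<le> Max (insert 0 ((\<lambda>e. lookup e (fst v) - \<delta> + 1) ` degs s m))"
        using fin that by (intro Max_ge) auto
      then show ?thesis by (simp add: N_def)
    qed
    then have "degs s m \<subseteq> below N" by (auto simp: below_def)
    then have "part s (below N) m = m" using part_degs[of s m]
      by (metis Int_absorb1 part_part)
    then show "m \<in> Q" by (rule *[OF m])
  qed
qed

lemma set_sum_0_left: "set_sum {0} A = (A :: 'a::comm_monoid_add set)" by (auto simp: set_sum_def)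

lemma free_bounded_below: "\<exists>\<delta>. \<forall>c\<in>free W b. part t (degs_ge g \<delta>) c = c"
proof -
  define \<delta> where "\<delta> = Min (insert 0 ((\<lambda>i. lookup (t i) g) ` {..<b}))"
  have "part t (degs_ge g \<delta>) c = c" if c: "c \<in> free W b" for c
    unfolding part_eq_iff
  proof (intro allI ballI)
    fix i \<mu> assume "\<mu> \<in> keys (c i)"
    then have "i < b" using c by (auto simp: free_def) (metis keys_zero empty_iff not_le)
    then have "\<delta> \<le> lookup (t i) g" unfolding \<delta>_def by (intro Min_le) auto
    then show "exponent_degree \<mu> + t i \<in> degs_ge g \<delta>"
      using lookup_exponent_degree_nonneg[of \<mu> g] by (simp add: degs_ge_def lookup_add)
  qed
  then show ?thesis by blast
qed

text \<open>
  If \<open>v\<close> is a nonzerodivisor on \<open>Z\<close> modulo \<open>K\<close>, generators of \<open>Z\<close> modulo \<open>v Z\<close> generate \<open>Z\<close> by Nakayama's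
  lemma, and setting \<open>v = 0\<close> identifies their syzygies modulo \<open>v\<close> times themselves with the syzygies of
  the generators of \<open>Z/vZ\<close> over \<open>W\<close>.  As \<open>v\<close> is also a nonzerodivisor on the syzygies, the argument
  repeats.
\<close>

lemma has_res_lift:
  assumes "v \<notin> W" "submod (insert v W) K" "graded s K" "submod (insert v W) Z" "graded s Z"
    and "\<And>m. m \<in> Z \<Longrightarrow> part s (degs_ge (fst v) \<delta>) m = m"
    and "\<And>m. m \<in> Z \<Longrightarrow> X v \<bullet> m \<in> K \<Longrightarrow> m \<in> K"
    and "has_res q W s Z (set_sum K ((\<bullet>) (X v) ` Z))"
  shows "has_res q (insert v W) s Z K"
  using assms
proof (induction q arbitrary: s Z K \<delta>)
  case 0
  have "X v \<bullet> c \<in> K" if "c \<in> K" for c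
    using that by (intro submod_smul[OF 0(2)] polys_X) auto
  then have "Z \<subseteq> K"
    using 0(8) by (intro graded_nakayama[OF 0(2,3) _ 0(4,5,6)]) (auto simp: has_res.simps)
  then show ?case by (simp add: has_res.simps)
next
  case (Suc q)
  let ?W = "insert v W" and ?XZ = "(\<bullet>) (X v) ` Z"
  note K = Suc.prems(2,3) and Z = Suc.prems(4,5)
  have X: "X v \<in> polys ?W" by (rule polys_X) simp
  obtain b a t where g: "homgens W s Z (set_sum K ?XZ) b a t"
    and r: "has_res q W t (syz W b a (set_sum K ?XZ)) {0}"
    using Suc.prems(8) by (auto simp: has_res.simps)
  note gD = homgensD[OF g]
  have lcZ: "lincomb b c a \<in> Z" if "c \<in> free ?W b" for c
    by (rule lincomb_mem[OF Z(1) gD(1) that])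
  let ?L = "(\<lambda>c. lincomb b c a) ` free ?W b"
  have L: "submod ?W ?L"
    unfolding submod_def
  proof (intro conjI ballI)
    show "?L \<subseteq> vecs" using lcZ submod_vecs[OF Z(1)] by blast
    show "0 \<in> ?L" using submod_0[OF submod_free] by (intro image_eqI[of _ _ 0]) auto
    show "x + y \<in> ?L" if "x \<in> ?L" "y \<in> ?L" for x y
      using that submod_add[OF submod_free[of ?W b]] by (force simp: lincomb_add[symmetric])
    show "f \<bullet> x \<in> ?L" if "x \<in> ?L" "f \<in> polys ?W" for x f
      using that submod_smul[OF submod_free[of ?W b]] by (force simp: lincomb_smul[symmetric])
  qed
  have gL: "graded s ?L"
    unfolding graded_def
  proof (intro ballI allI)
    fix m D assume "m \<in> ?L"
    then obtain c where c: "c \<in> free ?W b" "m = lincomb b c a" by auto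
    have "part s D m = lincomb b (part t D c) a" unfolding c(2) by (rule lincomb_part[OF gD(2)])
    then show "part s D m \<in> ?L" using gradedD[OF graded_free c(1)] by auto
  qed
  have "Z \<subseteq> set_sum K ?L"
  proof (rule graded_nakayama[OF _ _ _ Z Suc.prems(6)])
    show S: "submod ?W (set_sum K ?L)" by (rule submod_set_sum[OF K(1) L])
    show "graded s (set_sum K ?L)" by (rule graded_set_sum[OF K(2) gL])
    show "X v \<bullet> c \<in> set_sum K ?L" if "c \<in> set_sum K ?L" for c
      by (rule submod_smul[OF S X that])
    show "Z \<subseteq> set_sum (set_sum K ?L) ?XZ"
    proof
      fix m assume "m \<in> Z"
      then obtain c where c: "c \<in> free W b" "m - lincomb b c a \<in> set_sum K ?XZ" using gD(3) by blast
      then obtain k x where "k \<in> K" "x \<in> ?XZ" "m - lincomb b c a = k + x" unfolding set_sum_def by blast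
      moreover have "lincomb b c a \<in> ?L" using c(1) free_mono[of W ?W b b] by auto
      ultimately have "k + lincomb b c a \<in> set_sum K ?L" "m = (k + lincomb b c a) + x" "x \<in> ?XZ"
        unfolding set_sum_def by (blast, simp add: algebra_simps, blast)
      then show "m \<in> set_sum (set_sum K ?L) ?XZ" unfolding set_sum_def[of "set_sum K ?L"] by blast
    qed
  qed
  then have Zgen: "m \<in> set_sum K ?L" if "m \<in> Z" for m using that by blast
  have gens: "\<exists>c\<in>free ?W b. m - lincomb b c a \<in> K" if m: "m \<in> Z" for m
  proof -
    obtain k c where "k \<in> K" "c \<in> free ?W b" "m = k + lincomb b c a"
      using Zgen[OF m] unfolding set_sum_def by blast
    then show ?thesis by (intro bexI[of _ c]) auto
  qed
  have hg: "homgens ?W s Z K b a t" using gD gens by (auto simp: homgens_def)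
  let ?Y = "syz ?W b a K"
  have Y: "submod ?W ?Y" "graded t ?Y" using submod_syz[OF K(1)] graded_syz[OF K(2) gD(2)] by auto
  have YI: "c \<in> ?Y" if "c \<in> free ?W b" "X v \<bullet> c \<in> ?Y" for c
    using that Suc.prems(7)[OF lincomb_mem[OF Z(1) gD(1) that(1)]] by (auto simp: syz_def lincomb_smul)
  have XY: "X v \<bullet> c \<in> ?Y" if "c \<in> ?Y" for c by (rule submod_smul[OF Y(1) X that])
  have rY: "has_res q W t ?Y (set_sum {0} ((\<bullet>) (X v) ` ?Y))"
    unfolding set_sum_0_left
  proof (rule has_res_iso[OF graded_linear_dropv[OF Suc.prems(1), of t]])
    show "has_res q W t (syz W b a (set_sum K ?XZ)) {0}" by (rule r)
    show "submod W ?Y" using submod_mono[OF _ Y(1)] by auto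
    show "(dropv v m \<in> {0}) = (m \<in> (\<bullet>) (X v) ` ?Y)" if m: "m \<in> ?Y" for m
    proof
      have mf: "m \<in> free ?W b" using m by (simp add: syz_def)
      assume "dropv v m \<in> {0}"
      then obtain g where "g \<in> free ?W b" "m = X v \<bullet> g" using dropv_decomp[OF mf] by auto
      then show "m \<in> (\<bullet>) (X v) ` ?Y" using YI m by auto
    qed (auto simp: dropv_X)
    show "\<exists>m'\<in>syz W b a (set_sum K ?XZ). dropv v m - m' \<in> {0}" if "m \<in> ?Y" for m
    proof -
      have m: "m \<in> free ?W b" "lincomb b m a \<in> K" using that by (auto simp: syz_def)
      obtain g where g: "g \<in> free ?W b" "m = dropv v m + X v \<bullet> g" by (rule dropv_decomp[OF m(1)])
      from g(2) have dv: "dropv v m = m - X v \<bullet> g" by (metis add_diff_cancel_right')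
      have "X v \<bullet> (- lincomb b g a) = - (X v \<bullet> lincomb b g a)" by (simp add: fun_eq_iff vec_apply)
      then have "lincomb b (dropv v m) a = lincomb b m a + X v \<bullet> lincomb b (- g) a"
        unfolding dv lincomb_diff lincomb_smul lincomb_uminus by simp
      moreover have "lincomb b (- g) a \<in> Z"
        by (rule lincomb_mem[OF Z(1) gD(1) submod_uminus[OF submod_free g(1)]])
      ultimately have "lincomb b (dropv v m) a \<in> set_sum K ?XZ" using m(2) unfolding set_sum_def by blast
      then show ?thesis using dropv_free[OF m(1)] by (auto simp: syz_def)
    qed
    show "\<exists>m\<in>?Y. dropv v m - m' \<in> {0}" if m': "m' \<in> syz W b a (set_sum K ?XZ)" for m'
    proof -
      have f: "m' \<in> free W b" "m' \<in> free ?W b" using m' free_mono[of W ?W b b] by (auto simp: syz_def)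
      obtain k z where kz: "k \<in> K" "z \<in> Z" "lincomb b m' a = k + X v \<bullet> z"
        using m' by (auto simp: syz_def set_sum_def)
      obtain e where e: "e \<in> free ?W b" "z - lincomb b e a \<in> K" using gens[OF kz(2)] by auto
      have "lincomb b (m' - X v \<bullet> e) a = k + X v \<bullet> (z - lincomb b e a)"
        using kz(3) by (simp add: lincomb_diff lincomb_smul smul_distribs algebra_simps)
      also have "\<dots> \<in> K" by (intro submod_add[OF K(1)] kz(1) submod_smul[OF K(1) X e(2)])
      finally have "m' - X v \<bullet> e \<in> ?Y"
        using submod_diff[OF submod_free f(2) submod_smul[OF submod_free X e(1)]] by (simp add: syz_def)
      moreover have "dropv v (m' - X v \<bullet> e) = m'"
        using dropv_eq[OF f(1) Suc.prems(1)]
        by (simp add: graded_linear_diff[OF graded_linear_dropv[OF Suc.prems(1)]] dropv_X)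
      ultimately show ?thesis by (intro bexI[of _ "m' - X v \<bullet> e"]) auto
    qed
  qed (use Y submod_singleton_0 graded_0 in auto)
  obtain \<delta>' where "\<forall>c\<in>free ?W b. part t (degs_ge (fst v) \<delta>') c = (c :: 'a vec)"
    using free_bounded_below by meson
  then have \<delta>': "\<And>c. c \<in> ?Y \<Longrightarrow> part t (degs_ge (fst v) \<delta>') c = c" by (simp add: syz_def)
  have "has_res q ?W t ?Y {0}"
    using rY Y Suc.prems(1) submod_singleton_0 graded_0
    
    by - (rule Suc.IH[of "{0}" t ?Y \<delta>'], auto simp: X_smul_eq_0_iff \<delta>')
  then show ?case unfolding has_res.simps using hg by blast
qed


section \<open>Iterated truncation\<close>

text \<open>
  For all large \<open>d g\<^sub>1\<close>, for all large \<open>d g\<^sub>2\<close> depending on it, and so on.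
\<close>

fun iterated_ev :: "nat list \<Rightarrow> ((nat \<Rightarrow> int) \<Rightarrow> bool) \<Rightarrow> (nat \<Rightarrow> int) \<Rightarrow> bool" where
  "iterated_ev [] P d = P d"
| "iterated_ev (g # gs) P d = (\<exists>k. \<forall>m\<ge>k. iterated_ev gs P (d(g := m)))"

lemma iterated_ev_mono: "iterated_ev gs P d \<Longrightarrow> (\<And>d. P d \<Longrightarrow> Q d) \<Longrightarrow> iterated_ev gs Q d"
  by (induction gs arbitrary: d) (simp, fastforce)

lemma iterated_ev_conj: "iterated_ev gs P d \<Longrightarrow> iterated_ev gs Q d \<Longrightarrow> iterated_ev gs (\<lambda>d. P d \<and> Q d) d"
proof (induction gs arbitrary: d)
  case (Cons g gs)
  then obtain k l where "\<forall>m\<ge>k. iterated_ev gs P (d(g := m))" "\<forall>m\<ge>l. iterated_ev gs Q (d(g := m))" by auto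
  then have "\<forall>m\<ge>max k l. iterated_ev gs (\<lambda>d. P d \<and> Q d) (d(g := m))"
    by (auto intro!: Cons.IH simp del: fun_upd_apply)
  then show ?case unfolding iterated_ev.simps by blast
qed simp

lemma iterated_ev_upd: "g \<notin> set gs \<Longrightarrow> iterated_ev gs P (d(g := x)) \<longleftrightarrow> iterated_ev gs (\<lambda>d. P (d(g := x))) d"
proof (induction gs arbitrary: d)
  case (Cons h gs)
  then have "iterated_ev gs P (d(g := x, h := m)) \<longleftrightarrow> iterated_ev gs (\<lambda>d. P (d(g := x))) (d(h := m))" for m
    using Cons.IH[of "d(h := m)"] by (simp add: fun_upd_twist del: fun_upd_apply)
  then show ?case by (simp del: fun_upd_apply)
qed simp

lemma iterated_ev_True: "(\<And>d. P d) \<Longrightarrow> iterated_ev gs P d"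
  by (induction gs arbitrary: d) (auto simp del: fun_upd_apply)

lemma iterated_ev_obtain: "iterated_ev gs P d \<Longrightarrow> \<exists>d. P d"
proof (induction gs arbitrary: d)
  case (Cons g gs)
  then obtain k where "\<forall>m\<ge>k. iterated_ev gs P (d(g := m))" by (auto simp del: fun_upd_apply)
  then show ?case using Cons.IH by blast
qed auto

definition degs_ge_all :: "nat list \<Rightarrow> (nat \<Rightarrow> int) \<Rightarrow> multidegree set" where
  "degs_ge_all gs d = {e. \<forall>g\<in>set gs. d g \<le> lookup e g}"

text \<open>
  The elements of a graded module concentrated in the degrees \<open>D\<close>: truncations and strands.
\<close>

definition in_degs :: "(nat \<Rightarrow> multidegree) \<Rightarrow> multidegree set \<Rightarrow> 'k::field vec set \<Rightarrow> 'k vec set" where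
  "in_degs s D Z = {c \<in> Z. part s D c = c}"

text \<open>
  A set of degrees closed under the degrees of the monomials in \<open>W\<close> cuts out a submodule: this
  holds for truncations with all variables, and for strands with the variables of other factors.
\<close>

lemma submod_in_degs:
  fixes Z :: "'k::field vec set"
  assumes "submod W Z" "\<And>\<mu> e. keys \<mu> \<subseteq> W \<Longrightarrow> e \<in> D \<Longrightarrow> exponent_degree \<mu> + e \<in> D"
  shows "submod W (in_degs s D Z)"
  unfolding submod_def
proof (intro conjI ballI)
  fix f :: "'k cox_poly" and c assume f: "f \<in> polys W" and c: "c \<in> in_degs s D Z"
  have "part s D (f \<bullet> c) = f \<bullet> c"
    unfolding part_eq_iff
  proof (intro allI ballI)
    fix i \<mu> assume "\<mu> \<in> keys ((f \<bullet> c) i)"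
    then have "\<mu> \<in> keys (f * c i)" by (simp add: vec_apply)
    then obtain \<alpha> \<beta> where "\<alpha> \<in> keys f" "\<beta> \<in> keys (c i)" "\<mu> = \<alpha> + \<beta>"
      using keys_mult[of f "c i"] by blast
    moreover have "exponent_degree \<beta> + s i \<in> D"
      using c \<open>\<beta> \<in> keys (c i)\<close> unfolding in_degs_def part_eq_iff by blast
    moreover have "keys \<alpha> \<subseteq> W" using f \<open>\<alpha> \<in> keys f\<close> by (auto simp: polys_def)
    ultimately show "exponent_degree \<mu> + s i \<in> D"
      using assms(2)[of \<alpha> "exponent_degree \<beta> + s i"] by (simp add: exponent_degree_add add.assoc)
  qed
  then show "f \<bullet> c \<in> in_degs s D Z" using f c submod_smul[OF assms(1)] by (auto simp: in_degs_def)
qed (use assms(1) submod_vecs[OF assms(1)] submod_0 submod_add[OF assms(1)]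
     in \<open>auto simp: in_degs_def part_add\<close>)

lemma graded_in_degs: "graded s Z \<Longrightarrow> graded s (in_degs s D Z)"
  unfolding graded_def in_degs_def by (simp add: part_part) (metis Int_commute part_part)

lemma in_degs_subset: "in_degs s D Z \<subseteq> Z" by (auto simp: in_degs_def)

lemma part_in_degs: "graded s Z \<Longrightarrow> c \<in> Z \<Longrightarrow> part s D c \<in> in_degs s D Z"
  by (simp add: in_degs_def gradedD part_part)

lemma degs_ge_all_up: "e \<in> degs_ge_all gs d \<Longrightarrow> exponent_degree \<mu> + e \<in> degs_ge_all gs d"
proof -
  assume e: "e \<in> degs_ge_all gs d"
  have "d g \<le> lookup (exponent_degree \<mu>) g + lookup e g" if "g \<in> set gs" for g
    using lookup_exponent_degree_nonneg[of \<mu> g] e that by (fastforce simp: degs_ge_all_def)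
  then show ?thesis by (simp add: degs_ge_all_def lookup_add)
qed

abbreviation "trunc gs d s Z \<equiv> in_degs s (degs_ge_all gs d) Z"

lemma submod_trunc: "submod W Z \<Longrightarrow> submod W (trunc gs d s Z)"
  by (rule submod_in_degs) (auto intro: degs_ge_all_up)

lemma graded_linear_part:
  assumes "\<And>\<mu> e. keys \<mu> \<subseteq> W \<Longrightarrow> exponent_degree \<mu> + e \<in> D \<longleftrightarrow> e \<in> D"
  shows "graded_linear W s s (part s D)"
proof -
  have "part s D (f \<bullet> c) = f \<bullet> part s D c" if "f \<in> polys W" for f c
  proof -
    have "f \<in> {f. \<forall>\<mu>\<in>keys f. keys \<mu> \<subseteq> W}" using that by (simp add: polys_def)
    then show ?thesis
    proof (induction f rule: poly_induct)
      case (monomial \<mu> a)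
      have "part s D (single \<mu> a \<bullet> c) = single \<mu> a \<bullet> part s {d. exponent_degree \<mu> + d \<in> D} c"
        by (rule part_smul_poly) auto
      then show ?case using assms[OF monomial(1)] by simp
    qed (simp_all add: smul_distribs part_add)
  qed
  then show ?thesis by (auto simp: graded_linear_def part_add part_part Int_commute)
qed

lemma has_res_cong:
  assumes "submod W Z" "graded s Z" "submod W K" "graded s K" "\<And>m. m \<in> Z \<Longrightarrow> m \<in> K \<longleftrightarrow> m \<in> K'"
    and "has_res q W s Z K"
  shows "has_res q W s Z K'"
proof (rule has_res_iso[OF graded_linear_id assms(1-4) _ _ _ assms(6)])
  show "\<exists>m'\<in>Z. m - m' \<in> K" if "m \<in> Z" for m
    using that submod_0[OF assms(3)] by (intro bexI[of _ m]) auto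
  show "\<exists>m\<in>Z. m - m' \<in> K" if "m' \<in> Z" for m'
    using that submod_0[OF assms(3)] by (intro bexI[of _ m']) auto
qed (use assms(5) in auto)

text \<open>
  Truncation is exact on graded modules, so extensions of truncations are truncations of extensions.
\<close>

lemma has_res_trunc_horseshoe:
  assumes "submod W K" "graded s K" "submod W Y" "graded s Y" "submod W Z" "graded s Z" "K \<subseteq> Y" "Y \<subseteq> Z"
    and "has_res q W s (trunc gs d s Y) K" "has_res q W s (trunc gs d s Z) Y"
  shows "has_res q W s (trunc gs d s Z) K"
proof -
  let ?t = "trunc gs d s"
  note s = submod_trunc[OF assms(1), where gs = gs and d = d and s = s] submod_trunc[OF assms(3), where gs = gs and d = d and s = s] submod_trunc[OF assms(5), where gs = gs and d = d and s = s]
  note g = graded_in_degs[OF assms(2), of "degs_ge_all gs d"] graded_in_degs[OF assms(4), of "degs_ge_all gs d"] graded_in_degs[OF assms(6), of "degs_ge_all gs d"]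
  have "has_res q W s (?t Y) (?t K)"
    by (rule has_res_cong[OF s(2) g(2) assms(1,2) _ assms(9)]) (auto simp: in_degs_def)
  moreover have "has_res q W s (?t Z) (?t Y)"
    by (rule has_res_cong[OF s(3) g(3) assms(3,4) _ assms(10)]) (auto simp: in_degs_def)
  moreover have "?t K \<subseteq> ?t Y" "?t Y \<subseteq> ?t Z" using assms(7,8) by (auto simp: in_degs_def)
  ultimately have "has_res q W s (?t Z) (?t K)"
    using has_res_horseshoe[OF s(1) g(1) s(2) g(2) s(3) g(3)] by blast
  then show ?thesis
    by (rule has_res_cong[OF s(3) g(3) s(1) g(1), rotated]) (auto simp: in_degs_def)
qed

text \<open>
  A finitely generated graded module, given as the quotient \<open>Z/K\<close>.
\<close>

definition graded_pair ::
  "(nat \<times> nat) set \<Rightarrow> (nat \<Rightarrow> multidegree) \<Rightarrow> 'k::field vec set \<Rightarrow> 'k vec set \<Rightarrow> bool" where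
  "graded_pair W s Z K \<longleftrightarrow> submod W Z \<and> graded s Z \<and> submod W K \<and> graded s K \<and> K \<subseteq> Z \<and> fg W Z K"

lemma graded_pairD: assumes "graded_pair W s Z K"
  shows "submod W Z" "graded s Z" "submod W K" "graded s K" "K \<subseteq> Z" "fg W Z K"
  using assms by (auto simp: graded_pair_def)

lemma fg_mono: "fg W Z K \<Longrightarrow> K \<subseteq> Y \<Longrightarrow> fg W Z Y"
proof -
  assume "fg W Z K" "K \<subseteq> Y"
  then obtain A where A: "finite A" "A \<subseteq> Z" "Z \<subseteq> mspan W (A \<union> K)" by (auto simp: fg_def)
  have "mspan W (A \<union> K) \<subseteq> mspan W (A \<union> Y)" using \<open>K \<subseteq> Y\<close> by (intro mspan_mono) auto
  then show ?thesis using A unfolding fg_def by blast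
qed

lemma graded_pair_extend:
  assumes "graded_pair W s Z K" "finite W" "submod W Y" "graded s Y" "K \<subseteq> Y" "Y \<subseteq> Z"
  shows "graded_pair W s Y K" "graded_pair W s Z Y"
proof -
  note g = graded_pairD[OF assms(1)]
  obtain A where A: "finite A" "A \<subseteq> Z" "Z \<subseteq> mspan W (A \<union> K)" using g(6) by (auto simp: fg_def)
  have "fg W Y K"
    by (rule noetherian[OF assms(2) A(1) _ g(3) assms(3,5)]) (use A submod_vecs[OF g(1)] assms(6) in auto)
  then show "graded_pair W s Y K" "graded_pair W s Z Y"
    using g assms fg_mono[OF g(6) assms(5)] by (auto simp: graded_pair_def)
qed

text \<open>
  Modulo \<open>Y\<close> the variable \<open>v\<close> acts as zero, so the old generators suffice over the other variables.
\<close>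

lemma fg_drop_variable:
  assumes "fg (insert v W) Z K" "K \<subseteq> Y" "submod (insert v W) Z" "submod W Y" "submod (insert v W) K"
    and "\<And>m. m \<in> Z \<Longrightarrow> X v \<bullet> m \<in> Y"
  shows "fg W Z Y"
proof -
  obtain A where A: "finite A" "A \<subseteq> Z" "Z \<subseteq> mspan (insert v W) (A \<union> K)"
    using assms(1) by (auto simp: fg_def)
  have "m \<in> mspan W (A \<union> Y)" if "m \<in> mspan (insert v W) (A \<union> K)" for m
    using that
  proof (induction rule: mspan_induct)
    case (step m a f)
    have S: "submod W (mspan W (A \<union> Y))"
      using A(2) submod_vecs[OF assms(3)] submod_vecs[OF assms(4)] by (intro submod_mspan) auto
    have "f \<bullet> a \<in> mspan W (A \<union> Y)"
    proof -
      obtain g where g: "g \<in> polys (insert v W)" "f = drop_var v f + X v * g"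
        by (rule drop_var_decomp[OF step.hyps(3)])
      show ?thesis
      proof (cases "a \<in> A")
        case True
        then have "g \<bullet> a \<in> Z" using A g submod_smul[OF assms(3)] by auto
        then have "X v \<bullet> g \<bullet> a \<in> mspan W (A \<union> Y)" using assms(6) by (intro mspan_base) auto
        moreover have "drop_var v f \<bullet> a \<in> mspan W (A \<union> Y)"
          using True drop_var_polys[OF step.hyps(3)] by (intro mspan_smul mspan_base) auto
        moreover have "f \<bullet> a = drop_var v f \<bullet> a + X v \<bullet> g \<bullet> a"
          by (subst g(2)) (simp add: smul_distribs smul_smul)
        ultimately show ?thesis using submod_add[OF S] by metis
      next
        case False
        then have a: "a \<in> K" using step by auto
        then have "f \<bullet> a \<in> Y" using submod_smul[OF assms(5) step.hyps(3)] assms(2) by auto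
        then show ?thesis by (intro mspan_base) auto
      qed
    qed
    then show ?case using step submod_add[OF S] by blast
  qed (rule mspan_zero)
  then show ?thesis using A unfolding fg_def by blast
qed

lemma graded_pair_drop_variable:
  assumes "graded_pair (insert v W) s Z K" "submod W Y" "graded s Y" "K \<subseteq> Y" "Y \<subseteq> Z"
    "\<And>m. m \<in> Z \<Longrightarrow> X v \<bullet> m \<in> Y"
  shows "graded_pair W s Z Y"
  using graded_pairD[OF assms(1)] assms fg_drop_variable[of v W Z K Y]
    submod_mono[OF subset_insertI, of v W Z]
  by (auto simp: graded_pair_def)

lemma has_res_add_variables:
  assumes "finite U" "U \<inter> W = {}"
    and "submod (U \<union> W) K" "graded s K" "submod (U \<union> W) Z" "graded s Z"
    and "\<And>v m. v \<in> U \<Longrightarrow> m \<in> Z \<Longrightarrow> X v \<bullet> m \<in> K" and "has_res q W s Z K"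
  shows "has_res (q + card U) (U \<union> W) s Z K"
  using assms
proof (induction U rule: finite_induct)
  case (insert v U)
  have r: "has_res (q + card U) (U \<union> W) s Z K"
    using insert.prems(1,3,5,6,7) submod_mono[of "U \<union> W" "insert v U \<union> W"] insert.prems(2,4)
    by (intro insert.IH) auto
  have "has_res (Suc (q + card U)) (insert v (U \<union> W)) s Z K"
    by (rule has_res_add_variable[OF _ _ _ _ _ _ r]) (use insert in auto)
  then show ?case using insert by simp
qed simp

lemma has_res_0_iff: "has_res 0 W s Z K \<longleftrightarrow> Z \<subseteq> K"
  by (simp add: has_res.simps)

lemma lookup_exponent_degree_eq_0: "g \<notin> fst ` keys \<mu> \<Longrightarrow> lookup (exponent_degree \<mu>) g = 0"
  using keys_exponent_degree[of \<mu>] by (auto simp: in_keys_iff)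

definition degs_eq :: "nat \<Rightarrow> int \<Rightarrow> multidegree set" where
  "degs_eq g \<delta> = {e. lookup e g = \<delta>}"

lemma degs_eq_shift: "g \<notin> fst ` W \<Longrightarrow> keys \<mu> \<subseteq> W \<Longrightarrow> exponent_degree \<mu> + e \<in> degs_eq g \<delta> \<longleftrightarrow> e \<in> degs_eq g \<delta>"
proof -
  assume "g \<notin> fst ` W" "keys \<mu> \<subseteq> W"
  then have "lookup (exponent_degree \<mu>) g = 0" by (intro lookup_exponent_degree_eq_0) auto
  then show ?thesis by (simp add: degs_eq_def lookup_add)
qed

lemma finite_bounded_exponents:
  assumes "finite U"
  shows "finite {\<nu> :: exponent. keys \<nu> \<subseteq> U \<and> (\<forall>v. lookup \<nu> v \<le> N)}" (is "finite ?E")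
proof (rule finite_imageD)
  have "lookup ` ?E \<subseteq> {f. \<forall>x. (x \<in> U \<longrightarrow> f x \<in> {..N}) \<and> (x \<notin> U \<longrightarrow> f x = 0)}"
    by (auto simp: in_keys_iff)
  moreover have "finite {f. \<forall>x. (x \<in> U \<longrightarrow> f x \<in> {..N}) \<and> (x \<notin> U \<longrightarrow> f x = (0::nat))}"
    by (rule finite_set_of_finite_funs) (use assms in auto)
  ultimately show "finite (lookup ` ?E)" by (rule finite_subset)
  show "inj_on lookup ?E" by (rule inj_onI) (simp only: poly_mapping_eq_iff)
qed

text \<open>
  Over the other variables \<open>W\<close>, a strand is generated by the products of the generators of \<open>Z\<close> with monomials in
  \<open>U\<close>.  Every variable in \<open>U\<close> raises the degree at \<open>g\<close>, so only finitely many monomials reach the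
  strand.
\<close>

lemma fg_strand:
  assumes Z: "graded_pair (U \<union> W) s Z K" and U: "finite U" "\<And>v. v \<in> U \<Longrightarrow> fst v = g" and W: "g \<notin> fst ` W"
  shows "fg W (in_degs s (degs_eq g \<delta>) Z) (in_degs s (degs_eq g \<delta>) K)"
proof -
  let ?P = "part s (degs_eq g \<delta>)"
  note gZ = graded_pairD[OF Z]
  obtain A where A: "finite A" "A \<subseteq> Z" "Z \<subseteq> mspan (U \<union> W) (A \<union> K)" "\<And>x. x \<in> A \<Longrightarrow> \<exists>d. part s {d} x = x"
    using fg_homogeneous[OF gZ(6,3,1,2)] by metis
  obtain t where t: "\<And>x. x \<in> A \<Longrightarrow> part s {t x} x = x" using A(4) by metis
  \<comment> \<open>a monomial with an exponent above \<open>N\<close> carries every generator beyond degree \<open>\<delta>\<close>\<close>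
  define N where "N = nat (Max (insert 0 ((\<lambda>x. \<delta> - lookup (t x) g) ` A)))"
  have N: "\<delta> - lookup (t x) g \<le> int N" if "x \<in> A" for x
  proof -
    have "\<delta> - lookup (t x) g \<le> Max (insert 0 ((\<lambda>x. \<delta> - lookup (t x) g) ` A))"
      using A(1) that by (intro Max_ge) auto
    then show ?thesis by (simp add: N_def)
  qed
  define E where "E = {\<nu> :: exponent. keys \<nu> \<subseteq> U \<and> (\<forall>v. lookup \<nu> v \<le> N)}"
  define A' where "A' = (\<lambda>(\<nu>, x). ?P (single \<nu> 1 \<bullet> x)) ` (E \<times> A)"
  let ?K = "in_degs s (degs_eq g \<delta>) K" and ?Z = "in_degs s (degs_eq g \<delta>) Z"
  have gm: "graded_linear W s s (?P :: 'a vec \<Rightarrow> 'a vec)" by (rule graded_linear_part) (use degs_eq_shift[OF W] in auto)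
  have "E \<times> A \<subseteq> {(\<nu>, x). single \<nu> 1 \<bullet> x \<in> Z}"
    using A(2) by (auto simp: E_def intro!: submod_smul[OF gZ(1)] polys_monomial)
  then have A'Z: "A' \<subseteq> ?Z" using part_in_degs[OF gZ(2)] by (auto simp: A'_def)
  have "finite A'" using A(1) finite_bounded_exponents[OF U(1), of N] by (auto simp: A'_def E_def)
  have S: "submod W (mspan W (A' \<union> ?K))"
    using A'Z submod_vecs[OF gZ(1)] submod_vecs[OF gZ(3)] in_degs_subset by (intro submod_mspan) blast
  have mono: "?P (single \<mu> r \<bullet> a) \<in> mspan W (A' \<union> ?K)" if "a \<in> A" "keys \<mu> \<subseteq> U \<union> W" for a \<mu> r
  proof -
    \<comment> \<open>split the monomial into its variables in \<open>U\<close> and those in \<open>W\<close>\<close>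
    define \<nu> where "\<nu> = filter_terms (\<lambda>v. v \<in> U) \<mu>"
    define \<mu>' where "\<mu>' = filter_terms (\<lambda>v. v \<notin> U) \<mu>"
    have "\<mu>' + \<nu> = \<mu>"
      by (rule poly_mapping_eqI) (auto simp: \<nu>_def \<mu>'_def lookup_add lookup_filter_terms when_def)
    then have split: "single \<mu> r \<bullet> a = single \<mu>' r \<bullet> single \<nu> 1 \<bullet> a" by (simp add: smul_smul mult_single)
    have \<mu>': "single \<mu>' r \<in> polys W"
      using that(2) by (intro polys_monomial) (auto simp: \<mu>'_def keys_filter_terms)
    have "?P (single \<nu> 1 \<bullet> a) \<in> mspan W (A' \<union> ?K)"
    proof (cases "\<nu> \<in> E")
      case True then show ?thesis using that(1) by (intro mspan_base) (auto simp: A'_def)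
    next
      case False
      then obtain v where v: "lookup \<nu> v > N" by (auto simp: E_def \<nu>_def keys_filter_terms not_le)
      then have "v \<in> U" by (auto simp: \<nu>_def lookup_filter_terms when_def split: if_splits)
      then have "lookup (exponent_degree \<nu>) g > int N"
        using lookup_le_exponent_degree[of \<nu> v] v U(2) by auto
      then have "exponent_degree \<nu> + t a \<notin> degs_eq g \<delta>"
        using N[OF that(1)] by (auto simp: degs_eq_def lookup_add)
      then have "filter_terms (\<lambda>\<mu>. exponent_degree \<mu> + t a \<in> degs_eq g \<delta>) (single \<nu> (1::'a)) = 0"
        by (simp add: filter_terms_eq_0_iff)
      then have "?P (single \<nu> 1 \<bullet> a) = 0" by (simp add: part_smul_vec[OF t[OF that(1)]])
      then show ?thesis by (simp add: mspan_zero)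
    qed
    then have "single \<mu>' r \<bullet> ?P (single \<nu> 1 \<bullet> a) \<in> mspan W (A' \<union> ?K)" by (rule submod_smul[OF S \<mu>'])
    moreover have "?P (single \<mu> r \<bullet> a) = single \<mu>' r \<bullet> ?P (single \<nu> 1 \<bullet> a)"
      unfolding split using gm \<mu>' by (simp add: graded_linear_def)
    ultimately show ?thesis by simp
  qed
  have smul: "?P (f \<bullet> a) \<in> mspan W (A' \<union> ?K)" if "a \<in> A" "f \<in> polys (U \<union> W)" for a f
  proof -
    have "f \<in> {f. \<forall>\<mu>\<in>keys f. keys \<mu> \<subseteq> U \<union> W}" using that(2) by (simp add: polys_def)
    then show ?thesis
    proof (induction f rule: poly_induct)
      case (add f g)
      then show ?case using submod_add[OF S] by (simp add: smul_distribs part_add)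
    qed (use mono that(1) in \<open>simp_all add: mspan_zero\<close>)
  qed
  have P: "?P m \<in> mspan W (A' \<union> ?K)" if "m \<in> mspan (U \<union> W) (A \<union> K)" for m
    using that
  proof (induction rule: mspan_induct)
    case (step m a f)
    have "?P (f \<bullet> a) \<in> mspan W (A' \<union> ?K)"
    proof (cases "a \<in> A")
      case False
      then have "f \<bullet> a \<in> K" using step by (intro submod_smul[OF gZ(3)]) auto
      then show ?thesis using part_in_degs[OF gZ(4)] by (intro mspan_base) auto
    qed (use smul step in auto)
    then show ?case using submod_add[OF S step.IH] by (simp add: part_add)
  qed (simp add: mspan_zero)
  have "?Z \<subseteq> mspan W (A' \<union> ?K)"
  proof
    fix m assume "m \<in> ?Z"
    then have "m \<in> mspan (U \<union> W) (A \<union> K)" "?P m = m" using A(3) by (auto simp: in_degs_def)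
    then show "m \<in> mspan W (A' \<union> ?K)" using P[of m] by simp
  qed
  then show ?thesis using \<open>finite A'\<close> A'Z unfolding fg_def by blast
qed


section \<open>Truncations have short resolutions\<close>

lemma subset_trunc: "Y \<subseteq> Z \<Longrightarrow> in_degs s D Y \<subseteq> in_degs s D Z"
  by (auto simp: in_degs_def)

text \<open>
  Let \<open>X\<^sub>m\<close> be the truncation of \<open>Z\<close> at \<open>\<delta>\<close> and \<open>X\<^sub>1\<close> the one at \<open>\<delta> + 1\<close>.  Then \<open>v X\<^sub>m \<subseteq> X\<^sub>1 \<subseteq> X\<^sub>m\<close>, where \<open>X\<^sub>1/v X\<^sub>m\<close> is
  a truncation of \<open>Z/vZ\<close> and \<open>X\<^sub>m/X\<^sub>1\<close> is the strand of degree \<open>\<delta>\<close>, all modulo \<open>K\<close>.  Every variable in \<open>U\<close>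
  maps \<open>X\<^sub>m\<close> into \<open>X\<^sub>1\<close> and so costs one step for the strand.  The horseshoe lemma bounds \<open>X\<^sub>m/v X\<^sub>m\<close>,
  and the resolution lifts because \<open>v\<close> is a nonzerodivisor.
\<close>

lemma has_res_truncation_torsion_free:
  fixes Z :: "'k::field vec set"
  assumes M: "graded_pair (insert v (U \<union> V)) s Z K" and v: "v \<notin> U \<union> V" "fst v = g"
    and U: "finite U" "\<And>u. u \<in> U \<Longrightarrow> fst u = g" and V: "g \<notin> fst ` V" and g: "g \<notin> set gs"
    and tf: "\<And>m. m \<in> Z \<Longrightarrow> X v \<bullet> m \<in> K \<Longrightarrow> m \<in> K"
    and quotient: "has_res (c + card U) (U \<union> V) s (trunc (g # gs) (d(g := \<delta> + 1)) s Z) (set_sum K ((\<bullet>) (X v) ` Z))"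
    and strand: "has_res c V s (trunc gs (d(g := \<delta>)) s (in_degs s (degs_eq g \<delta>) Z)) (in_degs s (degs_eq g \<delta>) K)"
  shows "has_res (c + card U) (insert v (U \<union> V)) s (trunc (g # gs) (d(g := \<delta>)) s Z) K"
proof -
  let ?W = "insert v (U \<union> V)" and ?S = "U \<union> V" and ?B = "c + card U"
  define D where "D = degs_ge_all (g # gs) (d(g := \<delta>))"
  define D1 where "D1 = degs_ge_all (g # gs) (d(g := \<delta> + 1))"
  note gM = graded_pairD[OF M]
  have sub: "?S \<subseteq> ?W" "V \<subseteq> ?W" "V \<subseteq> ?S" by auto
  have up: "\<And>\<mu> e. e \<in> D \<Longrightarrow> exponent_degree \<mu> + e \<in> D" "\<And>\<mu> e. e \<in> D1 \<Longrightarrow> exponent_degree \<mu> + e \<in> D1"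
    by (auto simp: D_def D1_def intro: degs_ge_all_up)
  have D1_iff: "e \<in> D1 \<longleftrightarrow> e \<in> D \<and> lookup e g \<noteq> \<delta>" for e
    using g by (auto simp: D_def D1_def degs_ge_all_def)
  \<comment> \<open>multiplication by a variable of the factor \<open>g\<close> moves degrees from \<open>D\<close> to \<open>D1\<close>\<close>
  have D_shift: "single g 1 + e \<in> D1 \<longleftrightarrow> e \<in> D" for e
    using g by (auto simp: D_def D1_def degs_ge_all_def lookup_add lookup_single when_def)
  define Xm where "Xm = in_degs s D Z"
  define X1 where "X1 = in_degs s D1 Z"
  define KX where "KX = in_degs s D K"
  define XX where "XX = (\<bullet>) (X v) ` Xm"
  define L where "L = set_sum KX XX"
  define Y where "Y = set_sum KX X1"
  define K1 where "K1 = set_sum K ((\<bullet>) (X v) ` Z)"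
  have Xm: "submod ?W Xm" "graded s Xm" and X1: "submod ?W X1" "graded s X1" and KX: "submod ?W KX" "graded s KX"
    unfolding Xm_def X1_def KX_def
    using submod_in_degs[OF gM(1) up(1)] submod_in_degs[OF gM(1) up(2)] submod_in_degs[OF gM(3) up(1)]
      graded_in_degs[OF gM(2)] graded_in_degs[OF gM(4)] by blast+
  have XX: "submod ?W XX" "graded s XX"
    unfolding XX_def by (rule submod_image_smul[OF Xm(1)] graded_X_image[OF Xm(2)])+
  have L: "submod ?W L" "graded s L" and Y: "submod ?W Y" "graded s Y"
    unfolding L_def Y_def by (rule submod_set_sum graded_set_sum KX XX X1)+
  have K1: "submod ?W K1" "graded s K1"
    unfolding K1_def by (rule submod_set_sum graded_set_sum submod_image_smul graded_X_image gM)+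
  have KX_K: "KX \<subseteq> K" and KX_Xm: "KX \<subseteq> Xm" using gM(5) by (auto simp: KX_def Xm_def in_degs_def)
  have "D1 \<subseteq> D" using D1_iff by auto
  then have X1_Xm: "X1 \<subseteq> Xm"
    unfolding X1_def Xm_def in_degs_def part_eq_iff by blast
  have X1I: "X v \<bullet> m \<in> X1" if "m \<in> Xm" for m
  proof -
    have "part s D1 (X v \<bullet> m) = X v \<bullet> part s D m"
      unfolding part_X_smul using D_shift v(2) by simp
    then show ?thesis using that submod_smul[OF gM(1) polys_X[of v], of m]
      by (auto simp: X1_def Xm_def in_degs_def)
  qed
  then have XX_X1: "XX \<subseteq> X1" by (auto simp: XX_def)
  have LY: "L \<subseteq> Y" using XX_X1 by (auto simp: L_def Y_def set_sum_def)
  have YX: "Y \<subseteq> Xm" unfolding Y_def by (rule set_sum_least[OF Xm(1) KX_Xm X1_Xm])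
  have KX_L: "KX \<subseteq> L" unfolding L_def by (rule set_sum_left[OF XX(1)])
  have LK1: "L \<subseteq> K1" using KX_K by (auto simp: L_def K1_def set_sum_def XX_def Xm_def in_degs_def)
  have "has_res ?B ?S s Y L"
  proof (rule has_res_iso[OF graded_linear_id submod_mono[OF sub(1) Y(1)] Y(2) submod_mono[OF sub(1) K1(1)] K1(2)])
    show "has_res ?B ?S s X1 K1" using quotient by (simp add: X1_def D1_def K1_def)
    have X1L: "x \<in> L" if x: "x \<in> X1" "x \<in> K1" for x
    proof -
      obtain k z where kz: "k \<in> K" "z \<in> Z" "x = k + X v \<bullet> z" using x(2) by (auto simp: K1_def set_sum_def)
      have "x = part s D1 x" using that(1) by (simp add: X1_def in_degs_def)
      also have "\<dots> = part s D1 k + X v \<bullet> part s D z"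
        unfolding kz(3) part_add part_X_smul using D_shift v(2) by simp
      also have "\<dots> \<in> L"
      proof -
        have "part s D1 k \<in> KX"
          using kz(1) gM(4) \<open>D1 \<subseteq> D\<close> by (auto simp: KX_def in_degs_def part_part gradedD Int_absorb1)
        moreover have "X v \<bullet> part s D z \<in> XX" using part_in_degs[OF gM(2) kz(2)] by (auto simp: XX_def Xm_def)
        ultimately show ?thesis unfolding L_def set_sum_def by blast
      qed
      finally show ?thesis .
    qed
    have Y_split: "\<exists>k x. k \<in> KX \<and> x \<in> X1 \<and> y = k + x" if "y \<in> Y" for y
      using that by (auto simp: Y_def set_sum_def)
    have KX_K1: "KX \<subseteq> K1" using KX_L LK1 by auto
    show "(m \<in> K1) = (m \<in> L)" if m: "m \<in> Y" for m
    proof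
      assume mK: "m \<in> K1"
      obtain k x where kx: "k \<in> KX" "x \<in> X1" "m = k + x" using Y_split[OF m] by auto
      then have "x \<in> K1" using submod_diff[OF K1(1) mK, of k] KX_K1 by auto
      then show "m \<in> L" using kx X1L[of x] KX_L submod_add[OF L(1), of k x] by auto
    qed (use LK1 in auto)
    show "\<exists>m'\<in>X1. m - m' \<in> K1" if m: "m \<in> Y" for m
    proof -
      obtain k x where "k \<in> KX" "x \<in> X1" "m = k + x" using Y_split[OF m] by auto
      then show ?thesis using KX_K1 by (intro bexI[of _ x]) auto
    qed
    show "\<exists>m\<in>Y. m - m' \<in> K1" if "m' \<in> X1" for m'
      using that set_sum_right[OF KX(1), of X1] submod_0[OF K1(1)]
      by (intro bexI[of _ m']) (auto simp: Y_def)
  qed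
  moreover have "has_res ?B ?S s Xm Y"
  proof -
    let ?P = "part s (degs_eq g \<delta>)"
    have gm: "graded_linear V s s (?P :: 'k vec \<Rightarrow> 'k vec)"
      by (rule graded_linear_part) (use degs_eq_shift[OF V] in auto)
    have "in_degs s (degs_eq g \<delta>) K \<subseteq> K" by (rule in_degs_subset)
    have sK: "submod V (in_degs s (degs_eq g \<delta>) K)"
      by (rule submod_in_degs[OF submod_mono[OF sub(2) gM(3)]]) (use degs_eq_shift[OF V] in auto)
    have "e \<in> degs_ge_all gs (d(g := \<delta>)) \<and> e \<in> degs_eq g \<delta> \<longleftrightarrow> e \<in> D \<and> e \<in> degs_eq g \<delta>" for e
      using g by (auto simp: D_def degs_ge_all_def degs_eq_def)
    then have str: "trunc gs (d(g := \<delta>)) s (in_degs s (degs_eq g \<delta>) Z) = {x \<in> Xm. ?P x = x}"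
      unfolding Xm_def in_degs_def part_eq_iff by blast
    have "D = (D \<inter> degs_eq g \<delta>) \<union> D1" "(D \<inter> degs_eq g \<delta>) \<inter> D1 = {}"
      using D1_iff by (auto simp: degs_eq_def)
    have split: "x - ?P x \<in> X1" if "x \<in> Xm" for x
    proof -
      have "part s D1 (x - ?P x) = x - ?P x"
        unfolding part_eq_iff
      proof (intro allI ballI)
        fix i \<mu> assume "\<mu> \<in> keys ((x - ?P x) i)"
        then have "\<mu> \<in> keys (x i)" "exponent_degree \<mu> + s i \<notin> degs_eq g \<delta>"
          by (auto simp: in_keys_iff vec_apply lookup_minus part_def lookup_filter_terms when_def split: if_splits)
        moreover have "exponent_degree \<mu> + s i \<in> D"
          using that \<open>\<mu> \<in> keys (x i)\<close> unfolding Xm_def in_degs_def part_eq_iff by blast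
        ultimately show "exponent_degree \<mu> + s i \<in> D1" using D1_iff by (simp add: degs_eq_def)
      qed
      moreover have "x - ?P x \<in> Z"
        using that X1_Xm submod_diff[OF gM(1)] gradedD[OF gM(2)] by (auto simp: Xm_def in_degs_def)
      ultimately show ?thesis by (simp add: X1_def in_degs_def)
    qed
    have P_X1: "?P x = 0" if "x \<in> X1" for x
    proof -
      have "part s D1 x = x" using that by (simp add: X1_def in_degs_def)
      then have "?P x = part s (degs_eq g \<delta> \<inter> D1) x" by (metis part_part)
      moreover have "degs_eq g \<delta> \<inter> D1 = {}" using D1_iff by (auto simp: degs_eq_def)
      ultimately show ?thesis by (simp add: part_eq_0_iff)
    qed
    have P_Xm: "?P x \<in> Xm" "?P (?P x) = ?P x" if "x \<in> Xm" for x
      using gradedD[OF Xm(2) that] by (auto simp: part_part)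
    have "has_res c V s Xm Y"
    proof (rule has_res_iso[OF gm submod_mono[OF sub(2) Xm(1)] Xm(2) sK graded_in_degs[OF gM(4)] _ _ _ strand])
      show "(?P m \<in> in_degs s (degs_eq g \<delta>) K) = (m \<in> Y)" if m: "m \<in> Xm" for m
      proof
        assume "?P m \<in> in_degs s (degs_eq g \<delta>) K"
        then have "?P m \<in> K" by (simp add: in_degs_def)
        then have "?P m \<in> KX" using P_Xm[OF m] by (auto simp: KX_def Xm_def in_degs_def)
        moreover have "m = ?P m + (m - ?P m)" by simp
        ultimately show "m \<in> Y" unfolding Y_def set_sum_def using split[OF m] by blast
      next
        assume "m \<in> Y"
        then obtain k x where "k \<in> KX" "x \<in> X1" "m = k + x" by (auto simp: Y_def set_sum_def)
        then have "?P m = ?P k" "k \<in> K" using P_X1 KX_K by (auto simp: part_add)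
        then show "?P m \<in> in_degs s (degs_eq g \<delta>) K" using part_in_degs[OF gM(4)] by simp
      qed
      have K0: "0 \<in> in_degs s (degs_eq g \<delta>) K" by (rule submod_0[OF sK])
      show "\<exists>m'\<in>trunc gs (d(g := \<delta>)) s (in_degs s (degs_eq g \<delta>) Z). ?P m - m' \<in> in_degs s (degs_eq g \<delta>) K"
        if m: "m \<in> Xm" for m
        unfolding str using P_Xm[OF m] K0 by (intro bexI[of _ "?P m"]) auto
      show "\<exists>m\<in>Xm. ?P m - m' \<in> in_degs s (degs_eq g \<delta>) K"
        if "m' \<in> trunc gs (d(g := \<delta>)) s (in_degs s (degs_eq g \<delta>) Z)" for m'
        using that K0 unfolding str by (intro bexI[of _ m']) auto
    qed
    then show ?thesis
    proof (rule has_res_add_variables[OF U(1) _ submod_mono[OF sub(1) Y(1)] Y(2) submod_mono[OF sub(1) Xm(1)] Xm(2), rotated 2])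
      show "U \<inter> V = {}" using U(2) V by force
      show "X u \<bullet> m \<in> Y" if "u \<in> U" "m \<in> Xm" for u m
      proof -
        have "part s D1 (X u \<bullet> m) = X u \<bullet> part s D m"
          unfolding part_X_smul using D_shift U(2)[OF that(1)] by simp
        then have "X u \<bullet> m \<in> X1" using that submod_smul[OF gM(1) polys_X[of u], of m]
          by (auto simp: X1_def Xm_def in_degs_def)
        then show ?thesis using set_sum_right[OF KX(1), of X1] by (auto simp: Y_def)
      qed
    qed
  qed
  ultimately have "has_res ?B ?S s Xm L"
    using submod_mono[OF sub(1) L(1)] submod_mono[OF sub(1) Y(1)] submod_mono[OF sub(1) Xm(1)] L(2) Y(2) Xm(2) LY YX
    by - (rule has_res_horseshoe[of ?S L s Y Xm], auto)
  then have "has_res ?B ?W s Xm KX"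
  proof (intro has_res_lift[OF v(1) KX Xm])
    show "part s (degs_ge (fst v) \<delta>) m = m" if "m \<in> Xm" for m
    proof -
      have "part s D m = m" using that by (simp add: Xm_def in_degs_def)
      moreover have "D \<subseteq> degs_ge (fst v) \<delta>" using v(2) by (auto simp: D_def degs_ge_all_def degs_ge_def)
      ultimately show ?thesis unfolding part_eq_iff by blast
    qed
    show "m \<in> KX" if "m \<in> Xm" "X v \<bullet> m \<in> KX" for m
      using that tf[of m] by (auto simp: KX_def Xm_def in_degs_def)
  qed (simp add: L_def XX_def)
  then have "has_res ?B ?W s Xm K"
    by (rule has_res_cong[OF Xm KX, rotated]) (auto simp: KX_def Xm_def in_degs_def)
  then show ?thesis by (simp add: Xm_def D_def)
qed


lemma iterated_ev_Cons: "g \<notin> set gs \<Longrightarrow> iterated_ev (g # gs) P d \<longleftrightarrow> (\<exists>k. \<forall>m\<ge>k. iterated_ev gs (\<lambda>d. P (d(g := m))) d)"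
  by (simp add: iterated_ev_upd del: fun_upd_apply)

text \<open>
  If no variable has positive degree at \<open>g\<close>, the degrees at \<open>g\<close> of the generators bound all degrees.
\<close>

lemma truncation_vanishes:
  assumes M: "graded_pair V s Z K" and V: "g \<notin> fst ` V"
  obtains k where "\<And>d. d g \<ge> k \<Longrightarrow> trunc (g # gs) d s Z \<subseteq> K"
proof -
  note gM = graded_pairD[OF M]
  obtain A where A: "finite A" "A \<subseteq> Z" "Z \<subseteq> mspan V (A \<union> K)" using gM(6) by (auto simp: fg_def)
  have Av: "A \<subseteq> vecs" using A(2) submod_vecs[OF gM(1)] by auto
  have "finite (\<Union>a\<in>A. degs s a)" using A(1) Av by (auto intro: finite_degs)
  then have fin: "finite (insert 0 ((\<lambda>e. lookup e g) ` (\<Union>a\<in>A. degs s a)))" by auto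
  define k where "k = Max (insert 0 ((\<lambda>e. lookup e g) ` (\<Union>a\<in>A. degs s a))) + 1"
  define D where "D = {e :: multidegree. lookup e g < k}"
  have "degs s a \<subseteq> D" if "a \<in> A" for a
  proof
    fix e assume "e \<in> degs s a"
    then have "lookup e g \<le> Max (insert 0 ((\<lambda>e. lookup e g) ` (\<Union>a\<in>A. degs s a)))"
      using that by (intro Max_ge[OF fin]) auto
    then show "e \<in> D" by (simp add: D_def k_def)
  qed
  then have AD: "part s D a = a" if "a \<in> A" for a
    using part_degs[of s a] that by (metis Int_absorb1 part_part)
  have SD: "submod V (in_degs s D vecs)"
  proof (rule submod_in_degs[OF submod_vecs_UNIV])
    fix \<mu> :: exponent and e assume "keys \<mu> \<subseteq> V" "e \<in> D"
    moreover have "lookup (exponent_degree \<mu>) g = 0"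
      using V \<open>keys \<mu> \<subseteq> V\<close> by (intro lookup_exponent_degree_eq_0) auto
    ultimately show "exponent_degree \<mu> + e \<in> D" by (simp add: D_def lookup_add)
  qed
  have span: "mspan V A \<subseteq> in_degs s D vecs"
    by (rule mspan_least[OF SD]) (use AD Av in \<open>auto simp: in_degs_def\<close>)
  have "trunc (g # gs) d s Z \<subseteq> K" if "d g \<ge> k" for d
  proof
    fix z assume z: "z \<in> trunc (g # gs) d s Z"
    then have "z \<in> mspan V (A \<union> K)" using A(3) by (auto simp: in_degs_def)
    then obtain a c where ac: "a \<in> mspan V A" "c \<in> K" "z = a + c" by (rule mspan_Un[OF _ gM(3)])
    let ?degs_ge_all = "degs_ge_all (g # gs) d"
    have "degs_ge_all (g # gs) d \<inter> D = {}" using that by (auto simp: degs_ge_all_def D_def)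
    moreover have "part s D a = a" using span ac(1) by (auto simp: in_degs_def)
    ultimately have "part s ?degs_ge_all a = 0" by (metis part_part part_eq_0_iff empty_iff)
    moreover have "part s ?degs_ge_all z = z" using z by (simp add: in_degs_def)
    ultimately have "z = part s ?degs_ge_all c" unfolding ac(3) part_add by simp
    then show "z \<in> K" using gradedD[OF gM(4) ac(2)] by metis
  qed
  then show ?thesis by (rule that)
qed

text \<open>
  The variables \<open>U\<close> of one factor are treated one at a time, assuming a bound \<open>c\<close> for the later
  factors.  The first variable costs nothing and each further one costs one step.
\<close>

lemma truncation_group:
  assumes IH: "\<And>s (Z :: 'k::field vec set) K d. graded_pair V s Z K \<Longrightarrow> iterated_ev gs (\<lambda>d. has_res c V s (trunc gs d s Z) K) d"
    and V: "finite V" "g \<notin> fst ` V" and g: "g \<notin> set gs" and "finite U"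
  shows "(\<And>u. u \<in> U \<Longrightarrow> fst u = g) \<Longrightarrow> graded_pair (U \<union> V) s (Z :: 'k vec set) K \<Longrightarrow>
    iterated_ev (g # gs) (\<lambda>d. has_res (if U = {} then 0 else c + (card U - 1)) (U \<union> V) s (trunc (g # gs) d s Z) K) d"
  using \<open>finite U\<close>
proof (induction U arbitrary: s Z K d rule: finite_induct)
  case empty
  then obtain k where "\<And>d. d g \<ge> k \<Longrightarrow> trunc (g # gs) d s Z \<subseteq> K"
    using truncation_vanishes[of V s Z K g gs] V(2) by auto
  then show ?case unfolding iterated_ev_Cons[OF g]
    by (intro exI[of _ k] allI impI iterated_ev_True) (simp add: has_res_0_iff)
next
  case (insert v U s Z K d)
  let ?S = "U \<union> V" and ?W = "insert v U \<union> V" and ?B = "c + card U"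
  let ?B' = "if U = {} then 0 else c + (card U - 1)"
  let ?R = "\<lambda>s Z K d. has_res ?B ?W s (trunc (g # gs) d s Z) K"
  have fv: "fst v = g" and fU: "\<And>u. u \<in> U \<Longrightarrow> fst u = g" using insert.prems(1) by auto
  then have v: "v \<notin> ?S" using insert.hyps(2) V(2) by force
  have W: "?W = insert v ?S" and finW: "finite ?W" using insert.hyps(1) V(1) by auto
  have XW: "X v ^ k \<in> polys ?W" for k by (intro polys_power polys_X) auto
  have IHU: "iterated_ev (g # gs) (\<lambda>d. has_res ?B' ?S s (trunc (g # gs) d s Z) K) d"
    if "graded_pair ?S s Z K" for s d and Z K :: "'k vec set"
    using insert.IH[OF fU that] .
  have subS: "?S \<subseteq> ?W" by auto
  have killed: "iterated_ev (g # gs) (?R s Z K) d"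
    if gm: "graded_pair ?W s Z K" and kill: "\<And>m. m \<in> Z \<Longrightarrow> X v \<bullet> m \<in> K" for s d and Z K :: "'k vec set"
  proof -
    note gM = graded_pairD[OF gm]
    have "graded_pair ?S s Z K"
      by (rule graded_pair_drop_variable[OF gm[unfolded W] submod_mono[OF subS gM(3)] gM(4) _ gM(5) kill]) auto
    from IHU[OF this] show ?thesis
    proof (rule iterated_ev_mono)
      fix d assume r: "has_res ?B' ?S s (trunc (g # gs) d s Z) K"
      show "?R s Z K d"
      proof (cases "U = {}")
        case True
        then have "has_res 0 ?W s (trunc (g # gs) d s Z) K" using r by (simp add: has_res_0_iff)
        then show ?thesis by (rule has_res_mono[rotated]) simp
      next
        case False
        have "has_res (Suc ?B') (insert v ?S) s (trunc (g # gs) d s Z) K"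
          using gM[unfolded W]
          by - (rule has_res_add_variable[OF v _ _ submod_trunc graded_in_degs _ r],
              auto intro: kill subsetD[OF in_degs_subset])
        moreover have "Suc ?B' = ?B" using False insert.hyps(1) by (cases "card U") auto
        ultimately show ?thesis unfolding W by simp
      qed
    qed
  qed
  have split: "iterated_ev (g # gs) (?R s Z K) d"
    if gm: "graded_pair ?W s Z K" and Y: "submod ?W Y" "graded s Y" "K \<subseteq> Y" "Y \<subseteq> Z"
      and e1: "iterated_ev (g # gs) (?R s Y K) d" and e2: "iterated_ev (g # gs) (?R s Z Y) d" for s d and Z K Y :: "'k vec set"
  proof (rule iterated_ev_mono[OF iterated_ev_conj[OF e1 e2]])
    note gM = graded_pairD[OF gm]
    show "?R s Z K d" if "?R s Y K d \<and> ?R s Z Y d" for d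
      using that has_res_trunc_horseshoe[OF gM(3,4) Y(1,2) gM(1,2) Y(3,4)] by blast
  qed
  have killed_power: "iterated_ev (g # gs) (?R s Z K) d"
    if "graded_pair ?W s Z K" "\<And>m. m \<in> Z \<Longrightarrow> X v ^ k \<bullet> m \<in> K" for k s d and Z K :: "'k vec set"
    using that
  proof (induction k arbitrary: Z K)
    case 0
    then have "Z \<subseteq> K" by auto
    then have "has_res 0 ?W s (trunc (g # gs) d s Z) K" for d using in_degs_subset by (auto simp: has_res_0_iff in_degs_def)
    then show ?case by (intro iterated_ev_True) (rule has_res_mono[rotated], auto)
  next
    case (Suc k)
    note gM = graded_pairD[OF Suc.prems(1)]
    \<comment> \<open>peel off the elements killed by \<open>v\<close> itself\<close>
    define Y where "Y = colon Z K (X v)"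
    have XK: "X v \<bullet> m \<in> K" if "m \<in> K" for m using submod_smul[OF gM(3) XW[of 1] that] by simp
    have Y: "submod ?W Y" unfolding Y_def by (rule submod_colon[OF gM(1,3)])
    have gY: "graded s Y" unfolding Y_def by (rule graded_colon[OF gM(2,4), of _ "single g 1"]) (simp add: X_def fv)
    have KY: "K \<subseteq> Y" "Y \<subseteq> Z" using XK gM(5) by (auto simp: Y_def colon_def)
    note ext = graded_pair_extend[OF Suc.prems(1) finW Y gY KY]
    have "X v ^ k \<bullet> m \<in> Y" if "m \<in> Z" for m
      using Suc.prems(2)[OF that] submod_smul[OF gM(1) XW that] by (simp add: Y_def colon_def smul_smul)
    from Suc.IH[OF ext(2) this] have "iterated_ev (g # gs) (?R s Z Y) d" .
    moreover have "iterated_ev (g # gs) (?R s Y K) d" by (rule killed[OF ext(1)]) (simp add: Y_def colon_def)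
    ultimately show ?case by (intro split[OF Suc.prems(1) Y gY KY])
  qed
  have torsion_free: "iterated_ev (g # gs) (?R s Z K) d"
    if gm: "graded_pair ?W s Z K" and tf: "\<And>m. m \<in> Z \<Longrightarrow> X v \<bullet> m \<in> K \<Longrightarrow> m \<in> K" for s d and Z K :: "'k vec set"
  proof -
    note gM = graded_pairD[OF gm]
    let ?K1 = "set_sum K ((\<bullet>) (X v) ` Z)"
    have XZ: "submod ?W ((\<bullet>) (X v) ` Z)" by (rule submod_image_smul[OF gM(1)])
    have sub: "(\<bullet>) (X v) ` Z \<subseteq> Z" using submod_smul[OF gM(1) XW[of 1]] by auto
    have "graded_pair ?S s Z ?K1"
    proof (rule graded_pair_drop_variable[OF gm[unfolded W]])
      show "submod ?S ?K1" by (rule submod_mono[OF subS submod_set_sum[OF gM(3) XZ]])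
      show "graded s ?K1" by (rule graded_set_sum[OF gM(4) graded_X_image[OF gM(2)]])
      show "K \<subseteq> ?K1" by (rule set_sum_left[OF XZ])
      show "?K1 \<subseteq> Z" by (rule set_sum_least[OF gM(1,5) sub])
      show "X v \<bullet> m \<in> ?K1" if "m \<in> Z" for m using set_sum_right[OF gM(3), of "(\<bullet>) (X v) ` Z"] that by auto
    qed
    from IHU[OF this, of d] obtain k where
      k: "\<And>m. m \<ge> k \<Longrightarrow> iterated_ev gs (\<lambda>d. has_res ?B' ?S s (trunc (g # gs) (d(g := m)) s Z) ?K1) d"
      unfolding iterated_ev_Cons[OF g] by blast
    have shift: "exponent_degree \<mu> + e \<in> degs_eq g \<delta> \<longleftrightarrow> e \<in> degs_eq g \<delta>" if "keys \<mu> \<subseteq> V" for \<mu> e \<delta>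
      by (rule degs_eq_shift[OF V(2) that])
    have strand: "graded_pair V s (in_degs s (degs_eq g \<delta>) Z) (in_degs s (degs_eq g \<delta>) K)" for \<delta>
      unfolding graded_pair_def
    proof (intro conjI)
      have "V \<subseteq> ?W" by auto
      then show "submod V (in_degs s (degs_eq g \<delta>) Z)" "submod V (in_degs s (degs_eq g \<delta>) K)"
        using shift gM(1,3) submod_mono[of V ?W] by (auto intro!: submod_in_degs)
      show "fg V (in_degs s (degs_eq g \<delta>) Z) (in_degs s (degs_eq g \<delta>) K)"
        by (rule fg_strand[OF gm _ _ V(2)]) (use insert.hyps insert.prems in auto)
    qed (rule graded_in_degs[OF gM(2)] graded_in_degs[OF gM(4)] subset_trunc[OF gM(5)])+
    have "iterated_ev gs (\<lambda>d. ?R s Z K (d(g := \<delta>))) d" if "\<delta> \<ge> k" for \<delta>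
    proof (rule iterated_ev_mono[OF iterated_ev_conj[OF k[of "\<delta> + 1"] iffD1[OF iterated_ev_upd[OF g] IH[OF strand[of \<delta>], of "d(g := \<delta>)"]]]])
      show "\<delta> + 1 \<ge> k" using that by simp
      fix d
      assume r: "has_res ?B' ?S s (trunc (g # gs) (d(g := \<delta> + 1)) s Z) ?K1 \<and>
        has_res c V s (trunc gs (d(g := \<delta>)) s (in_degs s (degs_eq g \<delta>) Z)) (in_degs s (degs_eq g \<delta>) K)"
      have "?B' \<le> ?B" by auto
      then have "has_res ?B ?S s (trunc (g # gs) (d(g := \<delta> + 1)) s Z) ?K1" using r has_res_mono by blast
      from has_res_truncation_torsion_free[OF gm[unfolded W] v fv insert.hyps(1) fU V(2) g tf this] r
      show "?R s Z K (d(g := \<delta>))" unfolding W by blast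
    qed
    then show ?thesis unfolding iterated_ev_Cons[OF g] by blast
  qed
  have "iterated_ev (g # gs) (?R s Z K) d"
  proof -
    note gM = graded_pairD[OF insert.prems(2)]
    define L where "L k = colon Z K (X v ^ k)" for k
    \<comment> \<open>the \<open>v\<close>-torsion; being finitely generated, it equals some \<open>L k\<close>\<close>
    define \<Gamma> where "\<Gamma> = (\<Union>k. L k)"
    have L: "submod ?W (L k)" for k unfolding L_def by (rule submod_colon[OF gM(1,3)])
    have gL: "graded s (L k)" for k unfolding L_def X_power by (rule graded_colon[OF gM(2,4), of _ "single g (int k)"]) (simp add: fv)
    have L_mono: "L k \<subseteq> L l" if "k \<le> l" for k l
    proof
      fix m assume m: "m \<in> L k"
      have "X v ^ (l - k) \<bullet> X v ^ k \<bullet> m \<in> K" using m by (intro submod_smul[OF gM(3) XW, of "X v ^ k \<bullet> m"]) (simp add: L_def colon_def)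
      then show "m \<in> L l" using m that by (simp add: L_def colon_def smul_smul power_add[symmetric])
    qed
    have \<Gamma>: "submod ?W \<Gamma>" unfolding \<Gamma>_def by (rule submod_Union_chain[OF L L_mono])
    have g\<Gamma>: "graded s \<Gamma>" using gL unfolding \<Gamma>_def graded_def by blast
    have K_L: "K \<subseteq> L k" for k
      using gM(5) submod_smul[OF gM(3) XW] by (auto simp: L_def colon_def)
    have K\<Gamma>: "K \<subseteq> \<Gamma>" "\<Gamma> \<subseteq> Z" using K_L by (auto simp: \<Gamma>_def L_def colon_def)
    note ext = graded_pair_extend[OF insert.prems(2) finW \<Gamma> g\<Gamma> K\<Gamma>]
    obtain A where A: "finite A" "A \<subseteq> \<Gamma>" "\<Gamma> \<subseteq> mspan ?W (A \<union> K)"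
      using graded_pairD(6)[OF ext(1)] by (auto simp: fg_def)
    obtain k where "A \<subseteq> L k" using finite_subset_chain[OF A(1) A(2)[unfolded \<Gamma>_def] L_mono] by blast
    then have "\<Gamma> \<subseteq> L k" using A(3) mspan_least[OF L, of "A \<union> K" k] K_L[of k] by blast
    then have kill: "X v ^ k \<bullet> m \<in> K" if "m \<in> \<Gamma>" for m using that by (auto simp: L_def colon_def)
    have tf: "m \<in> \<Gamma>" if m: "m \<in> Z" "X v \<bullet> m \<in> \<Gamma>" for m
    proof -
      obtain k where "X v ^ k \<bullet> X v \<bullet> m \<in> K" using m(2) by (auto simp: \<Gamma>_def L_def colon_def)
      then have "m \<in> L (Suc k)" using m(1) by (simp add: L_def colon_def smul_smul mult.commute)
      then show ?thesis unfolding \<Gamma>_def by blast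
    qed
    show ?thesis
      by (rule split[OF insert.prems(2) \<Gamma> g\<Gamma> K\<Gamma> killed_power[OF ext(1) kill] torsion_free[OF ext(2) tf]])
  qed
  moreover have "card (insert v U) - 1 = card U" using insert.hyps by simp
  ultimately show ?case by simp
qed

text \<open>
  The number \<open>card (V g) - 1\<close> is the dimension of the projective space with the homogeneous coordinates
  \<open>V g\<close>, and the successor accounts for the term \<open>F\<^sub>0\<close>.  Over no variables at all this is the freeness of
  vector spaces, and each factor is added by \<open>truncation_group\<close>.
\<close>

theorem truncation:
  assumes "distinct gs" "\<And>g. g \<in> set gs \<Longrightarrow> finite (V g)" "\<And>g. g \<in> set gs \<Longrightarrow> V g \<noteq> {}"
    "\<And>g v. g \<in> set gs \<Longrightarrow> v \<in> V g \<Longrightarrow> fst v = g"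
    and "graded_pair (\<Union>g\<in>set gs. V g) s (Z :: 'k::field vec set) K"
  shows "iterated_ev gs (\<lambda>d. has_res (Suc (\<Sum>g\<leftarrow>gs. card (V g) - 1)) (\<Union>g\<in>set gs. V g) s (trunc gs d s Z) K) d"
  using assms
proof (induction gs arbitrary: s Z K d)
  case Nil
  then have "graded_pair {} s Z K" by simp
  note gM = graded_pairD[OF this]
  have "trunc [] d s Z = Z" for d by (auto simp: in_degs_def degs_ge_all_def part_eq_iff)
  then show ?case using has_res_field[OF gM(6,3,1,2)] by simp
next
  case (Cons g gs s Z K d)
  let ?V = "\<Union>g\<in>set gs. V g"
  have "iterated_ev (g # gs) (\<lambda>d. has_res (if V g = {} then 0 else Suc (\<Sum>g\<leftarrow>gs. card (V g) - 1) + (card (V g) - 1))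
      (V g \<union> ?V) s (trunc (g # gs) d s Z) K) d"
  proof (rule truncation_group)
    show "iterated_ev gs (\<lambda>d. has_res (Suc (\<Sum>g\<leftarrow>gs. card (V g) - 1)) ?V s (trunc gs d s Z) K) d"
      if "graded_pair ?V s Z K" for s d and Z K :: "'k vec set"
      by (rule Cons.IH[OF _ _ _ _ that]) (use Cons.prems in auto)
    show "g \<notin> fst ` ?V"
    proof
      assume "g \<in> fst ` ?V"
      then obtain h v where "h \<in> set gs" "v \<in> V h" "fst v = g" by auto
      moreover from this have "fst v = h" using Cons.prems(4)[of h v] by simp
      ultimately show False using Cons.prems(1) by simp
    qed
  qed (use Cons.prems in auto)
  then show ?case using Cons.prems(3)[of g] by (simp add: add.commute)
qed


section \<open>Germs\<close>

lemma cox_simps [simp]: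
  "carrier (cox n) = polys (variables n)" "mult (cox n) = (*)" "one (cox n) = 1"
  "zero (cox n) = 0" "add (cox n) = (+)" "smult (cox n) = (*)"
  by (simp_all add: cox_def Let_def polys_def)

lemma component_cox: "component (cox n) d = {f \<in> polys (variables n). \<forall>\<mu>\<in>keys f. exponent_degree \<mu> = d}"
  by (simp add: cox_def Let_def polys_def)

lemma cring_cox: "cring (cox n :: ('k::field cox_poly, 'k cox_poly) graded_module)"
proof (intro cringI abelian_groupI comm_monoidI)
  fix x :: "'k cox_poly"
  assume "x \<in> carrier (cox n)"
  then show "\<exists>y\<in>carrier (cox n). y \<oplus>\<^bsub>cox n\<^esub> x = \<zero>\<^bsub>cox n\<^esub>"
    by (intro bexI[of _ "- x"]) (auto intro: polys_uminus)
qed (auto intro: polys_add polys_mult simp: algebra_simps)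

lemma multidegrees_add: "d \<in> multidegrees n \<Longrightarrow> e \<in> multidegrees n \<Longrightarrow> d + e \<in> multidegrees n"
  using keys_add[of d e] by (auto simp: multidegrees_def)

lemma multidegrees_0: "0 \<in> multidegrees n" by (auto simp: multidegrees_def)

lemma component_cox_mult:
  assumes "f \<in> component (cox n) d" "g \<in> component (cox n) e"
  shows "f * g \<in> component (cox n) (d + e)"
  using assms keys_mult[of f g] by (fastforce simp: component_cox polys_mult exponent_degree_add)

lemma component_cox_1: "1 \<in> component (cox n) 0"
  by (auto simp: component_cox)

text \<open>
  The part of the notion of a graded module that germs and sections depend on.  The Cox ring, whose
  germs act on those of a module, is easily seen to have it.
\<close>

definition premodule ::
  "nat list \<Rightarrow> ('k::field cox_poly, 'm) graded_module \<Rightarrow> bool" where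
  "premodule n M \<longleftrightarrow>
     Module.module (cox n) M \<and>
     (\<forall>d \<in> multidegrees n. additive_subgroup (component M d) M) \<and>
     (\<forall>d \<in> multidegrees n. \<forall>e \<in> multidegrees n.
        \<forall>f \<in> component (cox n) d. \<forall>m \<in> component M e. f \<odot>\<^bsub>M\<^esub> m \<in> component M (d + e))"

lemma graded_module_premodule: "graded_module n M \<Longrightarrow> premodule n M"
  by (simp add: graded_module_def premodule_def)

lemma premodule_cox: "premodule n (cox n)"
  unfolding premodule_def
proof (intro conjI ballI)
  show "Module.module (cox n) (cox n)"
    using cring_cox[of n]
    by - (rule moduleI, auto simp: algebra_simps intro: polys_mult ring.is_abelian_group cring.axioms(1))
  fix d
  show "additive_subgroup (component (cox n) d) (cox n :: ('a cox_poly, 'a cox_poly) graded_module)"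
  proof (rule additive_subgroup.intro, rule subgroup.intro)
    fix f g :: "'a cox_poly" assume f: "f \<in> component (cox n) d"
    interpret cring "cox n :: ('a cox_poly, 'a cox_poly) graded_module" by (rule cring_cox)
    have "inv\<^bsub>add_monoid (cox n)\<^esub> f = - f"
      by (rule group.inv_equality[OF a_group]) (use f in \<open>auto simp: component_cox polys_uminus\<close>)
    moreover have "- f \<in> component (cox n) d"
      using f by (auto simp: component_cox polys_uminus in_keys_iff)
    ultimately show "inv\<^bsub>add_monoid (cox n)\<^esub> f \<in> component (cox n) d" by simp
    assume g: "g \<in> component (cox n) d"
    have "f + g \<in> component (cox n) d"
      using f g keys_add[of f g] unfolding component_cox by (auto simp: polys_add)
    then show "f \<otimes>\<^bsub>add_monoid (cox n)\<^esub> g \<in> component (cox n) d" by simp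
  qed (auto simp: component_cox)
qed (simp add: component_cox_mult)

text \<open>The operations of a module over the Cox ring, in the language of polynomials.\<close>

locale cox_module =
  fixes n :: "nat list" and M :: "('k::field cox_poly, 'm) graded_module" (structure)
  assumes premodule: "premodule n M"
begin

sublocale Module.module "cox n" M using premodule by (simp add: premodule_def)

lemma sm_closed: "a \<in> polys (variables n) \<Longrightarrow> x \<in> carrier M \<Longrightarrow> a \<odot> x \<in> carrier M"
  using smult_closed[of a x] by simp

lemma sm_sm: "a \<in> polys (variables n) \<Longrightarrow> b \<in> polys (variables n) \<Longrightarrow> x \<in> carrier M \<Longrightarrow> a \<odot> (b \<odot> x) = (a * b) \<odot> x"
  using smult_assoc1[of a b x] by simp

lemma sm_one: "x \<in> carrier M \<Longrightarrow> 1 \<odot> x = x"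
  using smult_one[of x] by simp

lemma sm_add: "a \<in> polys (variables n) \<Longrightarrow> x \<in> carrier M \<Longrightarrow> y \<in> carrier M \<Longrightarrow> a \<odot> (x \<oplus> y) = a \<odot> x \<oplus> a \<odot> y"
  using smult_r_distr[of a x y] by simp

lemma sm_add_left: "a \<in> polys (variables n) \<Longrightarrow> b \<in> polys (variables n) \<Longrightarrow> x \<in> carrier M \<Longrightarrow> (a + b) \<odot> x = a \<odot> x \<oplus> b \<odot> x"
  using smult_l_distr[of a b x] by simp

lemma sm_zero: "a \<in> polys (variables n) \<Longrightarrow> a \<odot> \<zero> = \<zero>"
  using smult_r_null[of a] by simp

lemma sm_zero_left: "x \<in> carrier M \<Longrightarrow> 0 \<odot> x = \<zero>"
  using smult_l_null[of x] by simp

lemma comp_subgroup: "d \<in> multidegrees n \<Longrightarrow> additive_subgroup (component M d) M"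
  using premodule by (simp add: premodule_def)

lemma comp_carrier: "d \<in> multidegrees n \<Longrightarrow> x \<in> component M d \<Longrightarrow> x \<in> carrier M"
  using additive_subgroup.a_Hcarr[OF comp_subgroup] by auto

lemma comp_zero: "d \<in> multidegrees n \<Longrightarrow> \<zero> \<in> component M d"
  using additive_subgroup.zero_closed[OF comp_subgroup] by auto

lemma comp_add: "d \<in> multidegrees n \<Longrightarrow> x \<in> component M d \<Longrightarrow> y \<in> component M d \<Longrightarrow> x \<oplus> y \<in> component M d"
  using additive_subgroup.a_closed[OF comp_subgroup] by auto

lemma comp_smult: "d \<in> multidegrees n \<Longrightarrow> e \<in> multidegrees n \<Longrightarrow> f \<in> component (cox n) d \<Longrightarrow> x \<in> component M e
    \<Longrightarrow> f \<odot> x \<in> component M (d + e)"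
  using premodule by (auto simp: premodule_def)

end

lemma component_cox_polys: "f \<in> component (cox n) d \<Longrightarrow> f \<in> polys (variables n)"
  by (simp add: component_cox)


text \<open>
  The forms that become invertible in the stalk at \<open>P\<close>.
\<close>

definition denominators :: "nat list \<Rightarrow> 'k::field point \<Rightarrow> 'k cox_poly set" where
  "denominators n P = {h \<in> homogeneous_elements n (cox n). h \<notin> P}"

lemma denominatorsE:
  assumes "h \<in> denominators n P"
  obtains d where "d \<in> multidegrees n" "h \<in> component (cox n) d" "h \<notin> P"
  using assms by (auto simp: denominators_def homogeneous_elements_def)

lemma denominatorsI: "d \<in> multidegrees n \<Longrightarrow> h \<in> component (cox n) d \<Longrightarrow> h \<notin> P \<Longrightarrow> h \<in> denominators n P"
  by (auto simp: denominators_def homogeneous_elements_def)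

lemma denominators_polys: "h \<in> denominators n P \<Longrightarrow> h \<in> polys (variables n)"
  by (auto elim!: denominatorsE simp: component_cox)

lemma proj_pointsD:
  assumes "P \<in> proj_points n"
  shows "primeideal P (cox n)" "\<not> irrelevant_ideal n \<subseteq> P"
  using assms by (auto simp: proj_points_def)

lemma point_mult: "P \<in> proj_points n \<Longrightarrow> a \<in> polys (variables n) \<Longrightarrow> b \<in> polys (variables n) \<Longrightarrow> a * b \<in> P \<longleftrightarrow> a \<in> P \<or> b \<in> P"
  using primeideal.I_prime[OF proj_pointsD(1), of P n a b]
    ideal.I_l_closed[OF primeideal.axioms(1)[OF proj_pointsD(1)], of P n b a]
    ideal.I_r_closed[OF primeideal.axioms(1)[OF proj_pointsD(1)], of P n a b] by auto

lemma point_one: "P \<in> proj_points n \<Longrightarrow> 1 \<notin> P"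
proof
  assume P: "P \<in> proj_points n" and "1 \<in> P"
  then have "P = carrier (cox n)"
    using ideal.one_imp_carrier[OF primeideal.axioms(1)[OF proj_pointsD(1)[OF P]]] by simp
  then show False using primeideal.I_notcarr[OF proj_pointsD(1)[OF P]] by simp
qed

lemma denominators_mult:
  assumes P: "P \<in> proj_points n" and "h \<in> denominators n P" "h' \<in> denominators n P"
  shows "h * h' \<in> denominators n P"
proof -
  obtain d e where "d \<in> multidegrees n" "h \<in> component (cox n) d" "h \<notin> P"
    "e \<in> multidegrees n" "h' \<in> component (cox n) e" "h' \<notin> P"
    using assms(2,3) by (meson denominatorsE)
  then show ?thesis
    by (intro denominatorsI[OF multidegrees_add component_cox_mult])
      (auto simp: point_mult[OF P] component_cox_polys)
qed

lemma denominators_1: "P \<in> proj_points n \<Longrightarrow> 1 \<in> denominators n P"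
  by (rule denominatorsI[OF multidegrees_0 component_cox_1 point_one])

text \<open>
  The pair \<open>m / f\<close> is an admissible fraction at \<open>P\<close>; only for these pairs is a germ meaningful.
\<close>

definition is_frac ::
  "nat list \<Rightarrow> ('k::field cox_poly, 'm) graded_module \<Rightarrow> 'k point \<Rightarrow> 'm \<Rightarrow> 'k cox_poly \<Rightarrow> bool" where
  "is_frac n M P m f \<longleftrightarrow> (\<exists>d\<in>multidegrees n. m \<in> component M d \<and> f \<in> component (cox n) d \<and> f \<notin> P)"

definition frac_eq ::
  "nat list \<Rightarrow> ('k::field cox_poly, 'm) graded_module \<Rightarrow> 'k point \<Rightarrow> 'm \<Rightarrow> 'k cox_poly \<Rightarrow> 'm \<Rightarrow> 'k cox_poly \<Rightarrow> bool" where
  "frac_eq n M P m f m' f' \<longleftrightarrow> (\<exists>h\<in>denominators n P. (h * f') \<odot>\<^bsub>M\<^esub> m = (h * f) \<odot>\<^bsub>M\<^esub> m')"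

context cox_module
begin

lemma is_fracD: "is_frac n M P m f \<Longrightarrow> m \<in> carrier M" "is_frac n M P m f \<Longrightarrow> f \<in> polys (variables n)"
  "is_frac n M P m f \<Longrightarrow> f \<in> denominators n P"
  by (auto simp: is_frac_def comp_carrier component_cox_polys intro: denominatorsI)

lemma mem_germ: "is_frac n M P m f \<Longrightarrow> (m', f') \<in> germ n M P m f \<longleftrightarrow> is_frac n M P m' f' \<and> frac_eq n M P m f m' f'"
proof -
  assume f: "is_frac n M P m f"
  have "h \<odot> (f' \<odot> m) = h \<odot> (f \<odot> m') \<longleftrightarrow> (h * f') \<odot> m = (h * f) \<odot> m'"
    if "is_frac n M P m' f'" "h \<in> polys (variables n)" for h
    using that is_fracD[OF f] is_fracD[OF that(1)] by (simp add: sm_sm)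
  then show ?thesis
    using denominators_polys
    by (auto simp: germ_def frac_eq_def is_frac_def[of n M P m' f'] denominators_def Bex_def) blast+
qed

lemma frac_eq_refl: "P \<in> proj_points n \<Longrightarrow> frac_eq n M P m f m f"
  unfolding frac_eq_def using denominators_1 by blast

lemma frac_eq_sym: "frac_eq n M P m f m' f' \<Longrightarrow> frac_eq n M P m' f' m f"
  unfolding frac_eq_def by metis

lemma frac_eq_trans:
  assumes P: "P \<in> proj_points n" and f: "is_frac n M P m f" "is_frac n M P m' f'" "is_frac n M P m'' f''"
    and e: "frac_eq n M P m f m' f'" "frac_eq n M P m' f' m'' f''"
  shows "frac_eq n M P m f m'' f''"
proof -
  obtain h h' where h: "h \<in> denominators n P" "(h * f') \<odot> m = (h * f) \<odot> m'"
    and h': "h' \<in> denominators n P" "(h' * f'') \<odot> m' = (h' * f') \<odot> m''"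
    using e by (auto simp: frac_eq_def)
  note c = is_fracD(1,2)[OF f(1)] is_fracD(1,2)[OF f(2)] is_fracD(1,2)[OF f(3)]
    denominators_polys[OF h(1)] denominators_polys[OF h'(1)]
  have "(h * h' * f' * f'') \<odot> m = (h' * f'') \<odot> ((h * f') \<odot> m)"
    using c by (simp add: sm_sm polys_mult mult_ac)
  also have "\<dots> = (h * f) \<odot> ((h' * f'') \<odot> m')"
    unfolding h(2) using c by (simp add: sm_sm polys_mult mult_ac)
  also have "\<dots> = (h * h' * f' * f) \<odot> m''"
    unfolding h'(2) using c by (simp add: sm_sm polys_mult mult_ac)
  finally show ?thesis unfolding frac_eq_def
    using denominators_mult[OF P denominators_mult[OF P h(1) h'(1)] is_fracD(3)[OF f(2)]] by blast
qed

lemma germ_eqI: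
  assumes P: "P \<in> proj_points n" and f: "is_frac n M P m f" "is_frac n M P m' f'" "frac_eq n M P m f m' f'"
  shows "germ n M P m f = germ n M P m' f'"
proof (rule Set.set_eqI)
  fix x :: "'m \<times> 'k cox_poly"
  obtain m'' f'' where x: "x = (m'', f'')" by (cases x)
  show "x \<in> germ n M P m f \<longleftrightarrow> x \<in> germ n M P m' f'"
    unfolding x mem_germ[OF f(1)] mem_germ[OF f(2)]
    using frac_eq_trans[OF P f(1,2) _ f(3)] frac_eq_trans[OF P f(2,1) _ frac_eq_sym[OF f(3)]] by blast
qed

lemma germ_eqD:
  assumes P: "P \<in> proj_points n" and f: "is_frac n M P m f" "is_frac n M P m' f'" "germ n M P m f = germ n M P m' f'"
  shows "frac_eq n M P m f m' f'"
proof -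
  have "(m', f') \<in> germ n M P m' f'" unfolding mem_germ[OF f(2)] using f(2) frac_eq_refl[OF P] by blast
  then show ?thesis using mem_germ[OF f(1)] f(3) by simp
qed

text \<open>
  The operations on germs are unions over all representatives; this rule evaluates them at one
  representative.
\<close>

lemma UN_germ:
  assumes P: "P \<in> proj_points n" and f: "is_frac n M P m f"
    and G: "\<And>m' f'. is_frac n M P m' f' \<Longrightarrow> frac_eq n M P m f m' f' \<Longrightarrow> G m' f' = G m f"
  shows "(\<Union>(m', f')\<in>germ n M P m f. G m' f') = G m f"
proof -
  have "(m, f) \<in> germ n M P m f" unfolding mem_germ[OF f] using f frac_eq_refl[OF P] by blast
  moreover have "G m' f' = G m f" if "(m', f') \<in> germ n M P m f" for m' f'
    using that G unfolding mem_germ[OF f] by blast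
  ultimately show ?thesis by fast
qed

lemma frac_add:
  assumes P: "P \<in> proj_points n" and "is_frac n M P m f" "is_frac n M P m' f'"
  shows "is_frac n M P (f' \<odot> m \<oplus> f \<odot> m') (f * f')"
proof -
  obtain d e where d: "d \<in> multidegrees n" "m \<in> component M d" "f \<in> component (cox n) d" "f \<notin> P"
    and e: "e \<in> multidegrees n" "m' \<in> component M e" "f' \<in> component (cox n) e" "f' \<notin> P"
    using assms(2,3) unfolding is_frac_def by blast
  have "f' \<odot> m \<in> component M (d + e)" "f \<odot> m' \<in> component M (d + e)"
    using comp_smult[OF e(1) d(1) e(3) d(2)] comp_smult[OF d(1) e(1) d(3) e(2)] by (simp_all add: add.commute)
  then show ?thesis unfolding is_frac_def using d e
    by (intro bexI[of _ "d + e"] conjI comp_add component_cox_mult multidegrees_add)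
      (auto simp: point_mult[OF P] component_cox_polys multidegrees_add)
qed

lemma frac_smult:
  assumes P: "P \<in> proj_points n" and "is_frac n (cox n) P b g" "is_frac n M P m f"
  shows "is_frac n M P (b \<odot> m) (g * f)"
proof -
  obtain d e where d: "d \<in> multidegrees n" "b \<in> component (cox n) d" "g \<in> component (cox n) d" "g \<notin> P"
    and e: "e \<in> multidegrees n" "m \<in> component M e" "f \<in> component (cox n) e" "f \<notin> P"
    using assms(2,3) unfolding is_frac_def by blast
  then show ?thesis unfolding is_frac_def
    by (intro bexI[of _ "d + e"] conjI comp_smult component_cox_mult multidegrees_add)
      (auto simp: point_mult[OF P] component_cox_polys multidegrees_add)
qed

lemma germ_add_germ:
  assumes P: "P \<in> proj_points n" and f: "is_frac n M P m f" and f': "is_frac n M P m' f'"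
  shows "germ_add n M P (germ n M P m f) (germ n M P m' f') = germ n M P (f' \<odot> m \<oplus> f \<odot> m') (f * f')"
proof -
  have eq: "germ n M P (f1' \<odot> m1 \<oplus> f1 \<odot> m1') (f1 * f1') = germ n M P (f' \<odot> m \<oplus> f \<odot> m') (f * f')"
    if f1: "is_frac n M P m1 f1" "frac_eq n M P m f m1 f1" and f1': "is_frac n M P m1' f1'" "frac_eq n M P m' f' m1' f1'"
    for m1 f1 m1' f1'
  proof (rule germ_eqI[OF P frac_add[OF P f1(1) f1'(1)] frac_add[OF P f f']])
    obtain h h' where h: "h \<in> denominators n P" "(h * f1) \<odot> m = (h * f) \<odot> m1"
      and h': "h' \<in> denominators n P" "(h' * f1') \<odot> m' = (h' * f') \<odot> m1'"
      using f1(2) f1'(2) by (auto simp: frac_eq_def)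
    note c = is_fracD(1,2)[OF f] is_fracD(1,2)[OF f'] is_fracD(1,2)[OF f1(1)] is_fracD(1,2)[OF f1'(1)]
      denominators_polys[OF h(1)] denominators_polys[OF h'(1)]
    have "(h * h' * (f * f')) \<odot> (f1' \<odot> m1 \<oplus> f1 \<odot> m1') = (h' * f' * f1') \<odot> ((h * f) \<odot> m1) \<oplus> (h * f * f1) \<odot> ((h' * f') \<odot> m1')"
      using c by (simp add: sm_add sm_closed sm_sm polys_mult mult_ac)
    also have "\<dots> = (h * h' * (f1 * f1')) \<odot> (f' \<odot> m \<oplus> f \<odot> m')"
      unfolding h(2)[symmetric] h'(2)[symmetric]
      using c by (simp add: sm_add sm_closed sm_sm polys_mult mult_ac)
    finally show "frac_eq n M P (f1' \<odot> m1 \<oplus> f1 \<odot> m1') (f1 * f1') (f' \<odot> m \<oplus> f \<odot> m') (f * f')"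
      unfolding frac_eq_def using denominators_mult[OF P h(1) h'(1)] by blast
  qed
  have "germ_add n M P (germ n M P m f) (germ n M P m' f') =
    (\<Union>(m1, f1)\<in>germ n M P m f. germ n M P (f' \<odot> m1 \<oplus> f1 \<odot> m') (f1 * f'))"
    unfolding germ_add_def
  proof (rule SUP_cong[OF refl], clarify)
    fix m1 f1 assume "(m1, f1) \<in> germ n M P m f"
    then have f1: "is_frac n M P m1 f1" "frac_eq n M P m f m1 f1" using mem_germ[OF f] by auto
    show "(\<Union>(m1', f1')\<in>germ n M P m' f'. germ n M P (f1' \<odot> m1 \<oplus> f1 \<odot> m1') (f1 * f1')) =
      germ n M P (f' \<odot> m1 \<oplus> f1 \<odot> m') (f1 * f')"
      using eq[OF f1] f' frac_eq_refl[OF P] by (intro UN_germ[OF P f']) metis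
  qed
  also have "\<dots> = germ n M P (f' \<odot> m \<oplus> f \<odot> m') (f * f')"
    using eq f' frac_eq_refl[OF P] by (intro UN_germ[OF P f]) metis
  finally show ?thesis .
qed

lemma germ_smult_germ:
  assumes P: "P \<in> proj_points n" and g: "is_frac n (cox n) P b g" and f: "is_frac n M P m f"
  shows "germ_smult n M P (germ n (cox n) P b g) (germ n M P m f) = germ n M P (b \<odot> m) (g * f)"
proof -
  interpret S: cox_module n "cox n" by (standard) (rule premodule_cox)
  have eq: "germ n M P (b1 \<odot> m1) (g1 * f1) = germ n M P (b \<odot> m) (g * f)"
    if f1: "is_frac n M P m1 f1" "frac_eq n M P m f m1 f1" and g1: "is_frac n (cox n) P b1 g1" "frac_eq n (cox n) P b g b1 g1"
    for m1 f1 b1 g1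
  proof (rule germ_eqI[OF P frac_smult[OF P g1(1) f1(1)] frac_smult[OF P g f]])
    obtain h h' where h: "h \<in> denominators n P" "(h * f1) \<odot> m = (h * f) \<odot> m1"
      and h': "h' \<in> denominators n P" "(h' * g1) * b = (h' * g) * b1"
      using f1(2) g1(2) by (auto simp: frac_eq_def)
    note c = is_fracD(1,2)[OF f] S.is_fracD(1,2)[OF g] is_fracD(1,2)[OF f1(1)] S.is_fracD(1,2)[OF g1(1)]
      denominators_polys[OF h(1)] denominators_polys[OF h'(1)]
    have "(h * h' * (g * f)) \<odot> (b1 \<odot> m1) = ((h' * g) * b1) \<odot> ((h * f) \<odot> m1)"
      using c by (simp add: sm_sm polys_mult mult_ac)
    also have "\<dots> = ((h' * g1) * b) \<odot> ((h * f1) \<odot> m)"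
      unfolding h(2) h'(2) ..
    also have "\<dots> = (h * h' * (g1 * f1)) \<odot> (b \<odot> m)"
      using c by (simp add: sm_sm polys_mult mult_ac)
    finally show "frac_eq n M P (b1 \<odot> m1) (g1 * f1) (b \<odot> m) (g * f)"
      unfolding frac_eq_def using denominators_mult[OF P h(1) h'(1)] by blast
  qed
  have "germ_smult n M P (germ n (cox n) P b g) (germ n M P m f) =
    (\<Union>(b1, g1)\<in>germ n (cox n) P b g. germ n M P (b1 \<odot> m) (g1 * f))"
    unfolding germ_smult_def
  proof (rule SUP_cong[OF refl], clarify)
    fix b1 g1 assume "(b1, g1) \<in> germ n (cox n) P b g"
    then have g1: "is_frac n (cox n) P b1 g1" "frac_eq n (cox n) P b g b1 g1" using S.mem_germ[OF g] by auto
    show "(\<Union>(m1, f1)\<in>germ n M P m f. germ n M P (b1 \<odot> m1) (g1 * f1)) = germ n M P (b1 \<odot> m) (g1 * f)"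
      using eq[OF _ _ g1] f frac_eq_refl[OF P] by (intro UN_germ[OF P f]) metis
  qed
  also have "\<dots> = germ n M P (b \<odot> m) (g * f)"
    using eq[OF f frac_eq_refl[OF P]] g S.frac_eq_refl[OF P] by (intro S.UN_germ[OF P g]) metis
  finally show ?thesis .
qed

end


section \<open>Sheaf maps induced by graded homomorphisms\<close>

lemma zariski_open_points: "zariski_open n U \<Longrightarrow> P \<in> U \<Longrightarrow> P \<in> proj_points n"
  by (auto simp: zariski_open_def)

text \<open>
  Multiplying the defining polynomials by \<open>u\<close> removes the zeros of \<open>u\<close>, as points are prime ideals.
\<close>

lemma zariski_open_nonvanishing:
  assumes "zariski_open n V" "u \<in> polys (variables n)"
  shows "zariski_open n {Q \<in> V. u \<notin> Q}"
proof -
  obtain A where A: "A \<subseteq> polys (variables n)" "V = {P \<in> proj_points n. \<not> A \<subseteq> P}"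
    using assms(1) by (auto simp: zariski_open_def)
  have "(\<lambda>a. a * u) ` A \<subseteq> P \<longleftrightarrow> A \<subseteq> P \<or> u \<in> P" if "P \<in> proj_points n" for P
    using point_mult[OF that _ assms(2)] A(1) by blast
  then have "{Q \<in> V. u \<notin> Q} = {P \<in> proj_points n. \<not> (\<lambda>a. a * u) ` A \<subseteq> P}"
    unfolding A(2) by blast
  moreover have "(\<lambda>a. a * u) ` A \<subseteq> carrier (cox n)" using A(1) assms(2) by (auto intro: polys_mult)
  ultimately show ?thesis unfolding zariski_open_def by blast
qed

lemma sectionsE:
  assumes "s \<in> sections n M U" "P \<in> U"
  obtains V d m f where "zariski_open n V" "P \<in> V" "V \<subseteq> U" "d \<in> multidegrees n" "m \<in> component M d"
    "f \<in> component (cox n) d" "\<And>Q. Q \<in> V \<Longrightarrow> f \<notin> Q" "\<And>Q. Q \<in> V \<Longrightarrow> s Q = germ n M Q m f"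
proof -
  have "\<forall>P\<in>U. \<exists>V. zariski_open n V \<and> P \<in> V \<and> V \<subseteq> U \<and>
      (\<exists>d\<in>multidegrees n. \<exists>m\<in>component M d. \<exists>f\<in>component (cox n) d. \<forall>Q\<in>V. f \<notin> Q \<and> s Q = germ n M Q m f)"
    using assms(1) unfolding sections_def mem_Collect_eq by (rule conjunct2)
  from bspec[OF this assms(2)] obtain V where V: "zariski_open n V" "P \<in> V" "V \<subseteq> U"
    and ex: "\<exists>d\<in>multidegrees n. \<exists>m\<in>component M d. \<exists>f\<in>component (cox n) d. \<forall>Q\<in>V. f \<notin> Q \<and> s Q = germ n M Q m f"
    by (elim exE conjE)
  from ex obtain d m f where "d \<in> multidegrees n" "m \<in> component M d" "f \<in> component (cox n) d"
    "\<forall>Q\<in>V. f \<notin> Q \<and> s Q = germ n M Q m f" by (elim bexE)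
  then show ?thesis using that[OF V] by simp
qed

lemma section_stalk:
  assumes "s \<in> sections n M U" "P \<in> U"
  obtains m f where "is_frac n M P m f" "s P = germ n M P m f"
  using sectionsE[OF assms] unfolding is_frac_def by metis

lemma sectionsI:
  assumes "s \<in> extensional U"
    and "\<And>P. P \<in> U \<Longrightarrow> \<exists>V d m f. zariski_open n V \<and> P \<in> V \<and> V \<subseteq> U \<and> d \<in> multidegrees n \<and> m \<in> component M d \<and>
      f \<in> component (cox n) d \<and> (\<forall>Q\<in>V. f \<notin> Q \<and> s Q = germ n M Q m f)"
  shows "s \<in> sections n M U"
  unfolding sections_def mem_Collect_eq
proof (intro conjI PiE_I ballI)
  fix P assume "P \<in> U"
  from assms(2)[OF this] obtain V d m f where V: "zariski_open n V" "P \<in> V" "V \<subseteq> U"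
    and dmf: "d \<in> multidegrees n" "m \<in> component M d" "f \<in> component (cox n) d"
    and germ: "\<forall>Q\<in>V. f \<notin> Q \<and> s Q = germ n M Q m f" by (elim exE conjE)
  show "s P \<in> stalk n M P"
    unfolding stalk_def mem_Collect_eq using dmf bspec[OF germ V(2)]
    by (intro exI[of _ m] exI[of _ f] exI[of _ d]) simp
  show "\<exists>V. zariski_open n V \<and> P \<in> V \<and> V \<subseteq> U \<and> (\<exists>d\<in>multidegrees n. \<exists>m\<in>component M d.
      \<exists>f\<in>component (cox n) d. \<forall>Q\<in>V. f \<notin> Q \<and> s Q = germ n M Q m f)"
    by (rule exI[of _ V], intro conjI V, rule bexI[of _ d], rule bexI[of _ m], rule bexI[of _ f], rule germ)
      (rule dmf)+
qed (use assms(1) in \<open>auto simp: extensional_def\<close>)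

lemma section_fraction:
  assumes "zariski_open n V" "d \<in> multidegrees n" "m \<in> component M d" "f \<in> component (cox n) d" "\<And>Q. Q \<in> V \<Longrightarrow> f \<notin> Q"
  shows "(\<lambda>Q\<in>V. germ n M Q m f) \<in> sections n M V"
proof (rule sectionsI)
  fix P assume "P \<in> V"
  then show "\<exists>V' d' m' f'. zariski_open n V' \<and> P \<in> V' \<and> V' \<subseteq> V \<and> d' \<in> multidegrees n \<and> m' \<in> component M d' \<and>
      f' \<in> component (cox n) d' \<and> (\<forall>Q\<in>V'. f' \<notin> Q \<and> (\<lambda>Q\<in>V. germ n M Q m f) Q = germ n M Q m' f')"
    using assms by (intro exI[of _ V] exI[of _ d] exI[of _ m] exI[of _ f]) simp
qed simp

lemma graded_hom_component:
  "h \<in> graded_hom n M N \<Longrightarrow> d \<in> multidegrees n \<Longrightarrow> m \<in> component M d \<Longrightarrow> h m \<in> component N d"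
  by (auto simp: graded_hom_def)

lemma graded_hom_add: "h \<in> graded_hom n M N \<Longrightarrow> x \<in> carrier M \<Longrightarrow> y \<in> carrier M \<Longrightarrow> h (x \<oplus>\<^bsub>M\<^esub> y) = h x \<oplus>\<^bsub>N\<^esub> h y"
  and graded_hom_smult: "h \<in> graded_hom n M N \<Longrightarrow> a \<in> polys (variables n) \<Longrightarrow> x \<in> carrier M \<Longrightarrow> h (a \<odot>\<^bsub>M\<^esub> x) = a \<odot>\<^bsub>N\<^esub> h x"
  by (auto simp: graded_hom_def module_hom_def)

locale cox_module_hom = A: cox_module n M + B: cox_module n N
  for n and M :: "('k::field cox_poly, 'm) graded_module" and N :: "('k cox_poly, 'l) graded_module" +
  fixes h
  assumes hom: "h \<in> graded_hom n M N"
begin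

lemma frac_hom: "is_frac n M P m f \<Longrightarrow> is_frac n N P (h m) f"
  unfolding is_frac_def using graded_hom_component[OF hom] by blast

lemma frac_eq_hom:
  assumes "is_frac n M P m f" "is_frac n M P m' f'" "frac_eq n M P m f m' f'"
  shows "frac_eq n N P (h m) f (h m') f'"
proof -
  obtain g where g: "g \<in> denominators n P" "(g * f') \<odot>\<^bsub>M\<^esub> m = (g * f) \<odot>\<^bsub>M\<^esub> m'"
    using assms(3) by (auto simp: frac_eq_def)
  have "(g * f') \<odot>\<^bsub>N\<^esub> h m = (g * f) \<odot>\<^bsub>N\<^esub> h m'"
    using arg_cong[OF g(2), of h] graded_hom_smult[OF hom] A.is_fracD[OF assms(1)] A.is_fracD[OF assms(2)]
      denominators_polys[OF g(1)] by (simp add: polys_mult)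
  then show ?thesis using g(1) unfolding frac_eq_def by blast
qed

lemma sheaf_map_germ:
  assumes P: "P \<in> proj_points n" and f: "is_frac n M P m f"
  shows "(\<Union>(m, f)\<in>germ n M P m f. germ n N P (h m) f) = germ n N P (h m) f"
proof (rule A.UN_germ[OF P f])
  fix m' f' assume f': "is_frac n M P m' f'" "frac_eq n M P m f m' f'"
  show "germ n N P (h m') f' = germ n N P (h m) f"
    by (rule B.germ_eqI[OF P frac_hom[OF f'(1)] frac_hom[OF f] B.frac_eq_sym[OF frac_eq_hom[OF f f']]])
qed

lemma sheaf_map_apply:
  assumes "P \<in> proj_points n" "P \<in> U" "is_frac n M P m f" "s P = germ n M P m f"
  shows "sheaf_map n N h U s P = germ n N P (h m) f"
  using sheaf_map_germ[OF assms(1,3)] assms(2,4) by (simp add: sheaf_map_def)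

lemma sheaf_map_section:
  assumes U: "zariski_open n U" and s: "s \<in> sections n M U"
  shows "sheaf_map n N h U s \<in> sections n N U"
proof (rule sectionsI)
  show "sheaf_map n N h U s \<in> extensional U" by (simp add: sheaf_map_def)
  fix P assume "P \<in> U"
  then obtain V d m f where V: "zariski_open n V" "P \<in> V" "V \<subseteq> U" "d \<in> multidegrees n" "m \<in> component M d"
    "f \<in> component (cox n) d" "\<And>Q. Q \<in> V \<Longrightarrow> f \<notin> Q" "\<And>Q. Q \<in> V \<Longrightarrow> s Q = germ n M Q m f"
    using sectionsE[OF s] by metis
  have "sheaf_map n N h U s Q = germ n N Q (h m) f" if "Q \<in> V" for Q
  proof (rule sheaf_map_apply)
    show "Q \<in> proj_points n" "Q \<in> U" using that V(1,3) zariski_open_points by blast+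
    show "is_frac n M Q m f" using V(4-7) that unfolding is_frac_def by blast
  qed (rule V(8)[OF that])
  then show "\<exists>V d m f. zariski_open n V \<and> P \<in> V \<and> V \<subseteq> U \<and> d \<in> multidegrees n \<and> m \<in> component N d \<and>
      f \<in> component (cox n) d \<and> (\<forall>Q\<in>V. f \<notin> Q \<and> sheaf_map n N h U s Q = germ n N Q m f)"
    using V graded_hom_component[OF hom V(4,5)] by blast
qed

lemma sheaf_map_module_hom:
  assumes U: "zariski_open n U"
  shows "sheaf_map n N h U \<in> module_hom (structure_sheaf n U) (sheaf_of n M U) (sheaf_of n N U)"
  unfolding module_hom_def
proof (intro CollectI conjI ballI funcsetI)
  show "sheaf_map n N h U s \<in> carrier (sheaf_of n N U)" if "s \<in> carrier (sheaf_of n M U)" for s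
    using that sheaf_map_section[OF U] by (simp add: sheaf_of_def)
next
  fix s t assume st: "s \<in> carrier (sheaf_of n M U)" "t \<in> carrier (sheaf_of n M U)"
  show "sheaf_map n N h U (s \<oplus>\<^bsub>sheaf_of n M U\<^esub> t) =
    sheaf_map n N h U s \<oplus>\<^bsub>sheaf_of n N U\<^esub> sheaf_map n N h U t"
  proof (rule extensionalityI[of _ U])
    fix P assume P: "P \<in> U"
    then have PP: "P \<in> proj_points n" using zariski_open_points[OF U] by blast
    obtain m f m' f' where f: "is_frac n M P m f" "s P = germ n M P m f"
      and f': "is_frac n M P m' f'" "t P = germ n M P m' f'"
      using st section_stalk[OF _ P] by (metis (no_types, lifting) sheaf_of_def partial_object.select_convs(1))
    have "sheaf_map n N h U (s \<oplus>\<^bsub>sheaf_of n M U\<^esub> t) P = germ n N P (h (f' \<odot>\<^bsub>M\<^esub> m \<oplus>\<^bsub>M\<^esub> f \<odot>\<^bsub>M\<^esub> m')) (f * f')"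
      using A.germ_add_germ[OF PP f(1) f'(1)] f(2) f'(2) P
      by (intro sheaf_map_apply[OF PP P A.frac_add[OF PP f(1) f'(1)]]) (simp add: sheaf_of_def)
    also have "h (f' \<odot>\<^bsub>M\<^esub> m \<oplus>\<^bsub>M\<^esub> f \<odot>\<^bsub>M\<^esub> m') = f' \<odot>\<^bsub>N\<^esub> h m \<oplus>\<^bsub>N\<^esub> f \<odot>\<^bsub>N\<^esub> h m'"
      using A.is_fracD[OF f(1)] A.is_fracD[OF f'(1)]
      by (simp add: graded_hom_add[OF hom] graded_hom_smult[OF hom] A.sm_closed)
    also have "germ n N P \<dots> (f * f') = germ_add n N P (germ n N P (h m) f) (germ n N P (h m') f')"
      by (rule B.germ_add_germ[OF PP frac_hom[OF f(1)] frac_hom[OF f'(1)], symmetric])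
    also have "\<dots> = (sheaf_map n N h U s \<oplus>\<^bsub>sheaf_of n N U\<^esub> sheaf_map n N h U t) P"
      using sheaf_map_apply[of P U m f s, OF PP P f] sheaf_map_apply[of P U m' f' t, OF PP P f'] P by (simp add: sheaf_of_def)
    finally show "sheaf_map n N h U (s \<oplus>\<^bsub>sheaf_of n M U\<^esub> t) P =
      (sheaf_map n N h U s \<oplus>\<^bsub>sheaf_of n N U\<^esub> sheaf_map n N h U t) P" .
  qed (simp_all add: sheaf_map_def sheaf_of_def)
next
  fix a s assume as: "a \<in> carrier (structure_sheaf n U)" "s \<in> carrier (sheaf_of n M U)"
  then have a: "a \<in> sections n (cox n) U" and s: "s \<in> sections n M U"
    by (simp_all add: structure_sheaf_def sheaf_of_def)
  show "sheaf_map n N h U (a \<odot>\<^bsub>sheaf_of n M U\<^esub> s) = a \<odot>\<^bsub>sheaf_of n N U\<^esub> sheaf_map n N h U s"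
  proof (rule extensionalityI[of _ U])
    fix P assume P: "P \<in> U"
    then have PP: "P \<in> proj_points n" using zariski_open_points[OF U] by blast
    obtain m f where f: "is_frac n M P m f" "s P = germ n M P m f" using section_stalk[OF s P] by blast
    obtain b g where g: "is_frac n (cox n) P b g" "a P = germ n (cox n) P b g" using section_stalk[OF a P] by blast
    have b: "b \<in> polys (variables n)" using g(1) by (auto simp: is_frac_def component_cox)
    have "sheaf_map n N h U (a \<odot>\<^bsub>sheaf_of n M U\<^esub> s) P = germ n N P (h (b \<odot>\<^bsub>M\<^esub> m)) (g * f)"
      using A.germ_smult_germ[OF PP g(1) f(1)] f(2) g(2) P
      by (intro sheaf_map_apply[OF PP P A.frac_smult[OF PP g(1) f(1)]]) (simp add: sheaf_of_def)
    also have "h (b \<odot>\<^bsub>M\<^esub> m) = b \<odot>\<^bsub>N\<^esub> h m"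
      by (rule graded_hom_smult[OF hom b A.is_fracD(1)[OF f(1)]])
    also have "germ n N P \<dots> (g * f) = germ_smult n N P (germ n (cox n) P b g) (germ n N P (h m) f)"
      by (rule B.germ_smult_germ[OF PP g(1) frac_hom[OF f(1)], symmetric])
    also have "\<dots> = (a \<odot>\<^bsub>sheaf_of n N U\<^esub> sheaf_map n N h U s) P"
      using sheaf_map_apply[of P U m f s, OF PP P f] g(2) P by (simp add: sheaf_of_def)
    finally show "sheaf_map n N h U (a \<odot>\<^bsub>sheaf_of n M U\<^esub> s) P = (a \<odot>\<^bsub>sheaf_of n N U\<^esub> sheaf_map n N h U s) P" .
  qed (simp_all add: sheaf_map_def sheaf_of_def)
qed

lemma sheaf_map_morphism: "sheaf_morphism n (sheaf_of n M) (sheaf_of n N) (sheaf_map n N h)"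
  unfolding sheaf_morphism_def
proof (intro conjI allI impI ballI)
  fix U V :: "'k point set" and s assume "zariski_open n U \<and> zariski_open n V \<and> V \<subseteq> U"
  then show "sheaf_map n N h V (restrict s V) = restrict (sheaf_map n N h U s) V"
    by (auto simp: sheaf_map_def restrict_def fun_eq_iff)
qed (rule sheaf_map_module_hom)

text \<open>
  The fraction \<open>y / (u f)\<close> is a preimage of \<open>m / f\<close> where \<open>u\<close> does not vanish.
\<close>

lemma local_preimage:
  assumes V: "zariski_open n V" "P \<in> V" "V \<subseteq> U" "e \<in> multidegrees n" "m \<in> component N e" "f \<in> component (cox n) e"
    "\<And>Q. Q \<in> V \<Longrightarrow> f \<notin> Q" "\<And>Q. Q \<in> V \<Longrightarrow> s Q = germ n N Q m f"
    and u: "d \<in> multidegrees n" "u \<in> component (cox n) d" "u \<notin> P" "y \<in> component M (d + e)" "h y = u \<odot>\<^bsub>N\<^esub> m"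
  shows "\<exists>V. zariski_open n V \<and> P \<in> V \<and> V \<subseteq> U \<and>
    (\<exists>t\<in>carrier (sheaf_of n M V). sheaf_map n N h V t = restrict s V)"
proof -
  define V' where "V' = {Q \<in> V. u \<notin> Q}"
  note up = component_cox_polys[OF u(2)] and fp = component_cox_polys[OF V(6)]
  have V': "zariski_open n V'" "P \<in> V'" "V' \<subseteq> U"
    using zariski_open_nonvanishing[OF V(1) up] u(3) V(2,3) by (auto simp: V'_def)
  have de: "d + e \<in> multidegrees n" by (rule multidegrees_add[OF u(1) V(4)])
  have uf: "u * f \<in> component (cox n) (d + e)" by (rule component_cox_mult[OF u(2) V(6)])
  have Q: "Q \<in> proj_points n" "u * f \<notin> Q" "f \<notin> Q" "is_frac n M Q y (u * f)" "s Q = germ n N Q m f" if "Q \<in> V'" for Q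
  proof -
    show Q: "Q \<in> proj_points n" using zariski_open_points[OF V'(1) that] .
    show f: "f \<notin> Q" and "s Q = germ n N Q m f" using that V(7,8) by (auto simp: V'_def)
    show ufQ: "u * f \<notin> Q" using f that point_mult[OF Q up fp] by (auto simp: V'_def)
    show "is_frac n M Q y (u * f)" unfolding is_frac_def using de uf ufQ u(4) by blast
  qed
  let ?t = "\<lambda>Q\<in>V'. germ n M Q y (u * f)"
  have t: "?t \<in> sections n M V'" by (rule section_fraction[OF V'(1) de u(4) uf Q(2)])
  have "sheaf_map n N h V' ?t = restrict s V'"
  proof (rule extensionalityI[of _ V'])
    fix R assume R: "R \<in> V'"
    have "sheaf_map n N h V' ?t R = germ n N R (h y) (u * f)"
      by (rule sheaf_map_apply[OF Q(1)[OF R] R Q(4)[OF R]]) (simp add: R)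
    also have "\<dots> = germ n N R m f"
    proof (rule B.germ_eqI[OF Q(1)[OF R] frac_hom[OF Q(4)[OF R]]])
      show "is_frac n N R m f" unfolding is_frac_def using V(4-6) Q(3)[OF R] by blast
      have "(1 * f) \<odot>\<^bsub>N\<^esub> h y = (1 * (u * f)) \<odot>\<^bsub>N\<^esub> m"
        unfolding u(5) using up fp B.comp_carrier[OF V(4,5)] by (simp add: B.sm_sm mult.commute)
      then show "frac_eq n N R (h y) (u * f) m f"
        unfolding frac_eq_def using denominators_1[OF Q(1)[OF R]] by blast
    qed
    finally show "sheaf_map n N h V' ?t R = restrict s V' R" using Q(5)[OF R] R by simp
  qed (simp_all add: sheaf_map_def)
  then show ?thesis
    using V' t by (intro exI[of _ V'] conjI bexI[of _ ?t]) (simp_all add: sheaf_of_def)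
qed

text \<open>
  The homomorphism itself need not be surjective: at each point a multiple of \<open>m\<close> by a form that is
  invertible there has to be hit.
\<close>

lemma sheaf_map_surjective:
  assumes hits: "\<And>P e m. P \<in> proj_points n \<Longrightarrow> e \<in> multidegrees n \<Longrightarrow> m \<in> component N e \<Longrightarrow>
    \<exists>d\<in>multidegrees n. \<exists>u\<in>component (cox n) d. u \<notin> P \<and> (\<exists>y\<in>component M (d + e). h y = u \<odot>\<^bsub>N\<^esub> m)"
  shows "sheaf_surjective n (sheaf_of n M) (sheaf_of n N) (sheaf_map n N h)"
  unfolding sheaf_surjective_def in_image_sheaf_def
proof (intro allI impI ballI)
  fix U s P assume U: "zariski_open n U" and s: "s \<in> carrier (sheaf_of n N U)" and P: "P \<in> U"
  from s have s: "s \<in> sections n N U" by (simp add: sheaf_of_def)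
  obtain V e m f where V: "zariski_open n V" "P \<in> V" "V \<subseteq> U" "e \<in> multidegrees n" "m \<in> component N e"
    "f \<in> component (cox n) e" "\<And>Q. Q \<in> V \<Longrightarrow> f \<notin> Q" "\<And>Q. Q \<in> V \<Longrightarrow> s Q = germ n N Q m f"
    using sectionsE[OF s P] by metis
  have PP: "P \<in> proj_points n" using zariski_open_points[OF V(1,2)] .
  obtain d u y where u: "d \<in> multidegrees n" "u \<in> component (cox n) d" "u \<notin> P" "y \<in> component M (d + e)"
    "h y = u \<odot>\<^bsub>N\<^esub> m" using hits[OF PP V(4,5)] by blast
  show "\<exists>V. zariski_open n V \<and> P \<in> V \<and> V \<subseteq> U \<and>
      (\<exists>t\<in>carrier (sheaf_of n M V). sheaf_map n N h V t = restrict s V)"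
    by (rule local_preimage[OF V u])
qed

end

text \<open>
  Localization is exact.  If \<open>y / f\<close> goes to zero at \<open>P\<close>, then \<open>h (u y) = 0\<close> for some form \<open>u\<close> that does not vanish at \<open>P\<close>, and
  \<open>y / f = (u y) / (u f)\<close> comes from a preimage of \<open>u y\<close>.
\<close>

lemma sheaf_map_exact:
  assumes A: "premodule n A" and B: "premodule n B" and C: "premodule n C"
    and g: "g \<in> graded_hom n A B" and h: "h \<in> graded_hom n B C"
    and complex: "\<And>x. x \<in> carrier A \<Longrightarrow> h (g x) = \<zero>\<^bsub>C\<^esub>"
    and exact: "\<And>e y. e \<in> multidegrees n \<Longrightarrow> y \<in> component B e \<Longrightarrow> h y = \<zero>\<^bsub>C\<^esub> \<Longrightarrow> \<exists>x\<in>component A e. g x = y"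
  shows "sheaf_exact n (sheaf_of n A) (sheaf_of n B) (sheaf_of n C) (sheaf_map n B g) (sheaf_map n C h)"
proof -
  interpret A: cox_module n A by standard (rule A)
  interpret B: cox_module n B by standard (rule B)
  interpret C: cox_module n C by standard (rule C)
  interpret G: cox_module_hom n A B g by standard (rule g)
  interpret H: cox_module_hom n B C h by standard (rule h)
  have zero: "is_frac n C P \<zero>\<^bsub>C\<^esub> 1" if "P \<in> proj_points n" for P
    unfolding is_frac_def using multidegrees_0 component_cox_1 point_one[OF that] C.comp_zero by blast
  show ?thesis
    unfolding sheaf_exact_def
  proof (intro allI impI ballI iffI)
    fix U s assume U: "zariski_open n U" and "s \<in> carrier (sheaf_of n B U)"
      and im: "in_image_sheaf n (sheaf_of n A) (sheaf_map n B g) U s"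
    show "sheaf_map n C h U s = \<zero>\<^bsub>sheaf_of n C U\<^esub>"
    proof (rule extensionalityI[of _ U])
      fix P assume P: "P \<in> U"
      then have PP: "P \<in> proj_points n" using zariski_open_points[OF U] by blast
      obtain V t where V: "zariski_open n V" "P \<in> V" "V \<subseteq> U" "t \<in> carrier (sheaf_of n A V)"
        "sheaf_map n B g V t = restrict s V" using im P unfolding in_image_sheaf_def by blast
      have t: "t \<in> sections n A V" using V(4) by (simp add: sheaf_of_def)
      obtain x f where x: "is_frac n A P x f" "t P = germ n A P x f" using section_stalk[OF t V(2)] by blast
      have "s P = germ n B P (g x) f"
        using fun_cong[OF V(5), of P] V(2) G.sheaf_map_apply[of P V x f t, OF PP V(2) x] by simp
      then have "sheaf_map n C h U s P = germ n C P (h (g x)) f"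
        by (rule H.sheaf_map_apply[OF PP P G.frac_hom[OF x(1)]])
      also have "\<dots> = germ n C P \<zero>\<^bsub>C\<^esub> 1"
      proof (rule C.germ_eqI[OF PP H.frac_hom[OF G.frac_hom[OF x(1)]] zero[OF PP]])
        have "h (g x) = \<zero>\<^bsub>C\<^esub>" by (rule complex[OF A.is_fracD(1)[OF x(1)]])
        then have "(1 * 1) \<odot>\<^bsub>C\<^esub> h (g x) = (1 * f) \<odot>\<^bsub>C\<^esub> \<zero>\<^bsub>C\<^esub>"
          using A.is_fracD(2)[OF x(1)] by (simp add: C.sm_zero)
        then show "frac_eq n C P (h (g x)) f \<zero>\<^bsub>C\<^esub> 1"
          unfolding frac_eq_def using denominators_1[OF PP] by blast
      qed
      finally show "sheaf_map n C h U s P = \<zero>\<^bsub>sheaf_of n C U\<^esub> P" using P by (simp add: sheaf_of_def)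
    qed (simp_all add: sheaf_map_def sheaf_of_def)
  next
    fix U s assume U: "zariski_open n U" and "s \<in> carrier (sheaf_of n B U)"
      and z: "sheaf_map n C h U s = \<zero>\<^bsub>sheaf_of n C U\<^esub>"
    then have s: "s \<in> sections n B U" by (simp add: sheaf_of_def)
    show "in_image_sheaf n (sheaf_of n A) (sheaf_map n B g) U s"
      unfolding in_image_sheaf_def
    proof
      fix P assume P: "P \<in> U"
      obtain V e y f where V: "zariski_open n V" "P \<in> V" "V \<subseteq> U" "e \<in> multidegrees n" "y \<in> component B e"
        "f \<in> component (cox n) e" "\<And>Q. Q \<in> V \<Longrightarrow> f \<notin> Q" "\<And>Q. Q \<in> V \<Longrightarrow> s Q = germ n B Q y f"
        using sectionsE[OF s P] by metis
      have PP: "P \<in> proj_points n" using zariski_open_points[OF V(1,2)] .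
      have yf: "is_frac n B P y f" unfolding is_frac_def using V(2,4-7) by blast
      have "germ n C P (h y) f = germ n C P \<zero>\<^bsub>C\<^esub> 1"
        using fun_cong[OF z, of P] P H.sheaf_map_apply[of P U y f s, OF PP P yf V(8)[OF V(2)]]
        by (simp add: sheaf_of_def)
      from C.germ_eqD[OF PP H.frac_hom[OF yf] zero[OF PP] this]
      obtain u where u: "u \<in> denominators n P" "(u * 1) \<odot>\<^bsub>C\<^esub> h y = (u * f) \<odot>\<^bsub>C\<^esub> \<zero>\<^bsub>C\<^esub>"
        by (auto simp: frac_eq_def)
      obtain d where d: "d \<in> multidegrees n" "u \<in> component (cox n) d" "u \<notin> P" using u(1) by (rule denominatorsE)
      note up = component_cox_polys[OF d(2)] and fp = component_cox_polys[OF V(6)]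
      have yc: "y \<in> carrier B" by (rule B.comp_carrier[OF V(4,5)])
      have "h (u \<odot>\<^bsub>B\<^esub> y) = \<zero>\<^bsub>C\<^esub>"
        using u(2) up fp by (simp add: graded_hom_smult[OF h up yc] C.sm_zero polys_mult)
      then obtain x where x: "x \<in> component A (d + e)" "g x = u \<odot>\<^bsub>B\<^esub> y"
        using exact[OF multidegrees_add[OF d(1) V(4)] B.comp_smult[OF d(1) V(4) d(2) V(5)]] by blast
      show "\<exists>V. zariski_open n V \<and> P \<in> V \<and> V \<subseteq> U \<and>
          (\<exists>t\<in>carrier (sheaf_of n A V). sheaf_map n B g V t = restrict s V)"
        by (rule G.local_preimage[OF V d x])
    qed
  qed
qed


section \<open>Graded free modules\<close>

definition free_module :: "nat list \<Rightarrow> nat \<Rightarrow> (nat \<Rightarrow> multidegree) \<Rightarrow> ('k::field cox_poly, 'k vec) graded_module" where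
  "free_module n b t =
     \<lparr>carrier = free (variables n) b, mult = undefined, one = undefined, zero = 0, add = (+), smult = (\<bullet>),
      component = (\<lambda>d. {c \<in> free (variables n) b. part t {d} c = c})\<rparr>"

lemma free_module_simps [simp]:
  "carrier (free_module n b t) = free (variables n) b" "zero (free_module n b t) = 0"
  "add (free_module n b t) = (+)" "smult (free_module n b t) = (\<bullet>)"
  "component (free_module n b t) d = {c \<in> free (variables n) b. part t {d} c = c}"
  by (simp_all add: free_module_def)

lemma free_module_module: "Module.module (cox n) (free_module n b t)"
proof (rule moduleI[OF cring_cox])
  note F = submod_free[of "variables n" b]
  show "abelian_group (free_module n b t)"
  proof (rule abelian_groupI)
    show "\<exists>d\<in>carrier (free_module n b t). d \<oplus>\<^bsub>free_module n b t\<^esub> c = \<zero>\<^bsub>free_module n b t\<^esub>"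
      if "c \<in> carrier (free_module n b t)" for c
      using that submod_uminus[OF F] by (intro bexI[of _ "- c"]) simp_all
  qed (use submod_add[OF F] submod_0[OF F] in \<open>simp_all add: add_ac\<close>)
qed (use submod_smul[OF submod_free[of "variables n" b]] in \<open>simp_all add: smul_distribs smul_smul\<close>)

lemma finsum_free_module:
  assumes "finite A" "\<And>x. x \<in> A \<Longrightarrow> f x \<in> free (variables n) b"
  shows "finsum (free_module n b t) f A = sum f A"
  using assms
proof (induction A rule: finite_induct)
  case empty
  interpret Module.module "cox n" "free_module n b t" by (rule free_module_module)
  show ?case using finsum_empty by simp
next
  case (insert x A)
  interpret Module.module "cox n" "free_module n b t" by (rule free_module_module)
  have "finsum (free_module n b t) f (insert x A) = f x \<oplus>\<^bsub>free_module n b t\<^esub> finsum (free_module n b t) f A"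
    by (rule finsum_insert) (use insert in auto)
  then show ?case using insert by simp
qed

lemma part_single_disjoint: "d \<noteq> e \<Longrightarrow> part s {d} c = c \<Longrightarrow> part s {e} c = 0"
  using part_part[of s "{e}" "{d}" c] by (simp add: part_eq_0_iff)

lemma exponent_degree_multidegrees: "keys \<mu> \<subseteq> variables n \<Longrightarrow> exponent_degree \<mu> \<in> multidegrees n"
  using keys_exponent_degree[of \<mu>] by (fastforce simp: multidegrees_def variables_def)

text \<open>
  Monomials in the variables of the Cox ring have degrees in \<open>\<int>\<^sup>r\<close>, so nothing lives in other degrees.
\<close>

lemma part_outside:
  assumes "\<And>i. t i \<in> multidegrees n" "c \<in> free (variables n) b" "d \<notin> multidegrees n"
  shows "part t {d} c = 0"
  unfolding part_eq_0_iff
proof (intro allI ballI)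
  fix i \<mu> assume "\<mu> \<in> keys (c i)"
  then have "keys \<mu> \<subseteq> variables n" using assms(2) by (auto simp: free_def polys_def)
  then show "exponent_degree \<mu> + t i \<notin> {d}"
    using multidegrees_add[OF exponent_degree_multidegrees assms(1)] assms(3) by auto
qed

lemma free_module_graded:
  assumes t: "\<And>i. t i \<in> multidegrees n"
  shows "graded_module n (free_module n b t)"
  unfolding graded_module_def
proof (intro conjI ballI)
  let ?F = "free_module n b t :: ('a::field cox_poly, 'a vec) graded_module"
  interpret F: Module.module "cox n" ?F by (rule free_module_module)
  note S = submod_free[of "variables n" b]
  show "Module.module (cox n) ?F" by (rule free_module_module)
  show "additive_subgroup (component ?F d) ?F" for d
  proof (rule additive_subgroup.intro, rule subgroup.intro)
    fix x assume x: "x \<in> component ?F d"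
    have "inv\<^bsub>add_monoid ?F\<^esub> x = - x"
      by (rule group.inv_equality[OF F.a_group]) (use x submod_uminus[OF S] in auto)
    moreover have "part t {d} (- x) = - part t {d} x" using part_diff[of t "{d}" 0 x] by simp
    ultimately show "inv\<^bsub>add_monoid ?F\<^esub> x \<in> component ?F d" using x submod_uminus[OF S, of x] by simp
  qed (use submod_add[OF S] submod_0[OF S] in \<open>auto simp: part_add\<close>)
  show "f \<odot>\<^bsub>?F\<^esub> m \<in> component ?F (d + e)" if "f \<in> component (cox n) d" "m \<in> component ?F e" for d e f m
  proof -
    have "part t {d + e} (f \<bullet> m) = f \<bullet> part t {x. d + x \<in> {d + e}} m"
      by (rule part_smul_poly) (use that(1) in \<open>simp add: component_cox\<close>)
    then show ?thesis using that submod_smul[OF S component_cox_polys[OF that(1)], of m] by simp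
  qed
  fix m assume m: "m \<in> carrier ?F"
  then have mv: "m \<in> vecs" using submod_vecs[OF S] by auto
  have pf: "part t {d} m \<in> free (variables n) b" for d using m gradedD[OF graded_free] by simp
  show "\<exists>!c. (\<forall>d\<in>multidegrees n. c d \<in> component ?F d) \<and> (\<forall>d. d \<notin> multidegrees n \<longrightarrow> c d = \<zero>\<^bsub>?F\<^esub>) \<and>
      finite {d. c d \<noteq> \<zero>\<^bsub>?F\<^esub>} \<and> m = (\<Oplus>\<^bsub>?F\<^esub>d\<in>{d. c d \<noteq> \<zero>\<^bsub>?F\<^esub>}. c d)"
  proof (rule ex1I[of _ "\<lambda>d. part t {d} m"], goal_cases)
    case 1
    have sub: "{d. part t {d} m \<noteq> 0} \<subseteq> degs t m"
      by (auto simp: part_eq_0_iff degs_def) (metis keys_zero empty_iff image_eqI)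
    then have fin: "finite {d. part t {d} m \<noteq> 0}" by (rule finite_subset) (rule finite_degs[OF mv])
    have "m = (\<Sum>d\<in>degs t m. part t {d} m)" by (rule vec_eq_sum_parts[OF mv])
    also have "\<dots> = (\<Sum>d\<in>{d. part t {d} m \<noteq> 0}. part t {d} m)"
      by (rule sum.mono_neutral_right[OF finite_degs[OF mv] sub]) auto
    also have "\<dots> = (\<Oplus>\<^bsub>?F\<^esub>d\<in>{d. part t {d} m \<noteq> 0}. part t {d} m)"
      by (rule finsum_free_module[OF fin pf, symmetric])
    finally have "m = (\<Oplus>\<^bsub>?F\<^esub>d\<in>{d. part t {d} m \<noteq> 0}. part t {d} m)" .
    moreover have "part t {d} m = 0" if "d \<notin> multidegrees n" for d
      using m t that by (intro part_outside[of t n m b d]) simp_all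
    ultimately show ?case using fin pf by (simp add: part_part)
  next
    case (2 c)
    then have c: "\<And>d. d \<in> multidegrees n \<Longrightarrow> c d \<in> free (variables n) b \<and> part t {d} (c d) = c d"
      "\<And>d. d \<notin> multidegrees n \<Longrightarrow> c d = 0" and fin: "finite {d. c d \<noteq> 0}"
      and eq: "m = (\<Oplus>\<^bsub>?F\<^esub>d\<in>{d. c d \<noteq> 0}. c d)" by auto
    have cf: "c d \<in> free (variables n) b" "part t {d} (c d) = c d" for d
      using c[of d] submod_0[OF S] by (cases "d \<in> multidegrees n"; simp)+
    have m_sum: "m = (\<Sum>d\<in>{d. c d \<noteq> 0}. c d)" using eq finsum_free_module[OF fin cf(1)] by simp
    show ?case
    proof
      fix d
      have "part t {d} m = (\<Sum>e\<in>{d. c d \<noteq> 0}. part t {d} (c e))" by (subst m_sum) (rule part_sum)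
      also have "\<dots> = (\<Sum>e\<in>{d. c d \<noteq> 0}. if e = d then c d else 0)"
        by (rule sum.cong[OF refl]) (auto simp: cf(2) part_single_disjoint[OF _ cf(2)])
      also have "\<dots> = c d" using fin by (simp add: sum.delta)
      finally show "c d = part t {d} m" ..
    qed
  qed
qed

lemma fg_graded_free_module:
  assumes t: "\<And>i. t i \<in> multidegrees n"
  shows "fg_graded_free n (free_module n b t)"
  unfolding fg_graded_free_def
proof (intro conjI exI)
  let ?F = "free_module n b t :: ('a::field cox_poly, 'a vec) graded_module"
  let ?e = "\<lambda>i. unitv i (1 :: 'a cox_poly)"
  let ?A = "?e ` {..<b}"
  show "graded_module n ?F" by (rule free_module_graded[OF t])
  show "finite ?A" by simp
  have e: "?e i \<in> free (variables n) b" if "i < b" for i using that by (auto simp: free_def unitv_def)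
  have "?e i \<in> component ?F (t i)" if "i < b" for i
    using e[OF that] by (auto simp: part_eq_iff unitv_def)
  then show "?A \<subseteq> homogeneous_elements n ?F" using t unfolding homogeneous_elements_def by blast
  have inj: "inj_on ?e {..<b}"
  proof (rule inj_onI)
    fix i j assume "?e i = ?e j"
    then have "?e i i = ?e j i" by simp
    then show "i = j" by (auto simp: unitv_def split: if_splits)
  qed
  have sum: "(\<Oplus>\<^bsub>?F\<^esub>a\<in>?A. c a \<odot>\<^bsub>?F\<^esub> a) = (\<lambda>j. if j < b then c (?e j) else 0)"
    if c: "c \<in> ?A \<rightarrow>\<^sub>E carrier (cox n)" for c
  proof -
    have "(\<Oplus>\<^bsub>?F\<^esub>a\<in>?A. c a \<odot>\<^bsub>?F\<^esub> a) = (\<Sum>a\<in>?A. c a \<bullet> a)"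
      unfolding free_module_simps
    proof (rule finsum_free_module)
      fix x assume x: "x \<in> ?A"
      then show "c x \<bullet> x \<in> free (variables n) b"
        using c e by (intro submod_smul[OF submod_free]) (auto simp: PiE_iff)
    qed simp
    also have "\<dots> = (\<Sum>i<b. c (?e i) \<bullet> ?e i)" by (simp add: sum.reindex[OF inj])
    also have "\<dots> = (\<lambda>j. if j < b then c (?e j) else 0)"
    proof
      fix j
      have "(\<Sum>i<b. c (?e i) \<bullet> ?e i) j = (\<Sum>i<b. if i = j then c (?e j) else 0)"
        unfolding sum_fun_apply by (rule sum.cong) (auto simp: vec_apply unitv_def)
      then show "(\<Sum>i<b. c (?e i) \<bullet> ?e i) j = (if j < b then c (?e j) else 0)" by simp
    qed
    finally show ?thesis .
  qed
  show "\<forall>m\<in>carrier ?F. \<exists>!c. c \<in> ?A \<rightarrow>\<^sub>E carrier (cox n) \<and> m = (\<Oplus>\<^bsub>?F\<^esub>a\<in>?A. c a \<odot>\<^bsub>?F\<^esub> a)"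
  proof
    fix m assume "m \<in> carrier ?F"
    then have m: "\<And>i. m i \<in> polys (variables n)" "\<And>i. i \<ge> b \<Longrightarrow> m i = 0" by (auto simp: free_def)
    define c0 where "c0 = (\<lambda>a\<in>?A. m (the_inv_into {..<b} ?e a))"
    have c0: "c0 (?e i) = m i" if "i < b" for i
      using that by (simp add: c0_def the_inv_into_f_f[OF inj])
    have c0A: "c0 \<in> ?A \<rightarrow>\<^sub>E carrier (cox n)" using c0 m(1) by (auto simp: c0_def the_inv_into_f_f[OF inj])
    show "\<exists>!c. c \<in> ?A \<rightarrow>\<^sub>E carrier (cox n) \<and> m = (\<Oplus>\<^bsub>?F\<^esub>a\<in>?A. c a \<odot>\<^bsub>?F\<^esub> a)"
    proof (rule ex1I[of _ c0])
      have "m = (\<lambda>j. if j < b then c0 (?e j) else 0)" using c0 m(2) by (auto simp: fun_eq_iff)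
      then show "c0 \<in> ?A \<rightarrow>\<^sub>E carrier (cox n) \<and> m = (\<Oplus>\<^bsub>?F\<^esub>a\<in>?A. c0 a \<odot>\<^bsub>?F\<^esub> a)"
        using sum[OF c0A] c0A by metis
      fix c assume c: "c \<in> ?A \<rightarrow>\<^sub>E carrier (cox n) \<and> m = (\<Oplus>\<^bsub>?F\<^esub>a\<in>?A. c a \<odot>\<^bsub>?F\<^esub> a)"
      have "m = (\<Oplus>\<^bsub>?F\<^esub>a\<in>?A. c a \<odot>\<^bsub>?F\<^esub> a)" by (rule conjunct2[OF c])
      also have "\<dots> = (\<lambda>j. if j < b then c (?e j) else 0)" by (rule sum[OF conjunct1[OF c]])
      finally have "c (?e j) = m j" if "j < b" for j using that by simp
      then show "c = c0" using c0 by (intro PiE_ext[OF conjunct1[OF c] c0A]) auto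
    qed
  qed
qed

text \<open>
  The nested existential quantifiers of a resolution, spread out as sequences of ranks, generators and degrees.
\<close>

lemma has_res_complex:
  assumes "has_res q W s Z K"
  shows "\<exists>b a t. homgens W s Z K (b 0) (a 0) (t 0) \<and>
    (\<forall>p. homgens W (t p) (syz W (b p) (a p) (if p = 0 then K else {0})) {0} (b (Suc p)) (a (Suc p)) (t (Suc p))) \<and>
    (\<forall>p\<ge>q. b p = (0::nat))"
  using assms
proof (induction q arbitrary: s Z K)
  case 0
  have Z: "Z \<subseteq> K" using 0 by (simp add: has_res.simps)
  have "homgens W s Z K 0 (\<lambda>_. 0) s" using Z submod_0[OF submod_free[of W 0]] by (auto simp: homgens_def)
  moreover have "homgens W s (syz W 0 (\<lambda>_. 0) K') {0} 0 (\<lambda>_. 0) s" for K' :: "'a vec set"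
    using submod_0[OF submod_free[of W 0]] by (auto simp: homgens_def syz_def free_def fun_eq_iff vec_apply)
  ultimately show ?case
    by (intro exI[of _ "\<lambda>_. 0"] exI[of _ "\<lambda>_ _. 0"] exI[of _ "\<lambda>_. s"]) simp
next
  case (Suc q)
  then obtain b0 a0 t0 where g: "homgens W s Z K b0 a0 t0" and r: "has_res q W t0 (syz W b0 a0 K) {0}"
    by (auto simp: has_res.simps)
  from Suc.IH[OF r] obtain b a t where *: "homgens W t0 (syz W b0 a0 K) {0} (b 0) (a 0) (t 0)"
    "\<And>p. homgens W (t p) (syz W (b p) (a p) (if p = 0 then {0} else {0})) {0} (b (Suc p)) (a (Suc p)) (t (Suc p))"
    "\<And>p. p \<ge> q \<Longrightarrow> b p = 0" by blast
  have "homgens W (case_nat t0 t p) (syz W (case_nat b0 b p) (case_nat a0 a p) (if p = 0 then K else {0})) {0}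
      (b p) (a p) (t p)" for p
    using *(1,2) by (cases p) simp_all
  moreover have "case_nat b0 b p = 0" if "p \<ge> Suc q" for p using *(3) that by (cases p) auto
  ultimately show ?case using g
    by (intro exI[of _ "case_nat b0 b"] exI[of _ "case_nat a0 a"] exI[of _ "case_nat t0 t"]) simp
qed


section \<open>Presentations by homogeneous generators\<close>

text \<open>
  A homogeneous family \<open>\<mu>\<close> of elements of \<open>M\<close> and the map \<open>\<Phi>\<close> from the free module that it defines.
  The degrees \<open>s i\<close> for \<open>i \<ge> \<beta>\<close> belong to no element; they are kept in \<open>\<int>\<^sup>r\<close>, which spares case distinctions.
\<close>

locale presentation = cox_module n M
  for n and M :: "('k::field cox_poly, 'm) graded_module" (structure) +
  fixes \<beta> :: nat and \<mu> :: "nat \<Rightarrow> 'm" and s :: "nat \<Rightarrow> multidegree"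
  assumes graded_M: "graded_module n M"
    and s: "\<And>i. s i \<in> multidegrees n"
    and \<mu>: "\<And>i. i < \<beta> \<Longrightarrow> \<mu> i \<in> component M (s i)"
begin

abbreviation "R \<equiv> variables n"

definition \<Phi> :: "'k vec \<Rightarrow> 'm" where "\<Phi> c = (\<Oplus>i\<in>{..<\<beta>}. c i \<odot> \<mu> i)"

lemma \<mu>_carrier: "i < \<beta> \<Longrightarrow> \<mu> i \<in> carrier M"
  using comp_carrier[OF s \<mu>] .

lemma term_closed: "c \<in> free R \<beta> \<Longrightarrow> (\<lambda>i. c i \<odot> \<mu> i) \<in> {..<\<beta>} \<rightarrow> carrier M"
  by (auto simp: free_def intro!: sm_closed \<mu>_carrier)

lemma \<Phi>_closed: "c \<in> free R \<beta> \<Longrightarrow> \<Phi> c \<in> carrier M"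
  unfolding \<Phi>_def by (rule M.finsum_closed[OF term_closed])

lemma \<Phi>_add:
  assumes "c \<in> free R \<beta>" "d \<in> free R \<beta>" shows "\<Phi> (c + d) = \<Phi> c \<oplus> \<Phi> d"
proof -
  have "\<Phi> (c + d) = (\<Oplus>i\<in>{..<\<beta>}. c i \<odot> \<mu> i \<oplus> d i \<odot> \<mu> i)"
    unfolding \<Phi>_def
  proof (rule M.finsum_cong'[OF refl])
    show "(\<lambda>i. c i \<odot> \<mu> i \<oplus> d i \<odot> \<mu> i) \<in> {..<\<beta>} \<rightarrow> carrier M"
      using term_closed[OF assms(1)] term_closed[OF assms(2)] by (auto simp: Pi_iff)
    show "(c + d) i \<odot> \<mu> i = c i \<odot> \<mu> i \<oplus> d i \<odot> \<mu> i" if "i \<in> {..<\<beta>}" for i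
      using that assms \<mu>_carrier[of i] by (simp add: vec_apply free_def sm_add_left)
  qed
  also have "\<dots> = \<Phi> c \<oplus> \<Phi> d"
    unfolding \<Phi>_def by (rule M.finsum_addf[OF term_closed[OF assms(1)] term_closed[OF assms(2)]])
  finally show ?thesis .
qed

lemma \<Phi>_smul:
  assumes f: "f \<in> polys R" and c: "c \<in> free R \<beta>" shows "\<Phi> (f \<bullet> c) = f \<odot> \<Phi> c"
proof -
  have "f \<odot> \<Phi> c = (\<Oplus>i\<in>{..<\<beta>}. f \<odot> (c i \<odot> \<mu> i))"
    unfolding \<Phi>_def using f by (intro finsum_smult_ldistr term_closed[OF c]) simp_all
  also have "\<dots> = \<Phi> (f \<bullet> c)"
    unfolding \<Phi>_def
  proof (rule M.finsum_cong'[OF refl])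
    show "(\<lambda>i. (f \<bullet> c) i \<odot> \<mu> i) \<in> {..<\<beta>} \<rightarrow> carrier M"
      by (rule term_closed[OF submod_smul[OF submod_free f c]])
    show "f \<odot> (c i \<odot> \<mu> i) = (f \<bullet> c) i \<odot> \<mu> i" if "i \<in> {..<\<beta>}" for i
      using that f c \<mu>_carrier[of i] by (simp add: vec_apply free_def sm_sm)
  qed
  finally show ?thesis ..
qed

lemma \<Phi>_0: "\<Phi> 0 = \<zero>"
  using \<Phi>_smul[of 0 0] submod_0[OF submod_free, of R \<beta>] \<Phi>_closed[of 0] by (simp add: sm_zero_left)

lemma \<Phi>_unitv:
  assumes "i < \<beta>" shows "\<Phi> (unitv i 1) = \<mu> i"
proof -
  have "\<Phi> (unitv i 1) = (\<Oplus>j\<in>{..<\<beta>}. if i = j then \<mu> j else \<zero>)"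
    unfolding \<Phi>_def
    by (rule M.finsum_cong') (auto simp: unitv_def sm_one sm_zero_left \<mu>_carrier)
  also have "\<dots> = \<mu> i"
    using assms \<mu>_carrier by (intro M.finsum_singleton) auto
  finally show ?thesis .
qed

lemma \<Phi>_sum: "finite A \<Longrightarrow> (\<And>x. x \<in> A \<Longrightarrow> f x \<in> free R \<beta>) \<Longrightarrow> \<Phi> (\<Sum>x\<in>A. f x) = (\<Oplus>x\<in>A. \<Phi> (f x))"
proof (induction A rule: finite_induct)
  case (insert x A)
  have "\<Phi> (\<Sum>x\<in>insert x A. f x) = \<Phi> (f x) \<oplus> \<Phi> (\<Sum>x\<in>A. f x)"
    using insert by (simp add: \<Phi>_add submod_sum[OF submod_free])
  also have "\<dots> = (\<Oplus>x\<in>insert x A. \<Phi> (f x))"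
    using insert \<Phi>_closed by (subst M.finsum_insert) auto
  finally show ?case .
qed (simp add: \<Phi>_0)

lemma \<Phi>_component:
  assumes d: "d \<in> multidegrees n" and c: "c \<in> free R \<beta>" "part s {d} c = c"
  shows "\<Phi> c \<in> component M d"
proof -
  interpret H: additive_subgroup "component M d" M by (rule comp_subgroup[OF d])
  have tm: "c i \<odot> \<mu> i \<in> component M d" if "i < \<beta>" for i
  proof -
    have "\<forall>\<nu>\<in>keys (c i). exponent_degree \<nu> = d - s i" using c(2) by (auto simp: part_eq_iff algebra_simps eq_diff_eq)
    then have "c i \<in> component (cox n) (d - s i)" using c(1) by (auto simp: component_cox free_def)
    moreover have "d - s i \<in> multidegrees n" using d s[of i]
      by (auto simp: multidegrees_def in_keys_iff lookup_minus subset_eq)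
    ultimately have "c i \<odot> \<mu> i \<in> component M (d - s i + s i)" using s \<mu>[OF that] by (intro comp_smult)
    then show ?thesis by simp
  qed
  have "(\<Oplus>i\<in>A. c i \<odot> \<mu> i) \<in> component M d" if "finite A" "\<And>i. i \<in> A \<Longrightarrow> c i \<odot> \<mu> i \<in> component M d" for A
    using that
  proof (induction A rule: finite_induct)
    case (insert i A)
    have "(\<Oplus>i\<in>insert i A. c i \<odot> \<mu> i) = c i \<odot> \<mu> i \<oplus> (\<Oplus>i\<in>A. c i \<odot> \<mu> i)"
      using insert comp_carrier[OF d] by (intro M.finsum_insert) auto
    then show ?case using insert comp_add[OF d] by simp
  qed (simp add: comp_zero[OF d])
  then show ?thesis unfolding \<Phi>_def using tm by blast
qed

lemma finsum_image:
  assumes "finite B" "\<And>i. i \<in> B \<Longrightarrow> f i \<in> \<Phi> ` free R \<beta>"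
  shows "(\<Oplus>i\<in>B. f i) \<in> \<Phi> ` free R \<beta>"
proof -
  obtain g where g: "\<And>i. i \<in> B \<Longrightarrow> g i \<in> free R \<beta>" "\<And>i. i \<in> B \<Longrightarrow> f i = \<Phi> (g i)"
  proof -
    have "\<forall>i\<in>B. \<exists>x. x \<in> free R \<beta> \<and> f i = \<Phi> x" using assms(2) by (auto simp: image_iff Bex_def)
    from bchoice[OF this] show ?thesis using that by blast
  qed
  have "(\<Oplus>i\<in>B. f i) = (\<Oplus>i\<in>B. \<Phi> (g i))"
    using g \<Phi>_closed by (intro M.finsum_cong') auto
  also have "\<dots> = \<Phi> (\<Sum>i\<in>B. g i)" by (rule \<Phi>_sum[OF assms(1) g(1), symmetric])
  finally have eq: "(\<Oplus>i\<in>B. f i) = \<Phi> (\<Sum>i\<in>B. g i)" .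
  show ?thesis unfolding eq by (rule imageI[OF submod_sum[OF submod_free g(1)]])
qed

text \<open>
  Both \<open>d \<mapsto> \<Phi> (c\<^sub>d)\<close> and the family concentrated in degree \<open>e\<close> with value \<open>\<Phi> c\<close> are decompositions of \<open>\<Phi> c\<close> into
  homogeneous components, so they agree.
\<close>

lemma \<Phi>_part:
  assumes e: "e \<in> multidegrees n" and c: "c \<in> free R \<beta>" and m: "\<Phi> c \<in> component M e"
  shows "\<Phi> (part s {e} c) = \<Phi> c"
proof -
  define dec where "dec x \<longleftrightarrow>
      (\<forall>d\<in>multidegrees n. x d \<in> component M d) \<and> (\<forall>d. d \<notin> multidegrees n \<longrightarrow> x d = \<zero>) \<and>
      finite {d. x d \<noteq> \<zero>} \<and> \<Phi> c = (\<Oplus>d\<in>{d. x d \<noteq> \<zero>}. x d)" for x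
  have uniq: "\<exists>!x. dec x"
    using graded_M \<Phi>_closed[OF c] unfolding graded_module_def dec_def by blast
  have cv: "c \<in> vecs" using c submod_vecs[OF submod_free] by auto
  have pf: "part s {d} c \<in> free R \<beta>" for d by (rule gradedD[OF graded_free c])
  have D1: "dec (\<lambda>d. \<Phi> (part s {d} c))"
    unfolding dec_def
  proof (intro conjI ballI allI impI)
    show "\<Phi> (part s {d} c) \<in> component M d" if "d \<in> multidegrees n" for d
      by (rule \<Phi>_component[OF that pf]) (simp add: part_part)
    show "\<Phi> (part s {d} c) = \<zero>" if "d \<notin> multidegrees n" for d
      using part_outside[OF s c that] \<Phi>_0 by simp
    have out: "part s {d} c = 0" if "d \<notin> degs s c" for d
    proof -
      have "part s {d} c = part s ({d} \<inter> degs s c) c" by (metis part_degs part_part)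
      then show ?thesis using that by (simp add: part_eq_0_iff)
    qed
    have sub: "{d. \<Phi> (part s {d} c) \<noteq> \<zero>} \<subseteq> degs s c"
    proof
      fix d assume "d \<in> {d. \<Phi> (part s {d} c) \<noteq> \<zero>}"
      then show "d \<in> degs s c" using out[of d] \<Phi>_0 by (cases "d \<in> degs s c") simp_all
    qed
    show "finite {d. \<Phi> (part s {d} c) \<noteq> \<zero>}" by (rule finite_subset[OF sub finite_degs[OF cv]])
    have "\<Phi> c = \<Phi> (\<Sum>d\<in>degs s c. part s {d} c)"
      by (rule arg_cong[OF vec_eq_sum_parts[OF cv]])
    also have "\<dots> = (\<Oplus>d\<in>degs s c. \<Phi> (part s {d} c))"
      by (rule \<Phi>_sum[OF finite_degs[OF cv] pf])
    also have "\<dots> = (\<Oplus>d\<in>{d. \<Phi> (part s {d} c) \<noteq> \<zero>}. \<Phi> (part s {d} c))"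
      using \<Phi>_closed[OF pf] sub
      by (intro M.add.finprod_mono_neutral_cong_right[OF finite_degs[OF cv]]) auto
    finally show "\<Phi> c = (\<Oplus>d\<in>{d. \<Phi> (part s {d} c) \<noteq> \<zero>}. \<Phi> (part s {d} c))" .
  qed
  have D2: "dec (\<lambda>d. if d = e then \<Phi> c else \<zero>)"
  proof (cases "\<Phi> c = \<zero>")
    case True
    then show ?thesis using comp_zero by (simp add: dec_def)
  next
    case False
    then have "{d. (if d = e then \<Phi> c else \<zero>) \<noteq> \<zero>} = {e}" by auto
    moreover have "(\<Oplus>d\<in>{e}. if d = e then \<Phi> c else \<zero>) = \<Phi> c" using \<Phi>_closed[OF c] by simp
    ultimately show ?thesis using comp_zero m e by (auto simp: dec_def)
  qed
  have "(\<lambda>d. \<Phi> (part s {d} c)) = (\<lambda>d. if d = e then \<Phi> c else \<zero>)"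
  proof -
    obtain x where "\<And>y. dec y \<Longrightarrow> y = x" using uniq by (auto elim: ex1E)
    from this[OF D1] this[OF D2] show ?thesis by (rule trans[OF _ sym])
  qed
  from fun_cong[OF this, of e] show ?thesis by simp
qed

definition Ker :: "'k vec set" where "Ker = {c \<in> free R \<beta>. \<Phi> c = \<zero>}"

lemma submod_Ker: "submod R Ker"
  unfolding submod_def
proof (intro conjI ballI)
  have F: "submod R (free R \<beta> :: 'k vec set)" by (rule submod_free)
  show "Ker \<subseteq> vecs" using submod_vecs[OF F] by (auto simp: Ker_def)
  show "0 \<in> Ker" using submod_0[OF F] \<Phi>_0 by (simp add: Ker_def)
  show "c + d \<in> Ker" if "c \<in> Ker" "d \<in> Ker" for c d
    using that submod_add[OF F] by (simp add: Ker_def \<Phi>_add)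
  show "f \<bullet> c \<in> Ker" if "f \<in> polys R" "c \<in> Ker" for f c
    using that submod_smul[OF F] by (simp add: Ker_def \<Phi>_smul sm_zero)
qed

text \<open>
  Zero is homogeneous of every degree, so \<open>\<Phi>\<close> kills each homogeneous part of an element that it kills.
\<close>

lemma graded_Ker: "graded s Ker"
  unfolding graded_def
proof (intro ballI allI)
  fix c D assume "c \<in> Ker"
  then have c: "c \<in> free R \<beta>" "\<Phi> c = \<zero>" by (auto simp: Ker_def)
  have cv: "c \<in> vecs" using c submod_vecs[OF submod_free] by auto
  have pf: "part s E c \<in> free R \<beta>" for E by (rule gradedD[OF graded_free c(1)])
  have "\<Phi> (part s {d} c) = \<zero>" for d
  proof (cases "d \<in> multidegrees n")
    case True
    have "\<Phi> c \<in> component M d" unfolding c(2) by (rule comp_zero[OF True])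
    then show ?thesis using \<Phi>_part[OF True c(1)] c(2) by simp
  next
    case False
    then show ?thesis using part_outside[OF s c(1)] \<Phi>_0 by simp
  qed
  moreover have "part s D c = part s (D \<inter> degs s c) c" by (metis part_degs part_part)
  then have "part s D c = (\<Sum>d\<in>D \<inter> degs s c. part s {d} c)"
    using part_finite[of "D \<inter> degs s c" s c] finite_degs[OF cv] by simp
  ultimately have "\<Phi> (part s D c) = \<zero>"
    using \<Phi>_sum[of "D \<inter> degs s c" "\<lambda>d. part s {d} c"] pf finite_degs[OF cv] by simp
  then show "part s D c \<in> Ker" using pf by (simp add: Ker_def)
qed

lemma graded_pair_presentation: "graded_pair R s (free R \<beta>) Ker"
  unfolding graded_pair_def fg_def
proof (intro conjI exI)
  let ?A = "(\<lambda>i. unitv i 1) ` {..<\<beta>}"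
  show "?A \<subseteq> free R \<beta>" by (auto simp: free_def unitv_def)
  have S: "submod R (mspan R (?A \<union> Ker))"
    using submod_vecs[OF submod_free, of R \<beta>] \<open>?A \<subseteq> free R \<beta>\<close> by (intro submod_mspan) (auto simp: Ker_def)
  show "free R \<beta> \<subseteq> mspan R (?A \<union> Ker)"
  proof
    fix c :: "'k vec" assume c: "c \<in> free R \<beta>"
    have "c = (\<Sum>i<\<beta>. c i \<bullet> unitv i 1)"
    proof
      fix j
      have "(\<Sum>i<\<beta>. c i \<bullet> unitv i 1) j = (\<Sum>i<\<beta>. if i = j then c j else 0)"
        unfolding sum_fun_apply by (rule sum.cong) (auto simp: vec_apply unitv_def)
      then show "c j = (\<Sum>i<\<beta>. c i \<bullet> unitv i 1) j" using c by (simp add: free_def)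
    qed
    also have "\<dots> \<in> mspan R (?A \<union> Ker)"
      using c by (intro submod_sum[OF S] mspan_smul mspan_base) (auto simp: free_def)
    finally show "c \<in> mspan R (?A \<union> Ker)" .
  qed
qed (use submod_free graded_free submod_Ker graded_Ker in \<open>auto simp: Ker_def\<close>)

end

text \<open>
  The homogeneous components of finitely many generators are finitely many homogeneous generators.
\<close>

lemma homogeneous_presentation:
  fixes M :: "('k::field cox_poly, 'm) graded_module"
  assumes M: "graded_module n M" and fin: "finitely_generated (cox n) M"
  obtains \<beta> \<mu> s where "presentation n M \<beta> \<mu> s"
    and "carrier M \<subseteq> presentation.\<Phi> M \<beta> \<mu> ` free (variables n) \<beta>"
proof -
  interpret M: cox_module n M by standard (rule graded_module_premodule[OF M])
  obtain A where A: "finite A" "A \<subseteq> carrier M"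
    and gen: "\<And>m. m \<in> carrier M \<Longrightarrow> \<exists>c\<in>A \<rightarrow> carrier (cox n). m = (\<Oplus>\<^bsub>M\<^esub>a\<in>A. c a \<odot>\<^bsub>M\<^esub> a)"
    using fin unfolding finitely_generated_def by blast
  define dec where "dec a x \<longleftrightarrow>
      (\<forall>d\<in>multidegrees n. x d \<in> component M d) \<and> (\<forall>d. d \<notin> multidegrees n \<longrightarrow> x d = \<zero>\<^bsub>M\<^esub>) \<and>
      finite {d. x d \<noteq> \<zero>\<^bsub>M\<^esub>} \<and> a = (\<Oplus>\<^bsub>M\<^esub>d\<in>{d. x d \<noteq> \<zero>\<^bsub>M\<^esub>}. x d)" for a x
  have "\<forall>a\<in>A. \<exists>x. dec a x"
    using M A(2) unfolding graded_module_def dec_def by blast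
  from bchoice[OF this] obtain x where dec: "\<And>a. a \<in> A \<Longrightarrow> dec a (x a)" by blast
  have x: "x a d \<in> component M d" if "a \<in> A" "d \<in> multidegrees n" for a d
    using dec[OF that(1)] that(2) by (simp add: dec_def)
  have x0: "x a d = \<zero>\<^bsub>M\<^esub>" if "a \<in> A" "d \<notin> multidegrees n" for a d
    using dec[OF that(1)] that(2) by (simp add: dec_def)
  have xfin: "finite {d. x a d \<noteq> \<zero>\<^bsub>M\<^esub>}" if "a \<in> A" for a
    using dec[OF that] by (simp add: dec_def)
  have xsum: "a = (\<Oplus>\<^bsub>M\<^esub>d\<in>{d. x a d \<noteq> \<zero>\<^bsub>M\<^esub>}. x a d)" if "a \<in> A" for a
    using dec[OF that] unfolding dec_def by blast
  define G where "G = (\<Union>a\<in>A. x a ` {d. x a d \<noteq> \<zero>\<^bsub>M\<^esub>})"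
  have finG: "finite G" using A(1) xfin by (auto simp: G_def)
  have hG: "\<exists>d\<in>multidegrees n. y \<in> component M d" if y: "y \<in> G" for y
  proof -
    obtain a d where "a \<in> A" "x a d \<noteq> \<zero>\<^bsub>M\<^esub>" "y = x a d" using y by (auto simp: G_def)
    then show ?thesis using x x0 by blast
  qed
  obtain t where t: "\<And>y. y \<in> G \<Longrightarrow> t y \<in> multidegrees n" "\<And>y. y \<in> G \<Longrightarrow> y \<in> component M (t y)"
    using hG by metis
  obtain \<mu> where "bij_betw \<mu> {0..<card G} G" using ex_bij_betw_nat_finite[OF finG] by auto
  then have \<mu>: "\<mu> ` {..<card G} = G" by (simp add: bij_betw_def atLeast0LessThan)
  define s where "s i = (if i < card G then t (\<mu> i) else 0)" for i
  have pres: "presentation n M (card G) \<mu> s"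
  proof (intro presentation.intro presentation_axioms.intro)
    show "s i \<in> multidegrees n" for i using \<mu> t(1)[of "\<mu> i"] multidegrees_0 by (auto simp: s_def)
    show "\<mu> i \<in> component M (s i)" if "i < card G" for i using \<mu> t(2)[of "\<mu> i"] that by (auto simp: s_def)
  qed (rule M.cox_module_axioms M)+
  interpret P: presentation n M "card G" \<mu> s by (rule pres)
  let ?I = "P.\<Phi> ` free (variables n) (card G)"
  have F: "submod (variables n) (free (variables n) (card G) :: 'k vec set)" by (rule submod_free)
  have Ismult: "f \<odot>\<^bsub>M\<^esub> y \<in> ?I" if "f \<in> polys (variables n)" "y \<in> ?I" for f y
    using that P.\<Phi>_smul submod_smul[OF F] by force
  have "G \<subseteq> ?I"
  proof
    fix y assume "y \<in> G"
    then obtain i where i: "i < card G" "y = \<mu> i" using \<mu> by auto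
    have "unitv i 1 \<in> free (variables n) (card G)" using i by (auto simp: free_def unitv_def)
    then show "y \<in> ?I" using P.\<Phi>_unitv[OF i(1)] i(2) by force
  qed
  have AI: "a \<in> ?I" if a: "a \<in> A" for a
  proof (subst xsum[OF a], rule P.finsum_image[OF xfin[OF a]])
    fix d assume "d \<in> {d. x a d \<noteq> \<zero>\<^bsub>M\<^esub>}"
    then have "x a d \<in> G" using a by (auto simp: G_def)
    then show "x a d \<in> ?I" using \<open>G \<subseteq> ?I\<close> by blast
  qed
  have "m \<in> ?I" if m: "m \<in> carrier M" for m
  proof -
    obtain c where c: "c \<in> A \<rightarrow> carrier (cox n)" "m = (\<Oplus>\<^bsub>M\<^esub>a\<in>A. c a \<odot>\<^bsub>M\<^esub> a)" using gen[OF m] by blast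
    show ?thesis unfolding c(2)
      by (rule P.finsum_image[OF A(1)], rule Ismult) (use c(1) AI in auto)
  qed
  then show ?thesis using that[OF pres] by blast
qed


section \<open>The virtual resolution of a truncation\<close>

lemma variables_X: "g < length n \<Longrightarrow> j \<le> n ! g \<Longrightarrow> X (g, j) \<in> polys (variables n)"
  by (rule polys_X) (simp add: variables_def)

text \<open>
  Otherwise the point would contain one of the ideals whose intersection is the irrelevant ideal.
\<close>

lemma point_variable:
  assumes P: "P \<in> proj_points n" and g: "g < length n"
  obtains j where "j \<le> n ! g" "X (g, j) \<notin> P"
proof -
  have "\<exists>j\<le>n ! g. X (g, j) \<notin> P"
  proof (rule ccontr)
    assume "\<not> (\<exists>j\<le>n ! g. X (g, j) \<notin> P)"
    then have "{var g j | j. j \<le> n ! g} \<subseteq> P" by (auto simp: var_eq_X)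
    moreover have "ideal P (cox n)" by (rule primeideal.axioms(1)[OF proj_pointsD(1)[OF P]])
    ultimately have "genideal (cox n) {var g j | j. j \<le> n ! g} \<subseteq> P"
      using ring.genideal_minimal[OF cring.axioms(1)[OF cring_cox]] by blast
    moreover have "irrelevant_ideal n \<subseteq> genideal (cox n) {var g j | j. j \<le> n ! g}"
      using g by (auto simp: irrelevant_ideal_def)
    ultimately show False using proj_pointsD(2)[OF P] by blast
  qed
  then show ?thesis using that by blast
qed

text \<open>
  A product of powers of variables, one from each factor, that do not vanish at the point.
\<close>

lemma nonvanishing_form:
  assumes P: "P \<in> proj_points n" and "set gs \<subseteq> {..<length n}"
  shows "\<exists>D\<in>multidegrees n. \<exists>u\<in>component (cox n) D. u \<notin> P \<and> (\<forall>g. 0 \<le> lookup D g) \<and> (\<forall>g\<in>set gs. N g \<le> lookup D g)"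
  using assms(2)
proof (induction gs)
  case Nil
  show ?case using component_cox_1 multidegrees_0 point_one[OF P]
    by (intro bexI[of _ 0] bexI[of _ 1]) simp_all
next
  case (Cons g gs)
  then obtain D u where D: "D \<in> multidegrees n" "u \<in> component (cox n) D" "u \<notin> P" "\<And>g. 0 \<le> lookup D g"
    "\<And>g. g \<in> set gs \<Longrightarrow> N g \<le> lookup D g" by auto
  have g: "g < length n" using Cons.prems by simp
  obtain j where j: "j \<le> n ! g" "X (g, j) \<notin> P" by (rule point_variable[OF P g])
  let ?k = "nat (N g)"
  let ?D = "single g (int ?k) :: multidegree"
  have "?D \<in> multidegrees n" using g by (simp add: multidegrees_def)
  moreover have "X (g, j) ^ ?k \<in> component (cox n) ?D"
    using polys_power[OF variables_X[OF g j(1)]] by (simp add: component_cox X_power)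
  moreover have "X (g, j) ^ k \<notin> P" for k
  proof (induction k)
    case 0 show ?case using point_one[OF P] by simp
  next
    case (Suc k)
    then show ?case
      using j(2) point_mult[OF P variables_X[OF g j(1)] polys_power[OF variables_X[OF g j(1)]]] by simp
  qed
  ultimately have *: "?D + D \<in> multidegrees n" "X (g, j) ^ ?k * u \<in> component (cox n) (?D + D)"
    "X (g, j) ^ ?k * u \<notin> P"
    using D(1-3) point_mult[OF P polys_power[OF variables_X[OF g j(1)]] component_cox_polys[OF D(2)]]
    by (auto intro: multidegrees_add component_cox_mult)
  have "0 \<le> lookup (?D + D) h" for h using D(4)[of h] by (simp add: lookup_add lookup_single when_def)
  moreover have "N h \<le> lookup (?D + D) h" if "h \<in> set (g # gs)" for h
  proof (cases "h = g")
    case True then show ?thesis using D(4)[of g] by (simp add: lookup_add)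
  next
    case False then show ?thesis using D(5)[of h] that by (simp add: lookup_add lookup_single when_def)
  qed
  ultimately show ?case using * by blast
qed

text \<open>
  The degree of a generator that is zero is arbitrary, so it may lie outside \<open>\<int>\<^sup>r\<close>.  Trimming all
  degrees of a resolution repairs this and preserves homogeneity (\<open>part_trim\<close>).
\<close>

definition trim :: "nat list \<Rightarrow> multidegree \<Rightarrow> multidegree" where
  "trim n e = filter_terms (\<lambda>g. g < length n) e"

lemma trim_multidegrees: "trim n e \<in> multidegrees n"
  by (auto simp: trim_def multidegrees_def keys_filter_terms)

lemma trim_add: "trim n (d + e) = trim n d + trim n e"
  by (simp add: trim_def filter_terms_add)

lemma trim_id: "e \<in> multidegrees n \<Longrightarrow> trim n e = e"
  by (auto simp: trim_def filter_terms_eq_iff multidegrees_def)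

lemma part_trim:
  assumes "c \<in> free (variables n) b" "part s {e} c = c"
  shows "part (\<lambda>i. trim n (s i)) {trim n e} c = c"
  unfolding part_eq_iff
proof (intro allI ballI)
  fix i \<mu> assume \<mu>: "\<mu> \<in> keys (c i)"
  then have "exponent_degree \<mu> + s i = e" using assms(2) by (auto simp: part_eq_iff)
  moreover have "keys \<mu> \<subseteq> variables n" using assms(1) \<mu> by (auto simp: free_def polys_def)
  ultimately show "exponent_degree \<mu> + trim n (s i) \<in> {trim n e}"
    using trim_add[of n "exponent_degree \<mu>" "s i"] trim_id[OF exponent_degree_multidegrees] by simp
qed

lemma lincomb_graded_hom:
  assumes a: "\<And>i. i < b' \<Longrightarrow> a i \<in> free (variables n) b" "\<And>i. i < b' \<Longrightarrow> part t {t' i} (a i) = a i"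
  shows "(\<lambda>c. lincomb b' c a) \<in> graded_hom n (free_module n b' t') (free_module n b t)"
proof -
  have mem: "lincomb b' c a \<in> free (variables n) b" if "c \<in> free (variables n) b'" for c
    by (rule lincomb_mem[OF submod_free a(1) that])
  have "part t {d} (lincomb b' c a) = lincomb b' c a" if "part t' {d} c = c" for c d
    using lincomb_part[of b' t t' a "{d}" c] a(2) that by simp
  then show ?thesis using mem
    by (auto simp: graded_hom_def module_hom_def lincomb_add lincomb_smul)
qed

context presentation
begin

text \<open>
  The resolution of the truncation is exact as a complex of modules, and so as a complex of sheaves.
  The augmentation \<open>h\<close> to \<open>M\<close> has the truncation as its image; every homogeneous \<open>m\<close> is moved into it
  by a form \<open>u\<close> that does not vanish at a given point, which is what surjectivity on sheaves requires.
\<close>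

lemma virtual_resolution_of_truncation:
  assumes onto: "carrier M \<subseteq> \<Phi> ` free R \<beta>"
    and r: "has_res (Suc N) R s (trunc [0..<length n] d s (free R \<beta>)) Ker"
  shows "\<exists>(F :: nat \<Rightarrow> ('k cox_poly, 'k vec) graded_module) \<delta>.
    virtual_resolution n M F \<delta> \<and> complex_length F \<le> enat N"
proof -
  let ?Z = "trunc [0..<length n] d s (free R \<beta>)"
  have FR: "submod R (free R b :: 'k vec set)" for b by (rule submod_free)
  obtain b a t where g0: "homgens R s ?Z Ker (b 0) (a 0) (t 0)"
    and gp: "\<And>p. homgens R (t p) (syz R (b p) (a p) (if p = 0 then Ker else {0})) {0} (b (Suc p)) (a (Suc p)) (t (Suc p))"
    and b0: "\<And>p. p \<ge> Suc N \<Longrightarrow> b p = 0"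
    using has_res_complex[OF r] by auto
  define t' where "t' p i = trim n (t p i)" for p i
  have t': "t' p i \<in> multidegrees n" for p i by (simp add: t'_def trim_multidegrees)
  have s': "trim n (s i) = s i" for i by (rule trim_id[OF s])
  \<comment> \<open>the terms and maps of the resolution, and the augmentation\<close>
  define F where "F p = (free_module n (b p) (t' p) :: ('k cox_poly, 'k vec) graded_module)" for p
  define \<delta> where "\<delta> p c = lincomb (b (Suc p)) c (a (Suc p))" for p and c :: "'k vec"
  define h where "h c = \<Phi> (lincomb (b 0) c (a 0))" for c
  define Kp where "Kp p = (if p = 0 then Ker else {0})" for p :: nat
  have Kp: "submod R (Kp p)" for p by (simp add: Kp_def submod_Ker submod_singleton_0)
  note gpD = homgensD[OF gp, folded Kp_def] and g0D = homgensD[OF g0]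
  have a0: "a 0 i \<in> free R \<beta>" if "i < b 0" for i using g0D(1)[OF that] in_degs_subset by blast
  have ap: "a (Suc p) i \<in> free R (b p)" if "i < b (Suc p)" for p i using gpD(1)[OF that] by (simp add: syz_def)
  have a0d: "part s {t' 0 i} (a 0 i) = a 0 i" if "i < b 0" for i
    using part_trim[OF a0[OF that] g0D(2)[OF that]] by (simp add: t'_def s')
  have apd: "part (t' p) {t' (Suc p) i} (a (Suc p) i) = a (Suc p) i" if "i < b (Suc p)" for p i
    using part_trim[OF ap[OF that] gpD(2)[OF that]] by (simp add: t'_def[abs_def])
  have \<delta>_hom: "\<delta> p \<in> graded_hom n (F (Suc p)) (F p)" for p
    unfolding \<delta>_def[abs_def] F_def by (rule lincomb_graded_hom[OF ap apd])
  have free_F: "fg_graded_free n (F p)" for p unfolding F_def by (rule fg_graded_free_module[OF t'])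
  have pre_F: "premodule n (F p)" for p
    using free_F[of p] graded_module_premodule by (auto simp: fg_graded_free_def)
  have \<delta>_syz: "\<delta> p x \<in> syz R (b p) (a p) (Kp p)" if "x \<in> free R (b (Suc p))" for p x
    unfolding \<delta>_def by (rule lincomb_mem[OF submod_syz[OF Kp] gpD(1) that])
  have \<delta>\<delta>: "\<delta> p (\<delta> (Suc p) x) = 0" if "x \<in> free R (b (Suc (Suc p)))" for p x
    using \<delta>_syz[OF that] by (simp add: syz_def Kp_def \<delta>_def[of p])
  have exact: "\<exists>x\<in>component (F (Suc p)) e. \<delta> p x = y"
    if y: "y \<in> component (F p) e" "y \<in> syz R (b p) (a p) (Kp p)" for p e y
  proof -
    obtain x where x: "x \<in> free R (b (Suc p))" "y = lincomb (b (Suc p)) x (a (Suc p))"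
      using gpD(3)[OF y(2)] by auto
    have "\<delta> p (part (t' (Suc p)) {e} x) = part (t' p) {e} y"
      unfolding x(2) \<delta>_def using lincomb_part[of "b (Suc p)" "t' p" "t' (Suc p)" "a (Suc p)" "{e}" x] apd by simp
    also have "\<dots> = y" using y(1) by (simp add: F_def)
    finally show ?thesis using gradedD[OF graded_free x(1)]
      by (intro bexI[of _ "part (t' (Suc p)) {e} x"]) (simp_all add: F_def part_part)
  qed
  have lc0: "lincomb (b 0) c (a 0) \<in> free R \<beta>" if "c \<in> free R (b 0)" for c
    by (rule lincomb_mem[OF FR a0 that])
  have h_hom: "h \<in> graded_hom n (F 0) M"
  proof -
    have "h c \<in> component M e" if "e \<in> multidegrees n" "c \<in> component (F 0) e" for c e
    proof -
      have c: "c \<in> free R (b 0)" "part (t' 0) {e} c = c" using that(2) by (auto simp: F_def)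
      have "part s {e} (lincomb (b 0) c (a 0)) = lincomb (b 0) c (a 0)"
        using lincomb_part[of "b 0" s "t' 0" "a 0" "{e}" c] a0d c(2) by simp
      then show ?thesis unfolding h_def by (rule \<Phi>_component[OF that(1) lc0[OF c(1)]])
    qed
    moreover have "h (x + y) = h x \<oplus> h y" if "x \<in> free R (b 0)" "y \<in> free R (b 0)" for x y
      unfolding h_def lincomb_add by (rule \<Phi>_add[OF lc0[OF that(1)] lc0[OF that(2)]])
    moreover have "h (f \<bullet> x) = f \<odot> h x" if "f \<in> polys R" "x \<in> free R (b 0)" for f x
      unfolding h_def lincomb_smul by (rule \<Phi>_smul[OF that(1) lc0[OF that(2)]])
    moreover have "h x \<in> carrier M" if "x \<in> free R (b 0)" for x
      unfolding h_def by (rule \<Phi>_closed[OF lc0[OF that]])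
    ultimately show ?thesis unfolding graded_hom_def module_hom_def by (auto simp: F_def simp del: free_module_simps(5))
  qed
  interpret H: cox_module_hom n "F 0" M h
    by (intro cox_module_hom.intro cox_module.intro cox_module_hom_axioms.intro pre_F premodule h_hom)
  have surj: "\<exists>D\<in>multidegrees n. \<exists>u\<in>component (cox n) D. u \<notin> P \<and> (\<exists>y\<in>component (F 0) (D + e). h y = u \<odot> m)"
    if P: "P \<in> proj_points n" and e: "e \<in> multidegrees n" and m: "m \<in> component M e" for P e m
  proof -
    obtain c0 where c0: "c0 \<in> free R \<beta>" "m = \<Phi> c0" using onto comp_carrier[OF e m] by blast
    define c where "c = part s {e} c0"
    have c: "c \<in> free R \<beta>" "part s {e} c = c" using gradedD[OF graded_free c0(1)] by (simp_all add: c_def part_part)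
    have \<Phi>c: "\<Phi> c = m" unfolding c_def c0(2) by (rule \<Phi>_part[OF e c0(1)]) (use m c0(2) in simp)
    have "set [0..<length n] \<subseteq> {..<length n}" by auto
    from nonvanishing_form[OF P this, of "\<lambda>g. d g - lookup e g"]
    obtain D u where D: "D \<in> multidegrees n" "u \<in> component (cox n) D" "u \<notin> P"
      "\<And>g. g < length n \<Longrightarrow> d g - lookup e g \<le> lookup D g" by auto
    have up: "u \<in> polys R" by (rule component_cox_polys[OF D(2)])
    have uc: "u \<bullet> c \<in> free R \<beta>" by (rule submod_smul[OF FR up c(1)])
    have "part s {D + e} (u \<bullet> c) = u \<bullet> part s {x. D + x \<in> {D + e}} c"
      by (rule part_smul_poly) (use D(2) in \<open>simp add: component_cox\<close>)
    then have ucd: "part s {D + e} (u \<bullet> c) = u \<bullet> c" using c(2) by simp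
    \<comment> \<open>the degree of \<open>u\<close> makes up for what the degree of \<open>m\<close> lacks\<close>
    have "D + e \<in> degs_ge_all [0..<length n] d" using D(4) by (fastforce simp: degs_ge_all_def lookup_add)
    then have "part s (degs_ge_all [0..<length n] d) (u \<bullet> c) = u \<bullet> c"
      using ucd part_part[of s "degs_ge_all [0..<length n] d" "{D + e}" "u \<bullet> c"] by simp
    then have "u \<bullet> c \<in> ?Z" using uc by (simp add: in_degs_def)
    then obtain y0 where y0: "y0 \<in> free R (b 0)" "u \<bullet> c - lincomb (b 0) y0 (a 0) \<in> Ker" using g0D(3) by blast
    define y where "y = part (t' 0) {D + e} y0"
    have y: "y \<in> component (F 0) (D + e)"
      using gradedD[OF graded_free y0(1)] by (simp add: y_def F_def part_part)
    have yf: "y \<in> free R (b 0)" using y by (simp add: F_def)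
    have "lincomb (b 0) y (a 0) = part s {D + e} (lincomb (b 0) y0 (a 0))"
      unfolding y_def using lincomb_part[of "b 0" s "t' 0" "a 0" "{D + e}" y0] a0d by simp
    then have "u \<bullet> c - lincomb (b 0) y (a 0) = part s {D + e} (u \<bullet> c - lincomb (b 0) y0 (a 0))"
      by (simp add: part_diff ucd)
    then have k: "u \<bullet> c - lincomb (b 0) y (a 0) \<in> Ker" using gradedD[OF graded_Ker y0(2)] by simp
    have "\<Phi> (u \<bullet> c) = \<Phi> ((u \<bullet> c - lincomb (b 0) y (a 0)) + lincomb (b 0) y (a 0))" by simp
    also have "\<dots> = \<Phi> (u \<bullet> c - lincomb (b 0) y (a 0)) \<oplus> h y"
      unfolding h_def by (rule \<Phi>_add) (use k lc0[OF yf] in \<open>auto simp: Ker_def\<close>)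
    also have "\<dots> = h y" using k \<Phi>_closed[OF lc0[OF yf]] by (simp add: Ker_def h_def)
    finally have "h y = u \<odot> m" using \<Phi>_smul[OF up c(1)] \<Phi>c by simp
    then show ?thesis using D y by blast
  qed
  have "fg_free_complex n F \<delta>"
    unfolding fg_free_complex_def using free_F \<delta>_hom \<delta>\<delta> by (auto simp: F_def)
  moreover have "sheaf_morphism n (sheaf_of n (F 0)) (sheaf_of n M) (sheaf_map n M h)"
    by (rule H.sheaf_map_morphism)
  moreover have "sheaf_surjective n (sheaf_of n (F 0)) (sheaf_of n M) (sheaf_map n M h)"
    by (rule H.sheaf_map_surjective) (rule surj)
  moreover have "sheaf_exact n (sheaf_of n (F 1)) (sheaf_of n (F 0)) (sheaf_of n M)
      (sheaf_map n (F 0) (\<delta> 0)) (sheaf_map n M h)"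
  proof (rule sheaf_map_exact[OF pre_F pre_F premodule])
    show "\<delta> 0 \<in> graded_hom n (F 1) (F 0)" using \<delta>_hom[of 0] by simp
    show "h (\<delta> 0 x) = \<zero>" if "x \<in> carrier (F 1)" for x
      using \<delta>_syz[of x 0] that by (simp add: F_def syz_def Kp_def Ker_def h_def)
    show "\<exists>x\<in>component (F 1) e. \<delta> 0 x = y" if y: "y \<in> component (F 0) e" "h y = \<zero>" for e y
    proof -
      have yf: "y \<in> free R (b 0)" using y(1) by (simp add: F_def)
      then have "y \<in> syz R (b 0) (a 0) (Kp 0)" using y(2) lc0[OF yf] by (simp add: syz_def Kp_def Ker_def h_def)
      then show ?thesis using exact[OF y(1)] by simp
    qed
  qed (rule h_hom)
  moreover have "sheaf_exact n (sheaf_of n (F (Suc (Suc p)))) (sheaf_of n (F (Suc p))) (sheaf_of n (F p))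
        (sheaf_map n (F (Suc p)) (\<delta> (Suc p))) (sheaf_map n (F p) (\<delta> p))" for p
  proof (rule sheaf_map_exact[OF pre_F pre_F pre_F \<delta>_hom \<delta>_hom])
    show "\<delta> p (\<delta> (Suc p) x) = \<zero>\<^bsub>F p\<^esub>" if "x \<in> carrier (F (Suc (Suc p)))" for x
      using \<delta>\<delta>[of x p] that by (simp add: F_def)
    show "\<exists>x\<in>component (F (Suc (Suc p))) e. \<delta> (Suc p) x = y"
      if y: "y \<in> component (F (Suc p)) e" "\<delta> p y = \<zero>\<^bsub>F p\<^esub>" for e y
      using y by (intro exact[OF y(1)]) (simp add: F_def syz_def Kp_def \<delta>_def)
  qed
  ultimately have "virtual_resolution n M F \<delta>" unfolding virtual_resolution_def by blast
  moreover have "complex_length F \<le> enat N"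
    unfolding complex_length_def
  proof (rule Sup_least, elim imageE, clarify)
    fix p assume ne: "carrier (F p) \<noteq> {\<zero>\<^bsub>F p\<^esub>}"
    show "enat p \<le> enat N"
    proof (rule ccontr)
      assume "\<not> enat p \<le> enat N"
      then have "b p = 0" using b0[of p] by simp
      then have "free R (b p) = ({0} :: 'k vec set)"
        by (auto simp: free_def fun_eq_iff vec_apply)
      then show False using ne by (simp add: F_def)
    qed
  qed
  ultimately show ?thesis by blast
qed

end

theorem proposition1p2:
  fixes n :: "nat list" and M :: "('k::field cox_poly, 'm) graded_module"
  assumes "graded_module n M" and "finitely_generated (cox n) M" and "B_saturated n M"
  shows "\<exists>(F :: nat \<Rightarrow> ('k cox_poly, nat \<Rightarrow> 'k cox_poly) graded_module) \<delta>.
           virtual_resolution n M F \<delta> \<and> complex_length F \<le> enat (sum_list n)"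
proof -
  obtain \<beta> \<mu> s where pres: "presentation n M \<beta> \<mu> s"
    and onto: "carrier M \<subseteq> presentation.\<Phi> M \<beta> \<mu> ` free (variables n) \<beta>"
    by (rule homogeneous_presentation[OF assms(1,2)])
  interpret presentation n M \<beta> \<mu> s by (rule pres)
  define V where "V g = {(g, j) | j. j \<le> n ! g}" for g
  have V_image: "V g = (\<lambda>j. (g, j)) ` {..n ! g}" for g by (auto simp: V_def)
  have card_V: "card (V g) = Suc (n ! g)" for g
    unfolding V_image by (subst card_image) (auto simp: inj_on_def)
  have V: "(\<Union>g\<in>set [0..<length n]. V g) = variables n"
    by (auto simp: V_def variables_def)
  have "(\<Sum>g\<leftarrow>[0..<length n]. card (V g) - 1) = sum_list (map ((!) n) [0..<length n])"
    by (simp add: card_V)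
  then have len: "(\<Sum>g\<leftarrow>[0..<length n]. card (V g) - 1) = sum_list n" by (simp add: map_nth)
  have "iterated_ev [0..<length n] (\<lambda>d. has_res (Suc (\<Sum>g\<leftarrow>[0..<length n]. card (V g) - 1)) (\<Union>g\<in>set [0..<length n]. V g) s
      (trunc [0..<length n] d s (free (variables n) \<beta>)) Ker) (\<lambda>_. 0)"
    by (rule truncation) (use graded_pair_presentation V in \<open>auto simp: V_image\<close>)
  then obtain d where "has_res (Suc (sum_list n)) (variables n) s
      (trunc [0..<length n] d s (free (variables n) \<beta>)) Ker"
    unfolding len V using iterated_ev_obtain by blast
  then show ?thesis by (rule virtual_resolution_of_truncation[OF onto])
qed

end
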